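(* Let $V \subset \mathbb{R}^{3}$ be an affine $2$-plane which is not a linear subspace (i.e. $0 \notin V$) and such that $V \cap S^{2}$ is a non-degenerate circle (i.e. a circle of positive radius). For $e \in S^{2}$ let $\pi_{e}(z) = z \cdot e$, $z \in \mathbb{R}^{3}$. Let $K \subset \mathbb{R}^{3}$ be an analytic set. Then: (1) $\dim_{\mathrm{H}} \pi_{e}(K) = \min\{\dim_{\mathrm{H}} K, 1\}$ for $\mathcal{H}^{1}$ almost every $e \in S^{2} \cap V$. (2) If $0 < \dim_{\mathrm{H}} K \leq 1$ and $0 \leq t < \dim_{\mathrm{H}} K$, then there is a set $E \subset S^{2} \cap V$ with $$\dim_{\mathrm{H}} E \leq \frac{\dim_{\mathrm{H}} K + t}{2\dim_{\mathrm{H}} K} < 1$$ such that $\dim_{\mathrm{H}} \pi_{e}(K) \geq t$ for all $e \in (S^{2}\cap V) \setminus E$.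
   Context: $S^{2}$ is the unit sphere in $\mathbb{R}^{3}$, $\mathcal{H}^{1}$ is $1$-dimensional Hausdorff measure, and $\dim_{\mathrm{H}}$ denotes Hausdorff dimension. $\pi_e$ represents the orthogonal projection onto the line spanned by $e$. "Analytic" means analytic (Suslin) set in the sense of descriptive set theory. *)

theory Defs
  imports "HOL-Analysis.Analysis"
begin

(* The convention is diam(U)^0 = 1 for nonempty U, so that the 0-dimensional measure counts points;
   powr alone would give 0 powr 0 = 0 on singletons. *)
definition hausdorff_gauge :: "real \<Rightarrow> 'a::metric_space set \<Rightarrow> ennreal" where
  "hausdorff_gauge s U =
     (if U = {} then 0 else if s = 0 then 1 else ennreal (diameter U powr s))"

(* Boundedness is required explicitly because diameter has no meaningful value on unbounded sets.
   Finite covers are included by padding with the empty set. *)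
definition hausdorff_content :: "real \<Rightarrow> real \<Rightarrow> 'a::metric_space set \<Rightarrow> ennreal" where
  "hausdorff_content s \<delta> A =
     (INF U \<in> {U :: nat \<Rightarrow> 'a set.
                 A \<subseteq> (\<Union>i. U i) \<and> (\<forall>i. bounded (U i) \<and> diameter (U i) \<le> \<delta>)}.
        (\<Sum>i. hausdorff_gauge s (U i)))"

(* The content grows as \<delta> decreases to 0, so the supremum is the limit. This is the outer measure,
   defined on all sets and without a normalising constant; for s = 1 it is length on curves. *)
definition hausdorff_measure :: "real \<Rightarrow> 'a::metric_space set \<Rightarrow> ennreal" where
  "hausdorff_measure s A = (SUP \<delta> \<in> {0<..}. hausdorff_content s \<delta> A)"

(* In particular the empty set has dimension 0. *)
definition hausdorff_dim :: "'a::metric_space set \<Rightarrow> ereal" where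
  "hausdorff_dim A = (INF s \<in> {s::real. 0 \<le> s \<and> hausdorff_measure s A = 0}. ereal s)"

(* "P holds for H^s almost every point of A" with respect to an outer measure: the exceptional
   set, which is not assumed measurable, is null. *)
definition hausdorff_ae :: "real \<Rightarrow> 'a::metric_space set \<Rightarrow> ('a \<Rightarrow> bool) \<Rightarrow> bool" where
  "hausdorff_ae s A P \<longleftrightarrow> hausdorff_measure s {x \<in> A. \<not> P x} = 0"

(* nat \<Rightarrow> nat carries the product of the discrete topologies, i.e. it is the Baire space. *)
definition analytic_set :: "'a::topological_space set \<Rightarrow> bool" where
  "analytic_set A \<longleftrightarrow>
     A = {} \<or> (\<exists>f :: (nat \<Rightarrow> nat) \<Rightarrow> 'a. continuous_on UNIV f \<and> A = range f)"

definition nondegenerate_circle :: "'a::euclidean_space set \<Rightarrow> bool" where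
  "nondegenerate_circle C \<longleftrightarrow>
     (\<exists>P c r. affine P \<and> aff_dim P = 2 \<and> c \<in> P \<and> 0 < r \<and> C = P \<inter> sphere c r)"

definition proj :: "'a::real_inner \<Rightarrow> 'a \<Rightarrow> real" where
  "proj e z = z \<bullet> e"

end

theory Submission
  imports Defs
begin

text \<open>
  The rational parametrization of the circle turns the projections into evaluations at \<open>t\<close> of the
  quadratic polynomials whose coefficients are the coordinates of the points of a linear image of
  \<open>K\<close>. Put a Frostman distribution of exponent \<open>s\<close> on it. If the projection with parameter \<open>t\<close> is
  small, then at some dyadic scale \<open>\<delta>\<close> a large part of the mass consists of points sharing their
  \<open>\<delta>\<close>-interval with much mass. Pairs of points whose difference polynomial has a large discriminant
  rarely share an interval, as in Kaufman's argument for the full family of projections.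

  The remaining pairs are tangent: after a small vertical shift, one graph lies below the other
  exactly over one short interval, a lens. Since two of the graphs meet at most twice, the lenses
  formed by two curves with two others have positions whose orders are tied to each other by a sign
  identity, and expanding a sum of squares of order kernels shows that two curves have few common
  neighbours. This is a weighted form of the Marcus--Tardos theorem on intersection reverse
  sequences, and it plays the role of Wolff's bound for circle tangencies. At scale \<open>\<delta>\<close> it bounds
  the measure of the bad parameters by \<open>\<delta>\<close> to the power \<open>(1 - t/s)/2\<close>, up to logarithms.
\<close>

section \<open>Lens systems\<close>

text \<open>Two tangent quadratics at distance about 1 stay within
  \<open>\<delta> = 1 / 2 ^ k\<close> of each other over a parameter interval of length about
  \<open>sqrt \<delta>\<close>, so counting shared parameters pair by pair loses too much; tangent
  pairs must be bounded collectively. Masses replace cardinalities throughout, so no multiplicity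
  has to be made uniform before the combinatorial bound applies. The order identity by itself only
  yields a sign; localizing it to dyadic cells of positions turns that sign into sums of squares, at
  the price of powers of \<open>k\<close>.

  The exponent arises as follows. A cell is heavy if its mass is at least \<open>m\<close>, about
  \<open>\<delta> powr t\<close>. With \<open>C * (1 / \<Lambda>) powr s = m / 2\<close>, only pairs
  at distance at least about \<open>1 / \<Lambda>\<close> matter. Up to powers of \<open>k\<close>,
  transversal pairs then account for \<open>\<Lambda>\<close> bad grid parameters and tangent pairs
  for \<open>sqrt (2 ^ k * \<Lambda>)\<close>. As \<open>\<Lambda>\<close> is about
  \<open>2 powr (k * t / s)\<close>, the second term is \<open>2 powr (k * (1 + t / s) / 2)\<close>,
  whence the dimension \<open>(1 + t / s) / 2\<close>, where \<open>s\<close> approaches the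
  dimension of \<open>K\<close>.\<close>

lemma sum_swap3:
  fixes f :: "'c \<Rightarrow> 'a \<Rightarrow> 'b \<Rightarrow> 'd::comm_monoid_add"
  shows "(\<Sum>x\<in>A. \<Sum>y\<in>B. \<Sum>i\<in>C. f i x y) = (\<Sum>i\<in>C. \<Sum>x\<in>A. \<Sum>y\<in>B. f i x y)"
proof -
  have "(\<Sum>x\<in>A. \<Sum>y\<in>B. \<Sum>i\<in>C. f i x y) = (\<Sum>x\<in>A. \<Sum>i\<in>C. \<Sum>y\<in>B. f i x y)"
    by (intro sum.cong refl sum.swap)
  also have "\<dots> = (\<Sum>i\<in>C. \<Sum>x\<in>A. \<Sum>y\<in>B. f i x y)" by (rule sum.swap)
  finally show ?thesis .
qed

lemma sum_same_class_eq_sum_squares: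
  fixes g :: "'a \<Rightarrow> real"
  assumes "finite A"
  shows "(\<Sum>a\<in>A. \<Sum>b\<in>A. if h a = h b then g a * g b else 0)
       = (\<Sum>s\<in>h ` A. (\<Sum>a\<in>{a\<in>A. h a = s}. g a)\<^sup>2)"
proof -
  have "(\<Sum>s\<in>h ` A. (\<Sum>a\<in>{a\<in>A. h a = s}. g a)\<^sup>2)
      = (\<Sum>s\<in>h ` A. \<Sum>a\<in>{a\<in>A. h a = s}. \<Sum>b\<in>{b\<in>A. h b = h a}. g a * g b)"
    by (intro sum.cong refl) (auto simp: power2_eq_square sum_product intro!: sum.cong)
  also have "\<dots> = (\<Sum>a\<in>A. \<Sum>b\<in>{b\<in>A. h b = h a}. g a * g b)"
    using sum.image_gen[OF assms, of "\<lambda>a. \<Sum>b\<in>{b\<in>A. h b = h a}. g a * g b" h] by simp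
  also have "\<dots> = (\<Sum>a\<in>A. \<Sum>b\<in>A. if h a = h b then g a * g b else 0)"
    unfolding sum.inter_filter[OF assms] by (intro sum.cong refl) auto
  finally show ?thesis by simp
qed

section \<open>Dyadic cells of lens positions\<close>

definition dcell :: "nat \<Rightarrow> real \<Rightarrow> int" where
  "dcell i p = \<lfloor>2 ^ i * p\<rfloor>"

lemma dcell_mono: "p \<le> q \<Longrightarrow> dcell i p \<le> dcell i q"
  unfolding dcell_def by (intro floor_mono mult_left_mono) auto

lemma dcell_Suc: "dcell (Suc i) p div 2 = dcell i p"
proof -
  have "\<lfloor>2 ^ Suc i * p / of_int 2\<rfloor> = \<lfloor>2 ^ Suc i * p\<rfloor> div 2"
    by (rule floor_divide_real_eq_div) simp
  then show ?thesis by (simp add: dcell_def)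
qed

lemma dcell_less_iff: "dcell i p < dcell i q \<Longrightarrow> p < q"
  using dcell_mono[of q p i] by (meson not_le)

lemma dcell_eq_imp_dist:
  assumes "dcell i p = dcell i q"
  shows "\<bar>p - q\<bar> < 1 / 2 ^ i"
proof -
  have "\<bar>2 ^ i * p - 2 ^ i * q\<bar> < 1"
    using assms unfolding dcell_def by linarith
  then have "2 ^ i * \<bar>p - q\<bar> < 1"
    by (simp add: right_diff_distrib[symmetric] abs_mult)
  then show ?thesis by (simp add: field_simps)
qed

lemma dcell_eq_downward:
  assumes "dcell i p = dcell i q" "j \<le> i"
  shows "dcell j p = dcell j q"
  using assms(2,1)
  by (induction rule: dec_induct) (auto, metis dcell_Suc)

text \<open>Two positions lying in different cells of level \<open>l\<close> are first separated at some level \<open>i\<close>,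
  in the two halves of a cell of level \<open>i - 1\<close>. A zero between the positions pins that cell down.\<close>

lemma sum_squares_cells_ge:
  fixes g :: "'b \<Rightarrow> real" and p q :: "'b \<Rightarrow> real"
  assumes fin: "finite A" and g: "\<And>a. a \<in> A \<Longrightarrow> 0 \<le> g a"
    and rp: "\<And>a. a \<in> A \<Longrightarrow> 0 \<le> p a \<and> p a < 1"
    and rq: "\<And>a. a \<in> A \<Longrightarrow> 0 \<le> q a \<and> q a < 1"
    and sep: "\<And>a. a \<in> A \<Longrightarrow> 1 / 2 ^ l \<le> \<bar>p a - q a\<bar>"
    and Z: "finite Z" "card Z \<le> 2"
    and btw: "\<And>a. a \<in> A \<Longrightarrow> \<exists>z\<in>Z. min (p a) (q a) \<le> z \<and> z \<le> max (p a) (q a)"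
  shows "(\<Sum>a\<in>A. g a)\<^sup>2 \<le> 4 * real l * (\<Sum>i\<in>{1..l}. \<Sum>a\<in>A. \<Sum>b\<in>A.
     if dcell i (p a) = dcell i (p b) \<and> dcell i (q a) = dcell i (q b)
     then (g a * sgn (q a - p a)) * (g b * sgn (q b - p b)) else 0)"
proof -
  define lv where "lv a = (LEAST i. dcell i (p a) \<noteq> dcell i (q a))" for a
  define cls where "cls a = (lv a, dcell (lv a) (p a), dcell (lv a) (q a))" for a
  define C where "C = cls ` A"
  define H where "H i a = (dcell i (p a), dcell i (q a))" for i a
  define G where "G a = g a * sgn (q a - p a)" for a
  have ex: "dcell l (p a) \<noteq> dcell l (q a)" if "a \<in> A" for a
    using dcell_eq_imp_dist[of l "p a" "q a"] sep[OF that] by auto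
  have lv_ne: "dcell (lv a) (p a) \<noteq> dcell (lv a) (q a)" if "a \<in> A" for a
    unfolding lv_def by (rule LeastI[of _ l]) (rule ex[OF that])
  have lv_le: "lv a \<le> l" if "a \<in> A" for a
    unfolding lv_def by (rule Least_le) (rule ex[OF that])
  have c0: "dcell 0 (p a) = 0 \<and> dcell 0 (q a) = 0" if "a \<in> A" for a
    using rp[OF that] rq[OF that] by (simp add: dcell_def floor_eq_iff)
  have lv_pos: "1 \<le> lv a" if "a \<in> A" for a
    using lv_ne[OF that] c0[OF that] by (cases "lv a") auto
  have below: "dcell (lv a - 1) (p a) = dcell (lv a - 1) (q a)" if "a \<in> A" for a
    using not_less_Least[of "lv a - 1" "\<lambda>i. dcell i (p a) \<noteq> dcell i (q a)"] lv_pos[OF that]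
    unfolding lv_def[symmetric] by auto
  \<comment> \<open>A class is determined by its level, by the zero \<open>z\<close> in the common
    parent cell, and by which half of that cell holds \<open>p a\<close>: at most
    \<open>l * 2 * 2\<close> classes.\<close>
  let ?f = "\<lambda>(i, z, b). (i, 2 * dcell (i - 1) z + (if b then 0 else 1),
                            2 * dcell (i - 1) z + (if b then 1 else 0))"
  have "C \<subseteq> ?f ` ({1..l} \<times> Z \<times> (UNIV::bool set))"
  proof
    fix s assume "s \<in> C"
    then obtain a where a: "a \<in> A" "s = cls a" unfolding C_def by auto
    obtain z where z: "z \<in> Z" "min (p a) (q a) \<le> z" "z \<le> max (p a) (q a)" using btw[OF a(1)] by auto
    define i where "i = lv a"
    have i: "1 \<le> i" "i \<le> l" using lv_pos lv_le a by (auto simp: i_def)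
    have zc: "dcell (i - 1) z = dcell (i - 1) (p a)" 
      using dcell_mono[OF z(2), of "i-1"] dcell_mono[OF z(3), of "i-1"] below[OF a(1)]
      unfolding i_def by (auto simp: min_def max_def split: if_splits)
    have dp: "dcell i (p a) div 2 = dcell (i - 1) z"
      using dcell_Suc[of "i-1" "p a"] i zc by simp
    have dq: "dcell i (q a) div 2 = dcell (i - 1) z"
      using dcell_Suc[of "i-1" "q a"] i zc below[OF a(1)] i_def by simp
    have ne: "dcell i (p a) \<noteq> dcell i (q a)" using lv_ne[OF a(1)] i_def by simp
    have "cls a = ?f (i, z, dcell i (p a) < dcell i (q a))"
      unfolding cls_def i_def[symmetric] using dp dq ne by auto
    then show "s \<in> ?f ` ({1..l} \<times> Z \<times> (UNIV::bool set))"
      using a z i by (intro image_eqI[of _ _ "(i, z, dcell i (p a) < dcell i (q a))"]) auto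
  qed
  then have "card C \<le> card ({1..l} \<times> Z \<times> (UNIV::bool set))"
    by (rule surj_card_le[rotated]) (use Z in auto)
  also have "\<dots> = l * (card Z * 2)" by (simp add: card_cartesian_product)
  also have "\<dots> \<le> l * (2 * 2)" using Z(2) by (intro mult_le_mono) auto
  finally have cardC: "card C \<le> 4 * l" by simp
  have cls_set: "{a\<in>A. cls a = (i, S, S')} = {a\<in>A. H i a = (S, S')}"
    if "(i, S, S') \<in> C" for i S S'
  proof -
    from that obtain b where b: "b \<in> A" "cls b = (i,S,S')" unfolding C_def by auto
    then have bi: "i = lv b" "S = dcell i (p b)" "S' = dcell i (q b)" by (auto simp: cls_def)
    have i1: "1 \<le> i" using lv_pos b bi by auto
    have SS: "S \<noteq> S'" "S div 2 = S' div 2"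
      using lv_ne[OF b(1)] bi below[OF b(1)] dcell_Suc[of "i-1" "p b"] dcell_Suc[of "i-1" "q b"] i1 by auto
    have "cls a = (i,S,S')" if a: "a \<in> A" "H i a = (S,S')" for a
    proof -
      have H: "dcell i (p a) = S" "dcell i (q a) = S'" using a by (auto simp: H_def)
      have eq: "dcell (i-1) (p a) = dcell (i-1) (q a)"
        using SS(2) H dcell_Suc[of "i-1" "p a"] dcell_Suc[of "i-1" "q a"] i1 by simp
      have "lv a \<le> i" unfolding lv_def by (rule Least_le) (use H SS in auto)
      moreover have "\<not> lv a \<le> i - 1"
        using dcell_eq_downward[OF eq] lv_ne[OF a(1)] by auto
      ultimately have "lv a = i" by simp
      then show ?thesis using H by (simp add: cls_def)
    qed
    then show ?thesis by (auto simp: cls_def H_def)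
  qed
  \<comment> \<open>The members of a class have \<open>p a\<close> and \<open>q a\<close> in the
    same two distinct cells, so the sign of \<open>q a - p a\<close> is constant on the class and
    disappears on squaring.\<close>
  have sq: "(\<Sum>a\<in>{a\<in>A. cls a = s}. g a)\<^sup>2 = (\<Sum>a\<in>{a\<in>A. H (fst s) a = snd s}. G a)\<^sup>2" if "s \<in> C" for s
  proof -
    obtain i S S' where s: "s = (i,S,S')" by (cases s) auto
    from that obtain b where b: "b \<in> A" "cls b = (i,S,S')" unfolding C_def s by auto
    then have SS: "S \<noteq> S'" using lv_ne[OF b(1)] by (auto simp: cls_def)
    have "sgn (q a - p a) = sgn (of_int (S' - S))" if "a \<in> A" "H i a = (S,S')" for a
    proof (cases "S < S'")
      case True
      then have "p a < q a" using that dcell_less_iff[of i "p a" "q a"] by (auto simp: H_def)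
      then show ?thesis using True by simp
    next
      case False
      then have "S' < S" using SS by auto
      then have "q a < p a" using that dcell_less_iff[of i "q a" "p a"] by (auto simp: H_def)
      then show ?thesis using \<open>S' < S\<close> by simp
    qed
    then have "(\<Sum>a\<in>{a\<in>A. H i a = (S,S')}. G a) = (\<Sum>a\<in>{a\<in>A. H i a = (S,S')}. g a * sgn (of_int (S' - S)))"
      unfolding G_def by (intro sum.cong) auto
    also have "\<dots> = (\<Sum>a\<in>{a\<in>A. H i a = (S,S')}. g a) * sgn (of_int (S' - S))"
      by (simp add: sum_distrib_right)
    finally have e: "(\<Sum>a\<in>{a\<in>A. H i a = (S,S')}. G a) = (\<Sum>a\<in>{a\<in>A. H i a = (S,S')}. g a) * sgn (of_int (S' - S))" .
    have "(sgn (real_of_int (S' - S)))\<^sup>2 = 1" using SS by (simp add: sgn_if)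
    then show ?thesis using cls_set[of i S S'] that s by (simp add: e power_mult_distrib)
  qed
  have "(\<Sum>a\<in>A. g a) = (\<Sum>s\<in>C. \<Sum>a\<in>{a\<in>A. cls a = s}. g a)"
    unfolding C_def by (rule sum.image_gen[OF fin])
  then have "(\<Sum>a\<in>A. g a)\<^sup>2 \<le> real (card C) * (\<Sum>s\<in>C. (\<Sum>a\<in>{a\<in>A. cls a = s}. g a)\<^sup>2)"
    using Cauchy_Schwarz_ineq_sum[of "\<lambda>_. 1" "\<lambda>s. \<Sum>a\<in>{a\<in>A. cls a = s}. g a" C] by simp
  also have "\<dots> = real (card C) * (\<Sum>s\<in>C. (\<Sum>a\<in>{a\<in>A. H (fst s) a = snd s}. G a)\<^sup>2)"
    using sq by (intro arg_cong[where f="\<lambda>x. _ * x"] sum.cong) auto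
  also have "\<dots> \<le> (4 * real l) * (\<Sum>s\<in>C. (\<Sum>a\<in>{a\<in>A. H (fst s) a = snd s}. G a)\<^sup>2)"
    using cardC by (intro mult_right_mono sum_nonneg) (auto simp flip: of_nat_mult)
  \<comment> \<open>Passing to all pairs of cells at all levels only adds squares and removes the
    reference to the level of first separation.\<close>
  also have "\<dots> \<le> (4 * real l) * (\<Sum>s\<in>(SIGMA i:{1..l}. H i ` A). (\<Sum>a\<in>{a\<in>A. H (fst s) a = snd s}. G a)\<^sup>2)"
  proof (intro mult_left_mono sum_mono2)
    show "C \<subseteq> (SIGMA i:{1..l}. H i ` A)"
      unfolding C_def cls_def H_def using lv_pos lv_le by auto
  qed (use fin in auto)
  also have "\<dots> = (4 * real l) * (\<Sum>i\<in>{1..l}. \<Sum>s\<in>H i ` A. (\<Sum>a\<in>{a\<in>A. H i a = s}. G a)\<^sup>2)"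
    by (subst sum.Sigma) (use fin in \<open>auto simp: case_prod_beta\<close>)
  also have "\<dots> = (4 * real l) * (\<Sum>i\<in>{1..l}. \<Sum>a\<in>A. \<Sum>b\<in>A. if H i a = H i b then G a * G b else 0)"
    by (simp add: sum_same_class_eq_sum_squares[OF fin])
  finally show ?thesis unfolding H_def G_def by (simp cong: if_cong)
qed


text \<open>Here \<open>p\<close> and \<open>q\<close> are the lens positions on two fixed curves.
  Where all four distances are at least \<open>\<eta>\<close>, \<open>order\<close> turns the
  product of the two order kernels into minus the product of the displacement signs. The exceptional
  pairs are those with \<open>q a\<close> close to \<open>p a\<close> for one member, which cost
  \<open>2 * (n * K)\<close>, and those lying close together on one of the curves, which cost
  \<open>2 * M * K\<close>.\<close>

lemma lens_pair_bound:
  fixes g :: "'b \<Rightarrow> real" and p q :: "'b \<Rightarrow> real"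
  assumes fin: "finite Y" and g: "\<And>a. a \<in> Y \<Longrightarrow> 0 \<le> g a"
    and locp: "\<And>a. a \<in> Y \<Longrightarrow> (\<Sum>b\<in>{b\<in>Y. \<bar>p b - p a\<bar> < \<eta>}. g b) \<le> M"
    and locq: "\<And>a. a \<in> Y \<Longrightarrow> (\<Sum>b\<in>{b\<in>Y. \<bar>q b - q a\<bar> < \<eta>}. g b) \<le> M"
    and order: "\<And>a b. a \<in> Y \<Longrightarrow> b \<in> Y \<Longrightarrow> 0 < g a \<Longrightarrow> 0 < g b \<Longrightarrow> \<eta> \<le> \<bar>p b - p a\<bar> \<Longrightarrow>
       \<eta> \<le> \<bar>q b - q a\<bar> \<Longrightarrow> \<eta> \<le> \<bar>q a - p a\<bar> \<Longrightarrow> \<eta> \<le> \<bar>q b - p b\<bar> \<Longrightarrow>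
       sgn (p b - p a) * sgn (q b - q a) = - (sgn (q a - p a) * sgn (q b - p b))"
  defines "A \<equiv> {a\<in>Y. 0 < g a \<and> \<eta> \<le> \<bar>q a - p a\<bar>}"
  defines "K \<equiv> \<Sum>a\<in>Y. g a" and "n \<equiv> \<Sum>a\<in>{a\<in>Y. \<bar>q a - p a\<bar> < \<eta>}. g a"
  shows "(\<Sum>a\<in>Y. \<Sum>b\<in>Y. if (dcell i (p a) = dcell i (p b) \<and> \<eta> \<le> \<bar>p b - p a\<bar>) \<and>
             (dcell i (q a) = dcell i (q b) \<and> \<eta> \<le> \<bar>q b - q a\<bar>)
           then g a * g b * (sgn (p b - p a) * sgn (q b - q a)) else 0)
     \<le> 2 * (n * K) + 2 * M * K - (\<Sum>a\<in>A. \<Sum>b\<in>A.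
     if dcell i (p a) = dcell i (p b) \<and> dcell i (q a) = dcell i (q b)
     then (g a * sgn (q a - p a)) * (g b * sgn (q b - p b)) else 0)"
proof -
  define e where "e a b = (if dcell i (p a) = dcell i (p b) \<and> dcell i (q a) = dcell i (q b)
     then (g a * sgn (q a - p a)) * (g b * sgn (q b - p b)) else 0)" for a b
  define near where "near a = (if \<bar>q a - p a\<bar> < \<eta> then g a else 0)" for a
  have eA: "(\<Sum>a\<in>A. \<Sum>b\<in>A. e a b) = (\<Sum>a\<in>Y. \<Sum>b\<in>Y. if a \<in> A \<and> b \<in> A then e a b else 0)"
  proof -
    have AY: "A = {a\<in>Y. a \<in> A}" unfolding A_def by auto
    have "(\<Sum>a\<in>A. \<Sum>b\<in>A. e a b) = (\<Sum>a\<in>{a\<in>Y. a\<in>A}. \<Sum>b\<in>{a\<in>Y. a\<in>A}. e a b)"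
      using AY by simp
    also have "\<dots> = (\<Sum>a\<in>Y. if a \<in> A then (\<Sum>b\<in>Y. if b \<in> A then e a b else 0) else 0)"
      by (simp only: sum.inter_filter[OF fin])
    also have "\<dots> = (\<Sum>a\<in>Y. \<Sum>b\<in>Y. if a \<in> A \<and> b \<in> A then e a b else 0)"
      by (intro sum.cong refl) auto
    finally show ?thesis .
  qed
  have absle: "\<bar>sgn x * sgn y\<bar> \<le> 1" for x y :: real
    by (simp add: sgn_if)
  have eabs: "\<bar>e a b\<bar> \<le> g a * g b" if "a \<in> Y" "b \<in> Y" for a b
  proof -
    have "\<bar>(g a * sgn (q a - p a)) * (g b * sgn (q b - p b))\<bar> = (g a * g b) * \<bar>sgn (q a - p a) * sgn (q b - p b)\<bar>"
      using g[OF that(1)] g[OF that(2)] by (simp add: abs_mult)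
    also have "\<dots> \<le> g a * g b * 1"
      using g[OF that(1)] g[OF that(2)] by (intro mult_left_mono absle) auto
    finally show ?thesis unfolding e_def using g[OF that(1)] g[OF that(2)] by auto
  qed
  have "(\<Sum>a\<in>Y. \<Sum>b\<in>Y. if (dcell i (p a) = dcell i (p b) \<and> \<eta> \<le> \<bar>p b - p a\<bar>) \<and>
             (dcell i (q a) = dcell i (q b) \<and> \<eta> \<le> \<bar>q b - q a\<bar>)
           then g a * g b * (sgn (p b - p a) * sgn (q b - q a)) else 0)
    \<le> (\<Sum>a\<in>Y. \<Sum>b\<in>Y. near a * g b + g a * near b
        + (g a * (if \<bar>p b - p a\<bar> < \<eta> then g b else 0) + g a * (if \<bar>q b - q a\<bar> < \<eta> then g b else 0))
        - (if a \<in> A \<and> b \<in> A then e a b else 0))" (is "_ \<le> (\<Sum>a\<in>Y. \<Sum>b\<in>Y. ?r a b)")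
  proof (intro sum_mono)
    fix a b assume ab: "a \<in> Y" "b \<in> Y"
    let ?l = "if (dcell i (p a) = dcell i (p b) \<and> \<eta> \<le> \<bar>p b - p a\<bar>) \<and>
             (dcell i (q a) = dcell i (q b) \<and> \<eta> \<le> \<bar>q b - q a\<bar>)
           then g a * g b * (sgn (p b - p a) * sgn (q b - q a)) else 0"
    have ga: "0 \<le> g a" "0 \<le> g b" "0 \<le> g a * g b" using g ab by auto
    have na: "0 \<le> near a" "0 \<le> near b" using ga by (auto simp: near_def)
    have l1: "?l \<le> g a * g b"
      using ga(3) mult_left_mono[of "sgn (p b - p a) * sgn (q b - q a)" 1 "g a * g b"]
        absle[of "p b - p a" "q b - q a"] by auto
    consider "g a = 0 \<or> g b = 0" | "\<not> (g a = 0 \<or> g b = 0)" "a \<notin> A \<or> b \<notin> A"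
      | "\<not> (g a = 0 \<or> g b = 0)" "a \<in> A" "b \<in> A" by blast
    then show "?l \<le> ?r a b"
    proof cases
      case 1
      then show ?thesis by (auto simp: near_def A_def)
    next
      case 2
      then have "\<bar>q a - p a\<bar> < \<eta> \<or> \<bar>q b - p b\<bar> < \<eta>" using ga ab unfolding A_def by auto
      then have "g a * g b \<le> near a * g b + g a * near b" using ga na by (auto simp: near_def)
      moreover have "0 \<le> g a * (if \<bar>p b - p a\<bar> < \<eta> then g b else 0) + g a * (if \<bar>q b - q a\<bar> < \<eta> then g b else 0)"
        using ga by auto
      ultimately show ?thesis using l1 2 by auto
    next
      case 3
      show ?thesis
      proof (cases "\<eta> \<le> \<bar>p b - p a\<bar> \<and> \<eta> \<le> \<bar>q b - q a\<bar>")
        case True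
        have "sgn (p b - p a) * sgn (q b - q a) = - (sgn (q a - p a) * sgn (q b - p b))"
          using 3 True ab by (intro order) (auto simp: A_def)
        then have "?l = - e a b" using True by (auto simp: e_def)
        then show ?thesis using 3 ga na by (auto intro!: add_nonneg_nonneg)
      next
        case False
        \<comment> \<open>The left side vanishes, but \<open>- e a b\<close> on the right may be
          negative; the closeness terms pay for it.\<close>
        then have "?l = 0" by auto
        moreover have "g a * g b \<le> g a * (if \<bar>p b - p a\<bar> < \<eta> then g b else 0) + g a * (if \<bar>q b - q a\<bar> < \<eta> then g b else 0)"
          using False ga by auto
        moreover have "e a b \<le> g a * g b" using eabs[OF ab] by linarith
        moreover have "0 \<le> near a * g b" "0 \<le> g a * near b" using ga na by auto
        ultimately show ?thesis using 3 by simp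
      qed
    qed
  qed
  also have "\<dots> = (\<Sum>a\<in>Y. near a) * K + K * (\<Sum>a\<in>Y. near a)
      + (\<Sum>a\<in>Y. g a * (\<Sum>b\<in>Y. if \<bar>p b - p a\<bar> < \<eta> then g b else 0))
      + (\<Sum>a\<in>Y. g a * (\<Sum>b\<in>Y. if \<bar>q b - q a\<bar> < \<eta> then g b else 0))
      - (\<Sum>a\<in>A. \<Sum>b\<in>A. e a b)"
    unfolding eA K_def
    by (simp add: sum.distrib sum_subtractf flip: sum_distrib_left sum_distrib_right)
  also have "\<dots> \<le> n * K + K * n + (\<Sum>a\<in>Y. g a * M) + (\<Sum>a\<in>Y. g a * M) - (\<Sum>a\<in>A. \<Sum>b\<in>A. e a b)"
  proof -
    have near_n: "(\<Sum>a\<in>Y. near a) = n" unfolding near_def n_def by (simp add: sum.inter_filter[OF fin])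
    have "(\<Sum>a\<in>Y. g a * (\<Sum>b\<in>Y. if \<bar>p b - p a\<bar> < \<eta> then g b else 0)) \<le> (\<Sum>a\<in>Y. g a * M)"
      using locp g by (intro sum_mono mult_left_mono) (auto simp: sum.inter_filter[OF fin, symmetric])
    moreover have "(\<Sum>a\<in>Y. g a * (\<Sum>b\<in>Y. if \<bar>q b - q a\<bar> < \<eta> then g b else 0)) \<le> (\<Sum>a\<in>Y. g a * M)"
      using locq g by (intro sum_mono mult_left_mono) (auto simp: sum.inter_filter[OF fin, symmetric])
    ultimately show ?thesis unfolding near_n by linarith
  qed
  also have "\<dots> = 2 * (n * K) + 2 * M * K - (\<Sum>a\<in>A. \<Sum>b\<in>A. e a b)"
    by (simp only: K_def sum_distrib_right[symmetric]) (simp add: algebra_simps)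
  finally show ?thesis unfolding e_def .
qed

text \<open>Think of \<open>X\<close> and \<open>Y\<close> as families of curves. The weight \<open>F x a\<close> is positive only if the curve of \<open>a\<close> dips
  below that of \<open>x\<close> near the position \<open>\<theta> x a\<close> and stays above it elsewhere. Curves that meet
  at most twice then satisfy \<open>order\<close> and the separation properties \<open>sepX\<close> and \<open>sepY\<close>.\<close>

locale lens_system =
  fixes X :: "'a set" and Y :: "'b set" and mu :: "'a \<Rightarrow> real" and nu :: "'b \<Rightarrow> real"
    and F \<theta> :: "'a \<Rightarrow> 'b \<Rightarrow> real" and \<eta> M :: real and l :: nat
  assumes finX: "finite X" and finY: "finite Y"
    and mu: "x \<in> X \<Longrightarrow> 0 \<le> mu x" and nu: "a \<in> Y \<Longrightarrow> 0 \<le> nu a"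
    and F_ge: "x \<in> X \<Longrightarrow> a \<in> Y \<Longrightarrow> 0 \<le> F x a" and F_le: "x \<in> X \<Longrightarrow> a \<in> Y \<Longrightarrow> F x a \<le> 1"
    and M_ge: "0 \<le> M"
    and locX: "x \<in> X \<Longrightarrow> (\<Sum>a\<in>{a\<in>Y. \<bar>\<theta> x a - t\<bar> < \<eta>}. nu a * F x a) \<le> M"
    and locY: "a \<in> Y \<Longrightarrow> (\<Sum>x\<in>{x\<in>X. \<bar>\<theta> x a - t\<bar> < \<eta>}. mu x * F x a) \<le> M"
    and range: "x \<in> X \<Longrightarrow> a \<in> Y \<Longrightarrow> 0 < F x a \<Longrightarrow> 0 \<le> \<theta> x a \<and> \<theta> x a < 1"
    and eta: "1 / 2 ^ l \<le> \<eta>" and l: "1 \<le> l"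
    and order: "x \<in> X \<Longrightarrow> y \<in> X \<Longrightarrow> a \<in> Y \<Longrightarrow> b \<in> Y \<Longrightarrow>
       0 < F x a \<Longrightarrow> 0 < F x b \<Longrightarrow> 0 < F y a \<Longrightarrow> 0 < F y b \<Longrightarrow>
       \<eta> \<le> \<bar>\<theta> x b - \<theta> x a\<bar> \<Longrightarrow> \<eta> \<le> \<bar>\<theta> y b - \<theta> y a\<bar> \<Longrightarrow>
       \<eta> \<le> \<bar>\<theta> y a - \<theta> x a\<bar> \<Longrightarrow> \<eta> \<le> \<bar>\<theta> y b - \<theta> x b\<bar> \<Longrightarrow>
       sgn (\<theta> x b - \<theta> x a) * sgn (\<theta> y b - \<theta> y a) = - (sgn (\<theta> y a - \<theta> x a) * sgn (\<theta> y b - \<theta> x b))"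
    and sepX: "x \<in> X \<Longrightarrow> y \<in> X \<Longrightarrow> \<exists>Z. finite Z \<and> card Z \<le> 2 \<and>
       (\<forall>a\<in>Y. 0 < F x a \<longrightarrow> 0 < F y a \<longrightarrow> \<eta> \<le> \<bar>\<theta> y a - \<theta> x a\<bar> \<longrightarrow>
         (\<exists>z\<in>Z. min (\<theta> x a) (\<theta> y a) \<le> z \<and> z \<le> max (\<theta> x a) (\<theta> y a)))"
    and sepY: "a \<in> Y \<Longrightarrow> b \<in> Y \<Longrightarrow> \<exists>Z. finite Z \<and> card Z \<le> 2 \<and>
       (\<forall>x\<in>X. 0 < F x a \<longrightarrow> 0 < F x b \<longrightarrow> \<eta> \<le> \<bar>\<theta> x b - \<theta> x a\<bar> \<longrightarrow>
         (\<exists>z\<in>Z. min (\<theta> x a) (\<theta> x b) \<le> z \<and> z \<le> max (\<theta> x a) (\<theta> x b)))"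
begin

text \<open>Transposing the two families exchanges the two sides of \<open>order\<close> up to sign,
  so each bound on common neighbours in \<open>X\<close> has a counterpart in
  \<open>Y\<close>.\<close>

lemma dual: "lens_system Y X nu mu (\<lambda>a x. F x a) (\<lambda>a x. \<theta> x a) \<eta> M l"
proof
  fix x y a b
  assume *: "x \<in> Y" "y \<in> Y" "a \<in> X" "b \<in> X" "0 < F a x" "0 < F b x" "0 < F a y" "0 < F b y"
    "\<eta> \<le> \<bar>\<theta> b x - \<theta> a x\<bar>" "\<eta> \<le> \<bar>\<theta> b y - \<theta> a y\<bar>"
    "\<eta> \<le> \<bar>\<theta> a y - \<theta> a x\<bar>" "\<eta> \<le> \<bar>\<theta> b y - \<theta> b x\<bar>"
  show "sgn (\<theta> b x - \<theta> a x) * sgn (\<theta> b y - \<theta> a y) = - (sgn (\<theta> a y - \<theta> a x) * sgn (\<theta> b y - \<theta> b x))"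
    using order[of a b x y] * by simp
qed (rule finX finY mu nu F_ge F_le M_ge locX locY range eta l sepX sepY; assumption)+

definition D1 :: "'a \<Rightarrow> real" where "D1 x = (\<Sum>a\<in>Y. nu a * F x a)"
definition D2 :: "'b \<Rightarrow> real" where "D2 a = (\<Sum>x\<in>X. mu x * F x a)"
definition Q1 :: real where "Q1 = (\<Sum>x\<in>X. mu x * (D1 x)\<^sup>2)"
definition Q2 :: real where "Q2 = (\<Sum>a\<in>Y. nu a * (D2 a)\<^sup>2)"
text \<open>Weighted number of common neighbours of two curves. \<open>Kn\<close> keeps those whose
  lenses sit at nearly the same position on both, and \<open>P i\<close> is the level
  \<open>i\<close> term of \<open>sum_squares_cells_ge\<close> for the others.\<close>

definition K :: "'a \<Rightarrow> 'a \<Rightarrow> real" where "K x y = (\<Sum>a\<in>Y. nu a * (F x a * F y a))"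
definition Kn :: "'a \<Rightarrow> 'a \<Rightarrow> real" where
  "Kn x y = (\<Sum>a\<in>{a\<in>Y. \<bar>\<theta> y a - \<theta> x a\<bar> < \<eta>}. nu a * (F x a * F y a))"
definition P :: "nat \<Rightarrow> 'a \<Rightarrow> 'a \<Rightarrow> real" where
  "P i x y = (let A = {a\<in>Y. 0 < nu a * (F x a * F y a) \<and> \<eta> \<le> \<bar>\<theta> y a - \<theta> x a\<bar>} in
     \<Sum>a\<in>A. \<Sum>b\<in>A.
     if dcell i (\<theta> x a) = dcell i (\<theta> x b) \<and> dcell i (\<theta> y a) = dcell i (\<theta> y b)
     then (nu a * (F x a * F y a) * sgn (\<theta> y a - \<theta> x a)) *
          (nu b * (F x b * F y b) * sgn (\<theta> y b - \<theta> x b)) else 0)"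

lemma Q_nonneg: "0 \<le> Q1" "0 \<le> Q2"
  unfolding Q1_def Q2_def by (auto intro!: sum_nonneg simp: mu nu)

lemma Kn_nonneg: "x \<in> X \<Longrightarrow> y \<in> X \<Longrightarrow> 0 \<le> Kn x y"
  unfolding Kn_def by (auto intro!: sum_nonneg mult_nonneg_nonneg simp: nu F_ge)

lemma Kn_le_K: "x \<in> X \<Longrightarrow> y \<in> X \<Longrightarrow> Kn x y \<le> K x y"
  unfolding K_def Kn_def using finY by (intro sum_mono2) (auto simp: nu F_ge)

lemma K_le_D1: "x \<in> X \<Longrightarrow> y \<in> X \<Longrightarrow> K x y \<le> D1 x"
  unfolding K_def D1_def
  by (intro sum_mono mult_left_mono) (auto simp: nu F_ge F_le mult_left_le)

lemma sum_K: "(\<Sum>x\<in>X. \<Sum>y\<in>X. mu x * mu y * K x y) = Q2"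
proof -
  have "(\<Sum>x\<in>X. \<Sum>y\<in>X. mu x * mu y * K x y)
     = (\<Sum>x\<in>X. \<Sum>y\<in>X. \<Sum>a\<in>Y. nu a * ((mu x * F x a) * (mu y * F y a)))"
    unfolding K_def by (simp add: sum_distrib_left mult_ac)
  also have "\<dots> = (\<Sum>x\<in>X. \<Sum>a\<in>Y. \<Sum>y\<in>X. nu a * ((mu x * F x a) * (mu y * F y a)))"
    by (intro sum.cong refl sum.swap)
  also have "\<dots> = (\<Sum>a\<in>Y. \<Sum>x\<in>X. \<Sum>y\<in>X. nu a * ((mu x * F x a) * (mu y * F y a)))"
    by (rule sum.swap)
  also have "\<dots> = Q2"
    unfolding Q2_def D2_def by (simp add: sum_product power2_eq_square sum_distrib_left mult_ac)
  finally show ?thesis .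
qed

text \<open>For fixed \<open>x\<close> and \<open>a\<close>, the curves \<open>y\<close> on which
  the lens of \<open>a\<close> sits near its position on \<open>x\<close> have weight at most
  \<open>M\<close> by \<open>locY\<close>; the remaining factor \<open>K\<close> is bounded by the
  degree \<open>D1\<close>.\<close>

lemma sum_KnK: "(\<Sum>x\<in>X. \<Sum>y\<in>X. mu x * mu y * (Kn x y * K x y)) \<le> M * Q1"
proof -
  have "(\<Sum>x\<in>X. \<Sum>y\<in>X. mu x * mu y * (Kn x y * K x y)) \<le> (\<Sum>x\<in>X. mu x * D1 x * (\<Sum>y\<in>X. mu y * Kn x y))"
    unfolding sum_distrib_left
  proof (intro sum_mono)
    fix x y assume xy: "x \<in> X" "y \<in> X"
    have "Kn x y * K x y \<le> Kn x y * D1 x"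
      using xy by (intro mult_left_mono K_le_D1 Kn_nonneg)
    then have "mu x * mu y * (Kn x y * K x y) \<le> mu x * mu y * (Kn x y * D1 x)"
      using mult_left_mono[of _ _ "mu x * mu y"] mu xy by simp
    then show "mu x * mu y * (Kn x y * K x y) \<le> mu x * D1 x * (mu y * Kn x y)"
      by (simp add: mult_ac)
  qed
  also have "\<dots> \<le> (\<Sum>x\<in>X. mu x * D1 x * (M * D1 x))"
  proof (intro sum_mono mult_left_mono)
    fix x assume x: "x \<in> X"
    have "(\<Sum>y\<in>X. mu y * Kn x y) = (\<Sum>y\<in>X. \<Sum>a\<in>Y. if \<bar>\<theta> y a - \<theta> x a\<bar> < \<eta> then (nu a * F x a) * (mu y * F y a) else 0)"
      unfolding Kn_def sum.inter_filter[OF finY] sum_distrib_left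
      by (intro sum.cong refl) auto
    also have "\<dots> = (\<Sum>a\<in>Y. \<Sum>y\<in>X. if \<bar>\<theta> y a - \<theta> x a\<bar> < \<eta> then (nu a * F x a) * (mu y * F y a) else 0)"
      by (rule sum.swap)
    also have "\<dots> = (\<Sum>a\<in>Y. (nu a * F x a) * (\<Sum>y\<in>{y\<in>X. \<bar>\<theta> y a - \<theta> x a\<bar> < \<eta>}. mu y * F y a))"
      unfolding sum.inter_filter[OF finX] sum_distrib_left
      by (intro sum.cong refl) auto
    also have "\<dots> \<le> (\<Sum>a\<in>Y. (nu a * F x a) * M)"
      using x by (intro sum_mono mult_left_mono locY) (auto simp: nu F_ge)
    also have "\<dots> = M * D1 x" by (simp add: D1_def sum_distrib_left mult_ac)
    finally show "(\<Sum>y\<in>X. mu y * Kn x y) \<le> M * D1 x" .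
    show "0 \<le> mu x * D1 x" using x by (auto simp: D1_def mu nu F_ge intro!: mult_nonneg_nonneg sum_nonneg)
  qed
  also have "\<dots> = M * Q1" by (simp add: Q1_def sum_distrib_left power2_eq_square mult_ac)
  finally show ?thesis .
qed

text \<open>The antisymmetric kernel \<open>\<phi> x\<close> records the order of two lens positions on \<open>x\<close>. By \<open>order\<close> the
  products for two different curves are essentially negative definite, whereas the sum of all
  products is a sum of squares; hence two curves have few common neighbours.\<close>

lemma sum_P: "(\<Sum>x\<in>X. \<Sum>y\<in>X. mu x * mu y * P i x y) \<le> 2 * M * (Q1 + Q2)"
proof -
  \<comment> \<open>The restriction to a common cell of level \<open>i\<close> is chosen so that the
    negative part of the expansion is exactly \<open>P i\<close>.\<close>
  define \<phi> where "\<phi> x a b = (if dcell i (\<theta> x a) = dcell i (\<theta> x b) \<and> \<eta> \<le> \<bar>\<theta> x b - \<theta> x a\<bar>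
    then F x a * F x b * sgn (\<theta> x b - \<theta> x a) else 0)" for x a b
  have "0 \<le> (\<Sum>a\<in>Y. \<Sum>b\<in>Y. nu a * nu b * (\<Sum>x\<in>X. mu x * \<phi> x a b)\<^sup>2)"
    by (auto intro!: sum_nonneg simp: nu)
  also have "\<dots> = (\<Sum>a\<in>Y. \<Sum>b\<in>Y. \<Sum>x\<in>X. \<Sum>y\<in>X. mu x * mu y * (nu a * nu b * (\<phi> x a b * \<phi> y a b)))"
    by (simp add: power2_eq_square sum_product sum_distrib_left mult_ac)
  also have "\<dots> = (\<Sum>x\<in>X. \<Sum>a\<in>Y. \<Sum>b\<in>Y. \<Sum>y\<in>X. mu x * mu y * (nu a * nu b * (\<phi> x a b * \<phi> y a b)))"
    by (rule sum_swap3)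
  also have "\<dots> = (\<Sum>x\<in>X. \<Sum>y\<in>X. \<Sum>a\<in>Y. \<Sum>b\<in>Y. mu x * mu y * (nu a * nu b * (\<phi> x a b * \<phi> y a b)))"
    by (intro sum.cong refl sum_swap3)
  also have "\<dots> = (\<Sum>x\<in>X. \<Sum>y\<in>X. mu x * mu y * (\<Sum>a\<in>Y. \<Sum>b\<in>Y. nu a * nu b * (\<phi> x a b * \<phi> y a b)))"
    by (simp add: sum_distrib_left)
  also have "\<dots> \<le> (\<Sum>x\<in>X. \<Sum>y\<in>X. mu x * mu y * (2 * (Kn x y * K x y) + 2 * M * K x y - P i x y))"
  proof (intro sum_mono mult_left_mono)
    fix x y assume xy: "x \<in> X" "y \<in> X"
    define g where "g a = nu a * (F x a * F y a)" for a
    have g0: "0 \<le> g a" if "a \<in> Y" for a using that xy by (simp add: g_def nu F_ge)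
    have gpos: "0 < F x a \<and> 0 < F y a" if "a \<in> Y" "0 < g a" for a
    proof -
      have "F x a \<noteq> 0" "F y a \<noteq> 0" using that(2) by (auto simp: g_def)
      then show ?thesis using F_ge[of x a] F_ge[of y a] xy that(1) by auto
    qed
    have gx: "g a \<le> nu a * F x a" if "a \<in> Y" for a
      unfolding g_def using that xy by (intro mult_left_mono) (auto simp: mult_left_le F_ge F_le nu)
    have gy: "g a \<le> nu a * F y a" if "a \<in> Y" for a
      unfolding g_def using that xy by (intro mult_left_mono) (auto simp: mult_left_le_one_le F_ge F_le nu)
    have "(\<Sum>a\<in>Y. \<Sum>b\<in>Y. nu a * nu b * (\<phi> x a b * \<phi> y a b)) =
      (\<Sum>a\<in>Y. \<Sum>b\<in>Y. if (dcell i (\<theta> x a) = dcell i (\<theta> x b) \<and> \<eta> \<le> \<bar>\<theta> x b - \<theta> x a\<bar>) \<and>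
             (dcell i (\<theta> y a) = dcell i (\<theta> y b) \<and> \<eta> \<le> \<bar>\<theta> y b - \<theta> y a\<bar>)
           then g a * g b * (sgn (\<theta> x b - \<theta> x a) * sgn (\<theta> y b - \<theta> y a)) else 0)"
      by (intro sum.cong refl) (auto simp: \<phi>_def g_def)
    also have "\<dots> \<le> 2 * ((\<Sum>a\<in>{a\<in>Y. \<bar>\<theta> y a - \<theta> x a\<bar> < \<eta>}. g a) * (\<Sum>a\<in>Y. g a)) + 2 * M * (\<Sum>a\<in>Y. g a)
       - (\<Sum>a\<in>{a\<in>Y. 0 < g a \<and> \<eta> \<le> \<bar>\<theta> y a - \<theta> x a\<bar>}. \<Sum>b\<in>{a\<in>Y. 0 < g a \<and> \<eta> \<le> \<bar>\<theta> y a - \<theta> x a\<bar>}.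
     if dcell i (\<theta> x a) = dcell i (\<theta> x b) \<and> dcell i (\<theta> y a) = dcell i (\<theta> y b)
     then (g a * sgn (\<theta> y a - \<theta> x a)) * (g b * sgn (\<theta> y b - \<theta> x b)) else 0)"
    proof (rule lens_pair_bound[OF finY g0])
      fix a assume "a \<in> Y"
      have "(\<Sum>b | b \<in> Y \<and> \<bar>\<theta> x b - \<theta> x a\<bar> < \<eta>. g b) \<le> (\<Sum>b | b \<in> Y \<and> \<bar>\<theta> x b - \<theta> x a\<bar> < \<eta>. nu b * F x b)"
        by (intro sum_mono gx) auto
      also have "\<dots> \<le> M" by (rule locX[OF xy(1)])
      finally show "(\<Sum>b | b \<in> Y \<and> \<bar>\<theta> x b - \<theta> x a\<bar> < \<eta>. g b) \<le> M" .
      have "(\<Sum>b | b \<in> Y \<and> \<bar>\<theta> y b - \<theta> y a\<bar> < \<eta>. g b) \<le> (\<Sum>b | b \<in> Y \<and> \<bar>\<theta> y b - \<theta> y a\<bar> < \<eta>. nu b * F y b)"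
        by (intro sum_mono gy) auto
      also have "\<dots> \<le> M" by (rule locX[OF xy(2)])
      finally show "(\<Sum>b | b \<in> Y \<and> \<bar>\<theta> y b - \<theta> y a\<bar> < \<eta>. g b) \<le> M" .
    next
      fix a b assume "a \<in> Y" "b \<in> Y" "0 < g a" "0 < g b" "\<eta> \<le> \<bar>\<theta> x b - \<theta> x a\<bar>" "\<eta> \<le> \<bar>\<theta> y b - \<theta> y a\<bar>"
        "\<eta> \<le> \<bar>\<theta> y a - \<theta> x a\<bar>" "\<eta> \<le> \<bar>\<theta> y b - \<theta> x b\<bar>"
      then show "sgn (\<theta> x b - \<theta> x a) * sgn (\<theta> y b - \<theta> y a) = - (sgn (\<theta> y a - \<theta> x a) * sgn (\<theta> y b - \<theta> x b))"
        using gpos xy by (intro order) auto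
    qed
    also have "\<dots> = 2 * (Kn x y * K x y) + 2 * M * K x y - P i x y"
      unfolding Kn_def K_def P_def Let_def g_def ..
    finally show "(\<Sum>a\<in>Y. \<Sum>b\<in>Y. nu a * nu b * (\<phi> x a b * \<phi> y a b)) \<le> 2 * (Kn x y * K x y) + 2 * M * K x y - P i x y" .
  qed (auto simp: mu)
  also have "\<dots> = 2 * (\<Sum>x\<in>X. \<Sum>y\<in>X. mu x * mu y * (Kn x y * K x y)) + 2 * M * (\<Sum>x\<in>X. \<Sum>y\<in>X. mu x * mu y * K x y)
       - (\<Sum>x\<in>X. \<Sum>y\<in>X. mu x * mu y * P i x y)"
    by (simp add: algebra_simps sum.distrib sum_subtractf sum_distrib_left)
  finally show ?thesis using sum_KnK sum_K by (simp add: algebra_simps)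
qed

lemma K_far_sq_le:
  assumes "x \<in> X" "y \<in> X"
  shows "(K x y - Kn x y)\<^sup>2 \<le> 4 * real l * (\<Sum>i\<in>{1..l}. P i x y)"
proof -
  define g where "g a = nu a * (F x a * F y a)" for a
  define A where "A = {a\<in>Y. 0 < g a \<and> \<eta> \<le> \<bar>\<theta> y a - \<theta> x a\<bar>}"
  have g0: "0 \<le> g a" if "a \<in> Y" for a using that assms by (simp add: g_def nu F_ge)
  have gpos: "0 < F x a \<and> 0 < F y a" if "a \<in> Y" "0 < g a" for a
  proof -
    have "F x a \<noteq> 0" "F y a \<noteq> 0" using that(2) by (auto simp: g_def)
    then show ?thesis using F_ge[of x a] F_ge[of y a] assms that(1) by auto
  qed
  obtain Z where Z: "finite Z" "card Z \<le> 2" "\<And>a. a\<in>Y \<Longrightarrow> 0 < F x a \<Longrightarrow> 0 < F y a \<Longrightarrow> \<eta> \<le> \<bar>\<theta> y a - \<theta> x a\<bar> \<Longrightarrow>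
         (\<exists>z\<in>Z. min (\<theta> x a) (\<theta> y a) \<le> z \<and> z \<le> max (\<theta> x a) (\<theta> y a))"
    using sepX[OF assms] by blast
  have "K x y = (\<Sum>a\<in>A. g a) + Kn x y"
  proof -
    have "K x y = (\<Sum>a\<in>{a\<in>Y. \<eta> \<le> \<bar>\<theta> y a - \<theta> x a\<bar>} \<union> {a\<in>Y. \<bar>\<theta> y a - \<theta> x a\<bar> < \<eta>}. g a)"
      unfolding K_def g_def by (intro sum.cong) auto
    also have "\<dots> = (\<Sum>a\<in>{a\<in>Y. \<eta> \<le> \<bar>\<theta> y a - \<theta> x a\<bar>}. g a) + (\<Sum>a\<in>{a\<in>Y. \<bar>\<theta> y a - \<theta> x a\<bar> < \<eta>}. g a)"
      using finY by (intro sum.union_disjoint) auto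
    also have "(\<Sum>a\<in>{a\<in>Y. \<eta> \<le> \<bar>\<theta> y a - \<theta> x a\<bar>}. g a) = (\<Sum>a\<in>A. g a)"
      using finY g0 unfolding A_def by (intro sum.mono_neutral_right) (auto simp: order_less_le)
    finally show ?thesis by (simp add: Kn_def g_def)
  qed
  moreover have "(\<Sum>a\<in>A. g a)\<^sup>2 \<le> 4 * real l * (\<Sum>i\<in>{1..l}. \<Sum>a\<in>A. \<Sum>b\<in>A.
     if dcell i (\<theta> x a) = dcell i (\<theta> x b) \<and> dcell i (\<theta> y a) = dcell i (\<theta> y b)
     then (g a * sgn (\<theta> y a - \<theta> x a)) * (g b * sgn (\<theta> y b - \<theta> x b)) else 0)"
  proof (rule sum_squares_cells_ge[OF _ _ _ _ _ Z(1,2)])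
    show "finite A" unfolding A_def using finY by simp
    fix a assume a: "a \<in> A"
    then have aY: "a \<in> Y" and F: "0 < F x a" "0 < F y a" and n: "\<eta> \<le> \<bar>\<theta> y a - \<theta> x a\<bar>"
      using gpos by (auto simp: A_def)
    show "0 \<le> g a" using g0 aY .
    show "0 \<le> \<theta> x a \<and> \<theta> x a < 1" using range[OF assms(1) aY F(1)] .
    show "0 \<le> \<theta> y a \<and> \<theta> y a < 1" using range[OF assms(2) aY F(2)] .
    show "1 / 2 ^ l \<le> \<bar>\<theta> x a - \<theta> y a\<bar>" using eta n by linarith
    show "\<exists>z\<in>Z. min (\<theta> x a) (\<theta> y a) \<le> z \<and> z \<le> max (\<theta> x a) (\<theta> y a)"
      using Z(3)[OF aY F n] .
  qed
  ultimately show ?thesis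
    unfolding P_def Let_def g_def[symmetric] A_def[symmetric] by simp
qed

text \<open>The far part \<open>K - Kn\<close> is controlled by \<open>sum_P\<close> summed over the
  \<open>l\<close> levels, which gives \<open>8 * l * (l * 2) = 16 * l ^ 2\<close>; the near part
  adds 2.\<close>

lemma sum_K_sq: "(\<Sum>x\<in>X. \<Sum>y\<in>X. mu x * mu y * (K x y)\<^sup>2) \<le> 18 * (real l)\<^sup>2 * M * (Q1 + Q2)"
proof -
  have "(\<Sum>x\<in>X. \<Sum>y\<in>X. mu x * mu y * (K x y)\<^sup>2)
     \<le> (\<Sum>x\<in>X. \<Sum>y\<in>X. mu x * mu y * (8 * real l * (\<Sum>i\<in>{1..l}. P i x y) + 2 * (Kn x y * K x y)))"
  proof (intro sum_mono mult_left_mono)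
    fix x y assume xy: "x \<in> X" "y \<in> X"
    have "0 \<le> ((K x y - Kn x y) - Kn x y)\<^sup>2" by simp
    then have "(K x y)\<^sup>2 \<le> 2 * (K x y - Kn x y)\<^sup>2 + 2 * (Kn x y)\<^sup>2"
      by (simp add: power2_eq_square algebra_simps)
    moreover have "(Kn x y)\<^sup>2 \<le> Kn x y * K x y"
      unfolding power2_eq_square using xy by (intro mult_left_mono Kn_le_K Kn_nonneg)
    ultimately show "(K x y)\<^sup>2 \<le> 8 * real l * (\<Sum>i\<in>{1..l}. P i x y) + 2 * (Kn x y * K x y)"
      using K_far_sq_le[OF xy] by linarith
  qed (auto simp: mu)
  also have "\<dots> = 8 * real l * (\<Sum>i\<in>{1..l}. \<Sum>x\<in>X. \<Sum>y\<in>X. mu x * mu y * P i x y)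
      + 2 * (\<Sum>x\<in>X. \<Sum>y\<in>X. mu x * mu y * (Kn x y * K x y))"
  proof -
    have "(\<Sum>x\<in>X. \<Sum>y\<in>X. mu x * mu y * (\<Sum>i\<in>{1..l}. P i x y)) = (\<Sum>i\<in>{1..l}. \<Sum>x\<in>X. \<Sum>y\<in>X. mu x * mu y * P i x y)"
      unfolding sum_distrib_left by (rule sum_swap3)
    moreover have "mu x * mu y * (8 * real l * (\<Sum>i\<in>{1..l}. P i x y) + 2 * (Kn x y * K x y))
        = 8 * real l * (mu x * mu y * (\<Sum>i\<in>{1..l}. P i x y)) + 2 * (mu x * mu y * (Kn x y * K x y))" for x y
      by (simp add: algebra_simps)
    ultimately show ?thesis
      by (simp only: sum.distrib sum_distrib_left[symmetric])
  qed
  also have "\<dots> \<le> 8 * real l * (\<Sum>i\<in>{1..l}. 2 * M * (Q1 + Q2)) + 2 * (M * Q1)"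
    by (intro add_mono mult_left_mono sum_mono sum_P sum_KnK) auto
  also have "\<dots> = 16 * (real l)\<^sup>2 * M * (Q1 + Q2) + 2 * (M * Q1)"
    by (simp add: power2_eq_square)
  also have "\<dots> \<le> 18 * (real l)\<^sup>2 * M * (Q1 + Q2)"
  proof -
    have "M * Q1 \<le> M * (Q1 + Q2)" using M_ge Q_nonneg by (intro mult_left_mono) auto
    also have "\<dots> \<le> (real l)\<^sup>2 * (M * (Q1 + Q2))"
      using l M_ge Q_nonneg mult_right_mono[of 1 "(real l)\<^sup>2" "M * (Q1+Q2)"] by simp
    finally show ?thesis by (simp add: mult_ac)
  qed
  finally show ?thesis .
qed

text \<open>Cauchy-Schwarz over those pairs of curves that have a common neighbour at all. Their
  total weight \<open>V\<close> is where the Frostman condition will be fed in, since related curves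
  are close to each other.\<close>

lemma Q2_sq_le:
  assumes V: "(\<Sum>x\<in>X. \<Sum>y\<in>X. if \<exists>a\<in>Y. 0 < F x a \<and> 0 < F y a then mu x * mu y else 0) \<le> V"
  shows "Q2\<^sup>2 \<le> V * (18 * (real l)\<^sup>2 * M * (Q1 + Q2))"
proof -
  define r where "r x y = (if \<exists>a\<in>Y. 0 < F x a \<and> 0 < F y a then mu x * mu y else 0)" for x y
  have K0: "K x y = 0" if "x \<in> X" "y \<in> X" "\<not> (\<exists>a\<in>Y. 0 < F x a \<and> 0 < F y a)" for x y
    unfolding K_def
  proof (intro sum.neutral ballI)
    fix a assume "a \<in> Y"
    then have "F x a = 0 \<or> F y a = 0" using that F_ge[of x a] F_ge[of y a] by force
    then show "nu a * (F x a * F y a) = 0" by auto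
  qed
  have r: "0 \<le> r x y" if "x \<in> X" "y \<in> X" for x y using that mu by (auto simp: r_def)
  have "Q2 = (\<Sum>(x,y)\<in>X\<times>X. sqrt (r x y) * (sqrt (r x y) * K x y))"
  proof -
    have "Q2 = (\<Sum>x\<in>X. \<Sum>y\<in>X. r x y * K x y)"
      unfolding sum_K[symmetric] r_def using K0 by (intro sum.cong refl) auto
    also have "\<dots> = (\<Sum>(x,y)\<in>X\<times>X. r x y * K x y)" by (simp add: sum.cartesian_product)
    also have "\<dots> = (\<Sum>(x,y)\<in>X\<times>X. sqrt (r x y) * (sqrt (r x y) * K x y))"
      using r by (intro sum.cong refl) (auto simp flip: mult.assoc)
    finally show ?thesis .
  qed
  then have "Q2\<^sup>2 \<le> (\<Sum>(x,y)\<in>X\<times>X. (sqrt (r x y))\<^sup>2) * (\<Sum>(x,y)\<in>X\<times>X. (sqrt (r x y) * K x y)\<^sup>2)"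
    using Cauchy_Schwarz_ineq_sum[of "\<lambda>(x,y). sqrt (r x y)" "\<lambda>(x,y). sqrt (r x y) * K x y" "X \<times> X"]
    by (simp add: case_prod_beta)
  also have "(\<Sum>(x,y)\<in>X\<times>X. (sqrt (r x y))\<^sup>2) = (\<Sum>(x,y)\<in>X\<times>X. r x y)"
    using r by (intro sum.cong refl) auto
  also have "(\<Sum>(x,y)\<in>X\<times>X. (sqrt (r x y) * K x y)\<^sup>2) = (\<Sum>(x,y)\<in>X\<times>X. r x y * (K x y)\<^sup>2)"
    using r by (intro sum.cong refl) (auto simp: power_mult_distrib)
  also have "(\<Sum>(x,y)\<in>X\<times>X. r x y * (K x y)\<^sup>2) = (\<Sum>x\<in>X. \<Sum>y\<in>X. mu x * mu y * (K x y)\<^sup>2)"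
    unfolding sum.cartesian_product[symmetric] using K0 by (intro sum.cong refl) (auto simp: r_def)
  also have "(\<Sum>(x,y)\<in>X\<times>X. r x y) * (\<Sum>x\<in>X. \<Sum>y\<in>X. mu x * mu y * (K x y)\<^sup>2) \<le> V * (18 * (real l)\<^sup>2 * M * (Q1 + Q2))"
  proof (rule mult_mono)
    show "(\<Sum>(x,y)\<in>X\<times>X. r x y) \<le> V" using V by (simp add: sum.cartesian_product[symmetric] r_def)
    have "0 \<le> (\<Sum>x\<in>X. \<Sum>y\<in>X. if \<exists>a\<in>Y. 0 < F x a \<and> 0 < F y a then mu x * mu y else 0)"
      by (intro sum_nonneg) (auto simp: mu)
    then show "0 \<le> V" using V by linarith
  qed (use sum_K_sq mu in \<open>auto intro!: sum_nonneg\<close>)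
  finally show ?thesis .
qed

theorem sum_F_sq_le:
  assumes V1: "(\<Sum>x\<in>X. \<Sum>y\<in>X. if \<exists>a\<in>Y. 0 < F x a \<and> 0 < F y a then mu x * mu y else 0) \<le> V"
    and V2: "(\<Sum>a\<in>Y. \<Sum>b\<in>Y. if \<exists>x\<in>X. 0 < F x a \<and> 0 < F x b then nu a * nu b else 0) \<le> V"
  shows "(\<Sum>x\<in>X. \<Sum>a\<in>Y. mu x * nu a * F x a)\<^sup>2 \<le> (\<Sum>x\<in>X. mu x) * (72 * (real l)\<^sup>2 * M * V)"
proof -
  interpret dual: lens_system Y X nu mu "\<lambda>a x. F x a" "\<lambda>a x. \<theta> x a" \<eta> M l by (rule dual)
  have dQ: "dual.Q1 = Q2" "dual.Q2 = Q1"
    unfolding dual.Q1_def dual.Q2_def Q1_def Q2_def dual.D1_def dual.D2_def D1_def D2_def by auto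
  define B where "B = V * (18 * (real l)\<^sup>2 * M)"
  \<comment> \<open>Each second moment is bounded only in terms of the sum of both. Adding the two
    bounds closes the loop: \<open>(Q1 + Q2)\<^sup>2 \<le> 4 * B * (Q1 + Q2)\<close>.\<close>
  have q2: "Q2\<^sup>2 \<le> B * (Q1 + Q2)" using Q2_sq_le[OF V1] by (simp add: B_def mult_ac)
  have q1: "Q1\<^sup>2 \<le> B * (Q1 + Q2)" using dual.Q2_sq_le[OF V2] by (simp add: B_def dQ mult_ac add_ac)
  have "(Q1 + Q2)\<^sup>2 \<le> 2 * (Q1\<^sup>2 + Q2\<^sup>2)"
    using zero_le_power2[of "Q1 - Q2"] by (simp add: power2_eq_square algebra_simps)
  then have "(Q1 + Q2) * (Q1 + Q2) \<le> (4 * B) * (Q1 + Q2)" using q1 q2 by (simp add: power2_eq_square)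
  moreover have "0 \<le> B"
  proof -
    have "0 \<le> (\<Sum>x\<in>X. \<Sum>y\<in>X. if \<exists>a\<in>Y. 0 < F x a \<and> 0 < F y a then mu x * mu y else 0)"
      by (intro sum_nonneg) (auto simp: mu)
    then show ?thesis using V1 M_ge by (simp add: B_def)
  qed
  ultimately have "Q1 + Q2 \<le> 4 * B"
    using Q_nonneg by (cases "Q1 + Q2 = 0") (auto simp: mult_le_cancel_right)
  then have Q1: "Q1 \<le> 72 * (real l)\<^sup>2 * M * V" using Q_nonneg by (simp add: B_def mult_ac)
  have "(\<Sum>x\<in>X. \<Sum>a\<in>Y. mu x * nu a * F x a) = (\<Sum>x\<in>X. sqrt (mu x) * (sqrt (mu x) * D1 x))"
  proof (intro sum.cong refl)
    fix x assume "x \<in> X"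
    then have "sqrt (mu x) * (sqrt (mu x) * D1 x) = mu x * D1 x"
      using mu by (simp flip: mult.assoc)
    then show "(\<Sum>a\<in>Y. mu x * nu a * F x a) = sqrt (mu x) * (sqrt (mu x) * D1 x)"
      by (simp add: D1_def sum_distrib_left mult.assoc)
  qed
  then have "(\<Sum>x\<in>X. \<Sum>a\<in>Y. mu x * nu a * F x a)\<^sup>2 \<le> (\<Sum>x\<in>X. (sqrt (mu x))\<^sup>2) * (\<Sum>x\<in>X. (sqrt (mu x) * D1 x)\<^sup>2)"
    using Cauchy_Schwarz_ineq_sum[of "\<lambda>x. sqrt (mu x)" "\<lambda>x. sqrt (mu x) * D1 x" X] by simp
  also have "\<dots> = (\<Sum>x\<in>X. mu x) * Q1"
    unfolding Q1_def using mu by (intro arg_cong2[where f="(*)"] sum.cong refl) (auto simp: power_mult_distrib)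
  also have "\<dots> \<le> (\<Sum>x\<in>X. mu x) * (72 * (real l)\<^sup>2 * M * V)"
    by (intro mult_left_mono Q1 sum_nonneg mu)
  finally show ?thesis .
qed

end

section \<open>Quadratic polynomials\<close>

lemma quadratic_three_zeros:
  fixes \<alpha> \<beta> \<gamma> :: real
  assumes "\<alpha> * x\<^sup>2 + \<beta> * x + \<gamma> = 0" "\<alpha> * y\<^sup>2 + \<beta> * y + \<gamma> = 0" "\<alpha> * z\<^sup>2 + \<beta> * z + \<gamma> = 0"
    and "x \<noteq> y" "x \<noteq> z" "y \<noteq> z"
  shows "\<alpha> = 0" "\<beta> = 0" "\<gamma> = 0"
proof -
  have xy: "(x - y) * (\<alpha> * (x + y) + \<beta>) = 0" using assms(1,2) by (simp add: algebra_simps power2_eq_square)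
  have xz: "(x - z) * (\<alpha> * (x + z) + \<beta>) = 0" using assms(1,3) by (simp add: algebra_simps power2_eq_square)
  have *: "\<alpha> * (x + y) + \<beta> = 0" "\<alpha> * (x + z) + \<beta> = 0" using xy xz assms by auto
  moreover have "\<alpha> * (y - z) = (\<alpha> * (x + y) + \<beta>) - (\<alpha> * (x + z) + \<beta>)" by (simp add: algebra_simps)
  ultimately have "\<alpha> * (y - z) = 0" by simp
  then show "\<alpha> = 0" using assms by simp
  then show "\<beta> = 0" using * by simp
  then show "\<gamma> = 0" using \<open>\<alpha> = 0\<close> assms by simp
qed

lemma quadratic_zero_between:
  fixes \<alpha> \<beta> \<gamma> :: real
  assumes "(\<alpha> * x\<^sup>2 + \<beta> * x + \<gamma>) * (\<alpha> * y\<^sup>2 + \<beta> * y + \<gamma>) < 0"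
  shows "\<exists>z. min x y < z \<and> z < max x y \<and> \<alpha> * z\<^sup>2 + \<beta> * z + \<gamma> = 0"
proof -
  define h where "h t = \<alpha> * t\<^sup>2 + \<beta> * t + \<gamma>" for t
  have ivt: "\<exists>z. u < z \<and> z < v \<and> h z = 0" if uv: "u < v" "h u * h v < 0" for u v
  proof -
    have cont: "isCont h t" "isCont (\<lambda>t. - h t) t" for t unfolding h_def by (auto intro!: continuous_intros)
    have "\<exists>z. u \<le> z \<and> z \<le> v \<and> h z = 0"
    proof (cases "h u \<le> 0")
      case True
      then have "0 \<le> h v" using uv(2) by (smt (verit) mult_nonpos_nonpos)
      then show ?thesis using IVT[of h u 0 v] True uv cont by auto
    next
      case False
      then have "h v \<le> 0" using uv(2) by (smt (verit) mult_nonneg_nonneg)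
      then show ?thesis using IVT2[of h v 0 u] False uv cont by auto
    qed
    then obtain z where z: "u \<le> z" "z \<le> v" "h z = 0" by blast
    moreover have "z \<noteq> u" "z \<noteq> v" using z(3) uv(2) by auto
    ultimately show ?thesis by (intro exI[of _ z]) auto
  qed
  have ne: "x \<noteq> y" using assms by (auto simp: not_less)
  show ?thesis
  proof (cases "x < y")
    case True
    then show ?thesis using ivt[of x y] assms by (simp add: h_def)
  next
    case False
    then show ?thesis using ivt[of y x] assms ne by (simp add: h_def mult.commute min_def max_def)
  qed
qed

lemma quadratic_no_alternation:
  fixes \<alpha> \<beta> \<gamma> :: real
  defines "h \<equiv> \<lambda>t. \<alpha> * t\<^sup>2 + \<beta> * t + \<gamma>"
  assumes "h u * h v < 0" "h v * h w < 0" "h w * h x < 0"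
  shows "\<not> (u < v \<and> v < w \<and> w < x)"
proof
  assume o: "u < v \<and> v < w \<and> w < x"
  obtain a where a: "u < a" "a < v" "h a = 0"
    using quadratic_zero_between[of \<alpha> u \<beta> \<gamma> v] assms(2) o by (auto simp: h_def min_def max_def)
  obtain b where b: "v < b" "b < w" "h b = 0"
    using quadratic_zero_between[of \<alpha> v \<beta> \<gamma> w] assms(3) o by (auto simp: h_def min_def max_def)
  obtain c where c: "w < c" "c < x" "h c = 0"
    using quadratic_zero_between[of \<alpha> w \<beta> \<gamma> x] assms(4) o by (auto simp: h_def min_def max_def)
  have "\<alpha> = 0 \<and> \<beta> = 0 \<and> \<gamma> = 0"
    using quadratic_three_zeros[of \<alpha> a \<beta> \<gamma> b c] a b c by (auto simp: h_def)
  then show False using assms(2) by (simp add: h_def)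
qed

lemma quadratic_zero_set:
  fixes \<alpha> \<beta> \<gamma> :: real
  assumes "\<not> (\<alpha> = 0 \<and> \<beta> = 0 \<and> \<gamma> = 0)"
  shows "finite {t. \<alpha> * t\<^sup>2 + \<beta> * t + \<gamma> = 0} \<and> card {t. \<alpha> * t\<^sup>2 + \<beta> * t + \<gamma> = 0} \<le> 2"
proof (rule ccontr)
  let ?S = "{t. \<alpha> * t\<^sup>2 + \<beta> * t + \<gamma> = 0}"
  assume "\<not> (finite ?S \<and> card ?S \<le> 2)"
  then have "\<exists>B. finite B \<and> card B = 3 \<and> B \<subseteq> ?S"
  proof (cases "finite ?S")
    case True
    with \<open>\<not> (finite ?S \<and> card ?S \<le> 2)\<close> have "3 \<le> card ?S" by simp
    then show ?thesis using obtain_subset_with_card_n[of 3 ?S] by metis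
  next
    case False
    then show ?thesis using infinite_arbitrarily_large[of ?S 3] by auto
  qed
  then obtain B where "card B = 3" "B \<subseteq> ?S" by blast
  then obtain x y z where "x \<noteq> y" "x \<noteq> z" "y \<noteq> z" "{x,y,z} \<subseteq> ?S"
    by (auto simp: card_3_iff)
  then show False using quadratic_three_zeros[of \<alpha> x \<beta> \<gamma> y z] assms by auto
qed

text \<open>Both sign patterns have at most two changes, so of the three ways to split the four points
  into two pairs that separate each other, only \<open>{pa, qb}\<close> against \<open>{pb, qa}\<close> remains.\<close>

lemma quadratic_order_identity:
  fixes \<alpha> \<beta> \<gamma> \<alpha>' \<beta>' \<gamma>' :: real
  defines "g \<equiv> \<lambda>t. \<alpha> * t\<^sup>2 + \<beta> * t + \<gamma>" and "h \<equiv> \<lambda>t. \<alpha>' * t\<^sup>2 + \<beta>' * t + \<gamma>'"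
  assumes g: "0 < g pa" "0 < g pb" "g qa < 0" "g qb < 0"
    and h: "h pa < 0" "0 < h pb" "h qa < 0" "0 < h qb"
  shows "sgn (pb - pa) * sgn (qb - qa) = - (sgn (qa - pa) * sgn (qb - pb))"
proof -
  have ga: "\<not> (u < v \<and> v < w \<and> w < x)" if "g u * g v < 0" "g v * g w < 0" "g w * g x < 0" for u v w x
    using quadratic_no_alternation[of \<alpha> u \<beta> \<gamma> v w x] that by (simp add: g_def)
  have ha: "\<not> (u < v \<and> v < w \<and> w < x)" if "h u * h v < 0" "h v * h w < 0" "h w * h x < 0" for u v w x
    using quadratic_no_alternation[of \<alpha>' u \<beta>' \<gamma>' v w x] that by (simp add: h_def)
  have gs: "g pa * g qa < 0" "g pa * g qb < 0" "g pb * g qa < 0" "g pb * g qb < 0"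
    "g qa * g pa < 0" "g qb * g pa < 0" "g qa * g pb < 0" "g qb * g pb < 0"
    using g by (auto simp: mult_less_0_iff)
  have hs: "h pa * h pb < 0" "h pa * h qb < 0" "h qa * h pb < 0" "h qa * h qb < 0"
    "h pb * h pa < 0" "h qb * h pa < 0" "h pb * h qa < 0" "h qb * h qa < 0"
    using h by (auto simp: mult_less_0_iff)
  have G: "\<not> (pa < qa \<and> qa < pb \<and> pb < qb)" "\<not> (pa < qb \<and> qb < pb \<and> pb < qa)"
    "\<not> (pb < qa \<and> qa < pa \<and> pa < qb)" "\<not> (pb < qb \<and> qb < pa \<and> pa < qa)"
    "\<not> (qa < pa \<and> pa < qb \<and> qb < pb)" "\<not> (qa < pb \<and> pb < qb \<and> qb < pa)"
    "\<not> (qb < pa \<and> pa < qa \<and> qa < pb)" "\<not> (qb < pb \<and> pb < qa \<and> qa < pa)"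
    by (rule ga; rule gs)+
  have H: "\<not> (pa < pb \<and> pb < qa \<and> qa < qb)" "\<not> (pa < qb \<and> qb < qa \<and> qa < pb)"
    "\<not> (qa < pb \<and> pb < pa \<and> pa < qb)" "\<not> (qa < qb \<and> qb < pa \<and> pa < pb)"
    "\<not> (pb < pa \<and> pa < qb \<and> qb < qa)" "\<not> (pb < qa \<and> qa < qb \<and> qb < pa)"
    "\<not> (qb < pa \<and> pa < pb \<and> pb < qa)" "\<not> (qb < qa \<and> qa < pb \<and> pb < pa)"
    by (rule ha; rule hs)+
  have ne: "pa \<noteq> pb" "qa \<noteq> qb" "pa \<noteq> qa" "pb \<noteq> qb" "pa \<noteq> qb" "pb \<noteq> qa"
    using g h by auto
  consider "pa < pb" "qa < qb" | "pa < pb" "qb < qa" | "pb < pa" "qa < qb" | "pb < pa" "qb < qa"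
    using ne by linarith
  then show ?thesis
  proof cases
    case 1
    have "(pa < qa \<and> qb < pb) \<or> (qa < pa \<and> pb < qb)" using 1 G(1,5) H(1,4) ne by linarith
    then show ?thesis using 1 by auto
  next
    case 2
    have "(pa < qa \<and> pb < qb) \<or> (qa < pa \<and> qb < pb)" using 2 G(2,7) H(2,7) ne by linarith
    then show ?thesis using 2 by auto
  next
    case 3
    have "(pa < qa \<and> pb < qb) \<or> (qa < pa \<and> qb < pb)" using 3 G(3,6) H(3,6) ne by linarith
    then show ?thesis using 3 by auto
  next
    case 4
    have "(pa < qa \<and> qb < pb) \<or> (qa < pa \<and> pb < qb)" using 4 G(4,8) H(5,8) ne by linarith
    then show ?thesis using 4 by auto
  qed
qed

lemma card_le_diameter:
  fixes L :: real
  assumes "finite S" "\<And>i j. i \<in> S \<Longrightarrow> j \<in> S \<Longrightarrow> real j - real i \<le> L" "0 \<le> L"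
  shows "real (card S) \<le> L + 1"
proof (cases "S = {}")
  case False
  have "S \<subseteq> {Min S..Max S}" using assms(1) by auto
  then have "card S \<le> Suc (Max S) - Min S" using card_mono[of "{Min S..Max S}" S] by simp
  moreover have "Min S \<le> Max S" using assms(1) False by (metis Max_in Min_le)
  ultimately have "real (card S) \<le> real (Max S) - real (Min S) + 1" by linarith
  also have "\<dots> \<le> L + 1" using assms(2)[of "Min S" "Max S"] assms(1) False by simp
  finally show ?thesis .
qed (use assms in simp)

text \<open>The difference quotient of a quadratic is the mean of its derivatives at the two
  endpoints. So two points of \<open>S\<close> with derivatives of the same sign are at most
  \<open>2 / D\<close> grid steps apart, whatever happens between them; the two signs together give
  \<open>2 * (2 / D + 1)\<close>.\<close>

lemma card_quadratic_small_le:
  fixes z1 z2 z3 D :: real and k :: nat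
  defines "f \<equiv> \<lambda>t. z1 * t\<^sup>2 + z2 * t + z3"
  assumes "finite S" "0 < D"
    and small: "\<And>j. j \<in> S \<Longrightarrow> \<bar>f (real j / 2 ^ k)\<bar> < 1 / 2 ^ k"
    and deriv: "\<And>j. j \<in> S \<Longrightarrow> D \<le> \<bar>2 * z1 * (real j / 2 ^ k) + z2\<bar>"
  shows "real (card S) \<le> 4 / D + 2"
proof -
  have one: "real (card S') \<le> 2 / D + 1" if S': "S' \<subseteq> S"
    and e: "e = 1 \<or> e = -1" and d: "\<And>j. j \<in> S' \<Longrightarrow> D \<le> e * (2 * z1 * (real j / 2 ^ k) + z2)" for e :: real and S'
  proof (rule card_le_diameter)
    show "finite S'" using S' assms(2) by (rule finite_subset)
    fix i j assume ij: "i \<in> S'" "j \<in> S'"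
    let ?x = "real i / 2 ^ k" and ?y = "real j / 2 ^ k"
    have n: "(?y - ?x) * 2 ^ k = real j - real i" by (simp add: field_simps)
    show "real j - real i \<le> 2 / D"
    proof (cases "i < j")
      case True
      then have xy: "0 < ?y - ?x" by (simp add: divide_strict_right_mono)
      have eq: "e * (f ?y - f ?x) = (?y - ?x) * ((e * (2 * z1 * ?x + z2) + e * (2 * z1 * ?y + z2)) / 2)"
        unfolding f_def by (simp add: field_simps power2_eq_square)
      have "(?y - ?x) * D \<le> (?y - ?x) * ((e * (2 * z1 * ?x + z2) + e * (2 * z1 * ?y + z2)) / 2)"
        using xy d[OF ij(1)] d[OF ij(2)] by (intro mult_left_mono) auto
      also have "\<dots> \<le> \<bar>f ?y\<bar> + \<bar>f ?x\<bar>" unfolding eq[symmetric] using e by auto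
      also have "\<dots> \<le> 2 / 2 ^ k" using small[of i] small[of j] ij S' by fastforce
      finally have "(?y - ?x) * D * 2 ^ k \<le> 2" by (simp add: field_simps)
      then have "((?y - ?x) * 2 ^ k) * D \<le> 2" by (simp add: mult_ac)
      then have "(real j - real i) * D \<le> 2" by (simp only: n)
      then show ?thesis using assms(3) by (simp add: field_simps)
    next
      case False
      then have "real j - real i \<le> 0" by simp
      also have "0 \<le> 2 / D" using assms(3) by simp
      finally show ?thesis .
    qed
  qed (use assms(3) in simp)
  define S1 where "S1 = {j\<in>S. D \<le> 1 * (2 * z1 * (real j / 2 ^ k) + z2)}"
  define S2 where "S2 = {j\<in>S. D \<le> -1 * (2 * z1 * (real j / 2 ^ k) + z2)}"
  have "S = S1 \<union> S2" using deriv unfolding S1_def S2_def by force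
  then have "real (card S) \<le> real (card S1) + real (card S2)"
    using card_Un_le[of S1 S2] by (simp flip: of_nat_add)
  also have "real (card S1) \<le> 2 / D + 1" by (rule one[of _ 1]) (auto simp: S1_def)
  also have "real (card S2) \<le> 2 / D + 1" by (rule one[of _ "-1"]) (auto simp: S2_def)
  finally show ?thesis by simp
qed

section \<open>Weighted families of quadratics\<close>

text \<open>Lens positions are required in \<open>[0, 1)\<close>, while the vertices used as
  positions are only known to lie within \<open>21 / 10\<close> of the unit interval; the map
  \<open>(v + 3) / 8\<close> brings them there.\<close>

lemma abs_rescale: "\<bar>(v + 3) / 8 - t\<bar> < e / 8 \<Longrightarrow> \<bar>v - (8 * t - 3)\<bar> < e" for v t e :: real
  by (auto simp: abs_less_iff field_simps)

lemma abs_rescale_diff: "e / 8 \<le> \<bar>(u + 3) / 8 - (v + 3) / 8\<bar> \<Longrightarrow> e \<le> \<bar>v - u\<bar>" for u v e :: real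
  by (simp add: diff_divide_distrib[symmetric] abs_minus_commute)

text \<open>A discretization at resolution \<open>1 / 2 ^ k\<close>: the Frostman bound is asked for
  only above the resolution, \<open>T\<close> is a set of grid parameters, and \<open>m\<close> is
  the mass from which a cell counts as heavy.\<close>

locale weighted_quadratics =
  fixes I :: "'a set" and c1 c2 c3 :: "'a \<Rightarrow> real" and mu :: "'a \<Rightarrow> real"
    and k :: nat and s m C :: real and T :: "nat set"
  assumes finI: "finite I" and mu: "x \<in> I \<Longrightarrow> 0 \<le> mu x" and mu_sum: "(\<Sum>x\<in>I. mu x) \<le> 1"
    and coord: "x \<in> I \<Longrightarrow> 0 \<le> c1 x \<and> c1 x < 1" "x \<in> I \<Longrightarrow> 0 \<le> c2 x \<and> c2 x < 1"
      "x \<in> I \<Longrightarrow> 0 \<le> c3 x \<and> c3 x < 1"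
    and s: "0 < s" "s \<le> 1" and m: "0 < m" "m \<le> 1" and C: "1 \<le> C"
    and frostman: "x \<in> I \<Longrightarrow> 1 / 2 ^ k \<le> r \<Longrightarrow>
      (\<Sum>y\<in>{y\<in>I. max \<bar>c1 y - c1 x\<bar> (max \<bar>c2 y - c2 x\<bar> \<bar>c3 y - c3 x\<bar>) < r}. mu y) \<le> C * r powr s"
    and T: "T \<subseteq> {..<2 ^ k}"
begin

definition ds :: "'a \<Rightarrow> 'a \<Rightarrow> real" where
  "ds x y = max \<bar>c1 y - c1 x\<bar> (max \<bar>c2 y - c2 x\<bar> \<bar>c3 y - c3 x\<bar>)"

definition q :: "'a \<Rightarrow> real \<Rightarrow> real" where "q x t = c1 x * t\<^sup>2 + c2 x * t + c3 x"

definition cell :: "'a \<Rightarrow> nat \<Rightarrow> int" where "cell x j = \<lfloor>2 ^ k * q x (real j / 2 ^ k)\<rfloor>"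

definition N :: "'a \<Rightarrow> nat \<Rightarrow> real" where "N x j = (\<Sum>y\<in>{y\<in>I. cell y j = cell x j}. mu y)"

text \<open>Dividing by the mass \<open>N x j\<close> of the cell makes every heavy point contribute exactly its own mass
  for each parameter, however heavy its cell is.\<close>

definition J :: "'a \<Rightarrow> 'a \<Rightarrow> real" where
  "J x y = (\<Sum>j\<in>{j\<in>T. cell y j = cell x j \<and> m \<le> N x j}. 1 / N x j)"

definition heavy_mass :: real where
  "heavy_mass = (\<Sum>j\<in>T. \<Sum>x\<in>{x\<in>I. m \<le> N x j}. mu x)"

lemma finT: "finite T" using T finite_subset by blast

lemma T_unit: "j \<in> T \<Longrightarrow> 0 \<le> real j / 2 ^ k \<and> real j / 2 ^ k \<le> 1"
  using T by (auto simp: divide_le_eq_1 less_imp_le)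

lemma N_cong: "cell y j = cell x j \<Longrightarrow> N y j = N x j"
  by (simp add: N_def)

lemma J_sym: "J x y = J y x"
  unfolding J_def by (rule sum.cong) (auto simp: N_cong[of y _ x])

lemma ds_sym: "ds x y = ds y x"
  unfolding ds_def by (simp add: abs_minus_commute)

lemma J_nonneg: "0 \<le> J x y"
  unfolding J_def using m by (intro sum_nonneg) auto

lemma J_le: "J x y \<le> real (card {j\<in>T. cell y j = cell x j}) / m"
proof -
  have "J x y \<le> (\<Sum>j\<in>{j\<in>T. cell y j = cell x j \<and> m \<le> N x j}. 1 / m)"
    unfolding J_def using m by (intro sum_mono divide_left_mono) auto
  also have "\<dots> \<le> (\<Sum>j\<in>{j\<in>T. cell y j = cell x j}. 1 / m)"
    using m finT by (intro sum_mono2) auto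
  finally show ?thesis by simp
qed

lemma J_pos_imp: "0 < J x y \<Longrightarrow> \<exists>j\<in>T. cell y j = cell x j"
  unfolding J_def by (metis (mono_tags, lifting) less_irrefl mem_Collect_eq sum.neutral)

lemma sum_J_cell:
  assumes "x \<in> I" "S \<subseteq> I"
  shows "(\<Sum>y\<in>S. mu y * J x y)
    = (\<Sum>j\<in>T. if m \<le> N x j then (\<Sum>y\<in>{y\<in>S. cell y j = cell x j}. mu y) / N x j else 0)"
proof -
  have finS: "finite S" using assms finI finite_subset by blast
  have "(\<Sum>y\<in>S. mu y * J x y) = (\<Sum>y\<in>S. \<Sum>j\<in>T. if m \<le> N x j \<and> cell y j = cell x j then mu y / N x j else 0)"
    unfolding J_def sum.inter_filter[OF finT] sum_distrib_left by (intro sum.cong refl) auto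
  also have "\<dots> = (\<Sum>j\<in>T. \<Sum>y\<in>S. if m \<le> N x j \<and> cell y j = cell x j then mu y / N x j else 0)"
    by (rule sum.swap)
  also have "\<dots> = (\<Sum>j\<in>T. if m \<le> N x j then (\<Sum>y\<in>{y\<in>S. cell y j = cell x j}. mu y) / N x j else 0)"
    unfolding sum.inter_filter[OF finS] sum_divide_distrib by (intro sum.cong refl) (auto intro!: sum.cong)
  finally show ?thesis .
qed

lemma heavy_mass_swap: "heavy_mass = (\<Sum>x\<in>I. mu x * (\<Sum>j\<in>T. if m \<le> N x j then 1 else 0))"
proof -
  have "heavy_mass = (\<Sum>j\<in>T. \<Sum>x\<in>I. if m \<le> N x j then mu x else 0)"
    unfolding heavy_mass_def sum.inter_filter[OF finI] ..
  also have "\<dots> = (\<Sum>x\<in>I. \<Sum>j\<in>T. if m \<le> N x j then mu x else 0)" by (rule sum.swap)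
  also have "\<dots> = (\<Sum>x\<in>I. mu x * (\<Sum>j\<in>T. if m \<le> N x j then 1 else 0))"
    unfolding sum_distrib_left by (intro sum.cong refl) auto
  finally show ?thesis .
qed

lemma sum_J: "(\<Sum>x\<in>I. \<Sum>y\<in>I. mu x * mu y * J x y) = heavy_mass"
proof -
  have "(\<Sum>y\<in>I. mu x * mu y * J x y) = mu x * (\<Sum>j\<in>T. if m \<le> N x j then 1 else 0)" if "x \<in> I" for x
  proof -
    have "(\<Sum>y\<in>I. mu x * mu y * J x y) = mu x * (\<Sum>y\<in>I. mu y * J x y)"
      by (simp add: sum_distrib_left mult_ac)
    also have "(\<Sum>y\<in>I. mu y * J x y) = (\<Sum>j\<in>T. if m \<le> N x j then 1 else 0)"
      unfolding sum_J_cell[OF that order_refl] N_def[symmetric] using m by (intro sum.cong refl) auto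
    finally show ?thesis .
  qed
  then show ?thesis unfolding heavy_mass_swap by simp
qed

lemma near_mass:
  assumes "x \<in> I" "1 / 2 ^ k \<le> r"
  shows "(\<Sum>y\<in>{y\<in>I. ds x y < r}. mu y) \<le> C * r powr s"
  using frostman[OF assms] by (simp add: ds_def)

text \<open>A ball of radius \<open>r\<close> carries at most \<open>m / 2\<close>, that is, at most
  half of a heavy cell. So for each point and parameter at most half of the normalized contribution
  comes from close partners.\<close>

lemma sum_J_near:
  assumes r: "1 / 2 ^ k \<le> r" and Cr: "C * r powr s \<le> m / 2"
  shows "(\<Sum>x\<in>I. \<Sum>y\<in>{y\<in>I. ds x y < r}. mu x * mu y * J x y) \<le> heavy_mass / 2"
proof -
  have "(\<Sum>y\<in>{y\<in>I. ds x y < r}. mu x * mu y * J x y) \<le> mu x * (\<Sum>j\<in>T. if m \<le> N x j then 1 / 2 else 0)" if x: "x \<in> I" for x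
  proof -
    have eq: "(\<Sum>y\<in>{y\<in>I. ds x y < r}. mu x * mu y * J x y) = mu x * (\<Sum>y\<in>{y\<in>I. ds x y < r}. mu y * J x y)"
      by (simp add: sum_distrib_left mult_ac)
    have "(\<Sum>y\<in>{y\<in>I. ds x y < r}. mu y * J x y) \<le> (\<Sum>j\<in>T. if m \<le> N x j then 1 / 2 else 0)"
    proof (subst sum_J_cell[OF x], simp, intro sum_mono)
      fix j
      have "(\<Sum>y\<in>{y \<in> {y \<in> I. ds x y < r}. cell y j = cell x j}. mu y) \<le> (\<Sum>y\<in>{y \<in> I. ds x y < r}. mu y)"
        using finI mu by (intro sum_mono2) auto
      also have "\<dots> \<le> m / 2" using near_mass[OF x r] Cr by linarith
      finally have a: "(\<Sum>y\<in>{y \<in> {y \<in> I. ds x y < r}. cell y j = cell x j}. mu y) \<le> m / 2" .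
      have "(\<Sum>y\<in>{y \<in> {y \<in> I. ds x y < r}. cell y j = cell x j}. mu y) / N x j \<le> 1 / 2" if "m \<le> N x j"
        using a that m by (simp add: divide_le_eq)
      then show "(if m \<le> N x j then (\<Sum>y\<in>{y \<in> {y \<in> I. ds x y < r}. cell y j = cell x j}. mu y) / N x j else 0)
          \<le> (if m \<le> N x j then 1 / 2 else 0)" by simp
    qed
    then show ?thesis unfolding eq using mu[OF x] by (rule mult_left_mono)
  qed
  then have "(\<Sum>x\<in>I. \<Sum>y\<in>{y\<in>I. ds x y < r}. mu x * mu y * J x y) \<le> (\<Sum>x\<in>I. mu x * (\<Sum>j\<in>T. if m \<le> N x j then 1 / 2 else 0))"
    by (rule sum_mono)
  also have "\<dots> = (\<Sum>x\<in>I. mu x * (\<Sum>j\<in>T. if m \<le> N x j then 1 else 0)) / 2"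
    unfolding sum_divide_distrib sum_distrib_left by (intro sum.cong refl) auto
  also have "\<dots> = heavy_mass / 2" unfolding heavy_mass_swap ..
  finally show ?thesis .
qed

lemma pair_mass:
  assumes "1 / 2 ^ k \<le> r"
  shows "(\<Sum>x\<in>I. \<Sum>y\<in>{y\<in>I. ds x y < r}. mu x * mu y) \<le> C * r powr s"
proof -
  have "(\<Sum>x\<in>I. \<Sum>y\<in>{y\<in>I. ds x y < r}. mu x * mu y) = (\<Sum>x\<in>I. mu x * (\<Sum>y\<in>{y\<in>I. ds x y < r}. mu y))"
    by (simp add: sum_distrib_left)
  also have "\<dots> \<le> (\<Sum>x\<in>I. mu x * (C * r powr s))"
    using assms by (intro sum_mono mult_left_mono near_mass mu)
  also have "\<dots> = (\<Sum>x\<in>I. mu x) * (C * r powr s)" by (simp add: sum_distrib_right)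
  also have "\<dots> \<le> 1 * (C * r powr s)" using mu_sum C by (intro mult_right_mono) auto
  finally show ?thesis by simp
qed

section \<open>Transversal pairs\<close>

definition disc :: "'a \<Rightarrow> 'a \<Rightarrow> real" where
  "disc x y = (c2 y - c2 x)\<^sup>2 - 4 * (c1 y - c1 x) * (c3 y - c3 x)"

definition slope :: "'a \<Rightarrow> 'a \<Rightarrow> real \<Rightarrow> real" where
  "slope x y t = 2 * (c1 y - c1 x) * t + (c2 y - c2 x)"

lemma q_diff: "q y t - q x t = (c1 y - c1 x) * t\<^sup>2 + (c2 y - c2 x) * t + (c3 y - c3 x)"
  by (simp add: q_def algebra_simps)

lemma slope_sq: "(slope x y t)\<^sup>2 = disc x y + 4 * (c1 y - c1 x) * (q y t - q x t)"
  unfolding q_diff slope_def disc_def by (simp add: power2_eq_square algebra_simps)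

lemma same_cell_dist:
  assumes "cell y j = cell x j"
  shows "\<bar>q y (real j / 2 ^ k) - q x (real j / 2 ^ k)\<bar> < 1 / 2 ^ k"
  using dcell_eq_imp_dist[of k "q y (real j / 2 ^ k)" "q x (real j / 2 ^ k)"] assms
  by (simp add: dcell_def cell_def)

lemma ds_le_iff: "ds x y < r \<longleftrightarrow> \<bar>c1 y - c1 x\<bar> < r \<and> \<bar>c2 y - c2 x\<bar> < r \<and> \<bar>c3 y - c3 x\<bar> < r"
  by (auto simp: ds_def)

lemma coord_le_ds: "\<bar>c1 y - c1 x\<bar> \<le> ds x y" "\<bar>c2 y - c2 x\<bar> \<le> ds x y" "\<bar>c3 y - c3 x\<bar> \<le> ds x y"
  by (auto simp: ds_def)

lemma ds_triangle: "ds x z \<le> ds x y + ds y z"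
proof -
  have "\<bar>c1 z - c1 x\<bar> \<le> ds x y + ds y z" "\<bar>c2 z - c2 x\<bar> \<le> ds x y + ds y z"
    "\<bar>c3 z - c3 x\<bar> \<le> ds x y + ds y z"
    using coord_le_ds[of y x] coord_le_ds[of z y] by linarith+
  then show ?thesis by (simp add: ds_def[of x z])
qed

lemma slope_sq_bounds:
  assumes "cell y j = cell x j" "ds x y < 2 * \<rho>"
  shows "\<bar>(slope x y (real j / 2 ^ k))\<^sup>2 - disc x y\<bar> \<le> 8 * \<rho> / 2 ^ k"
proof -
  have "\<bar>(slope x y (real j / 2 ^ k))\<^sup>2 - disc x y\<bar> = 4 * (\<bar>c1 y - c1 x\<bar> * \<bar>q y (real j / 2 ^ k) - q x (real j / 2 ^ k)\<bar>)"
  proof -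
    have "(slope x y (real j / 2 ^ k))\<^sup>2 - disc x y = 4 * ((c1 y - c1 x) * (q y (real j / 2 ^ k) - q x (real j / 2 ^ k)))"
      by (simp add: slope_sq)
    then show ?thesis by (simp only: abs_mult abs_numeral)
  qed
  also have "\<dots> \<le> 4 * ((2 * \<rho>) * (1 / 2 ^ k))"
    using same_cell_dist[OF assms(1)] assms(2) by (intro mult_left_mono mult_mono) (auto simp: ds_le_iff)
  finally show ?thesis by simp
qed

text \<open>At a shared cell the squared slope differs from the discriminant by at most
  \<open>8 * \<rho> / 2 ^ k\<close>. The constant 768 makes this at most half of
  \<open>\<rho>\<^sup>2 / 48\<close>, so the slope is at least \<open>\<rho> / 10\<close>, and
  \<open>4 / (\<rho> / 10) + 2 \<le> 42 / \<rho>\<close>.\<close>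

lemma J_transversal:
  assumes ds: "ds x y < 2 * \<rho>" and \<rho>: "768 / 2 ^ k \<le> \<rho>" "\<rho> \<le> 1" and d: "\<rho>\<^sup>2 / 48 \<le> \<bar>disc x y\<bar>"
  shows "J x y \<le> 42 / (\<rho> * m)"
proof -
  have rpos: "0 < \<rho>" using \<rho>(1) by (rule less_le_trans[rotated]) simp
  have "real (card {j\<in>T. cell y j = cell x j}) \<le> 4 / (\<rho> / 10) + 2"
  proof (rule card_quadratic_small_le[where k=k and ?z1.0="c1 y - c1 x" and ?z2.0="c2 y - c2 x" and ?z3.0="c3 y - c3 x"])
    fix j assume j: "j \<in> {j\<in>T. cell y j = cell x j}"
    then show "\<bar>(c1 y - c1 x) * (real j / 2 ^ k)\<^sup>2 + (c2 y - c2 x) * (real j / 2 ^ k) + (c3 y - c3 x)\<bar> < 1 / 2 ^ k"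
      using same_cell_dist[of y j x] by (simp add: q_diff)
    have "8 * \<rho> / 2 ^ k = 8 * \<rho> * (1 / 2 ^ k)" by simp
    also have "\<dots> \<le> 8 * \<rho> * (\<rho> / 768)" using rpos \<rho>(1) by (intro mult_left_mono) auto
    also have "\<dots> = \<rho>\<^sup>2 / 96" by (simp add: power2_eq_square)
    finally have small: "8 * \<rho> / 2 ^ k \<le> \<rho>\<^sup>2 / 96" .
    have "0 \<le> (slope x y (real j / 2 ^ k))\<^sup>2" "0 < \<rho>\<^sup>2" using rpos by auto
    moreover have "\<bar>(slope x y (real j / 2 ^ k))\<^sup>2 - disc x y\<bar> \<le> \<rho>\<^sup>2 / 96"
      using small slope_sq_bounds[of y j x \<rho>] j ds by (auto intro: order_trans)
    ultimately have "\<rho>\<^sup>2 / 96 \<le> (slope x y (real j / 2 ^ k))\<^sup>2"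
      using d by linarith
    moreover have "(\<rho> / 10)\<^sup>2 \<le> \<rho>\<^sup>2 / 96" by (simp add: power_divide divide_left_mono)
    ultimately have "(\<rho> / 10)\<^sup>2 \<le> (slope x y (real j / 2 ^ k))\<^sup>2" by linarith
    then have "\<bar>\<rho> / 10\<bar> \<le> \<bar>slope x y (real j / 2 ^ k)\<bar>" by (simp only: abs_le_square_iff)
    then show "\<rho> / 10 \<le> \<bar>2 * (c1 y - c1 x) * (real j / 2 ^ k) + (c2 y - c2 x)\<bar>"
      using rpos by (simp add: slope_def)
  qed (use finT rpos in auto)
  also have "\<dots> \<le> 42 / \<rho>" using rpos \<rho>(2) by (simp add: field_simps)
  finally have "real (card {j\<in>T. cell y j = cell x j}) / m \<le> 42 / \<rho> / m" using m by (intro divide_right_mono) auto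
  then show ?thesis using J_le[of x y] by simp
qed

text \<open>Kaufman's estimate at one dyadic distance: pairs of mass of order
  \<open>\<rho> powr s\<close>, each sharing of order \<open>1 / \<rho>\<close> parameters.\<close>

lemma sum_J_transversal:
  assumes \<rho>: "768 / 2 ^ k \<le> \<rho>" "\<rho> \<le> 1"
  shows "(\<Sum>x\<in>I. \<Sum>y\<in>I. if ds x y < 2 * \<rho> \<and> \<rho>\<^sup>2 / 48 \<le> \<bar>disc x y\<bar> then mu x * mu y * J x y else 0)
     \<le> 84 * C * \<rho> powr (s - 1) / m"
proof -
  have rpos: "0 < \<rho>" using \<rho>(1) by (rule less_le_trans[rotated]) simp
  have "(\<Sum>x\<in>I. \<Sum>y\<in>I. if ds x y < 2 * \<rho> \<and> \<rho>\<^sup>2 / 48 \<le> \<bar>disc x y\<bar> then mu x * mu y * J x y else 0)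
    \<le> (\<Sum>x\<in>I. \<Sum>y\<in>I. (if ds x y < 2 * \<rho> then mu x * mu y else 0) * (42 / (\<rho> * m)))"
  proof (intro sum_mono)
    fix x y assume "x \<in> I" "y \<in> I"
    then have "0 \<le> mu x * mu y" using mu by simp
    then show "(if ds x y < 2 * \<rho> \<and> \<rho>\<^sup>2 / 48 \<le> \<bar>disc x y\<bar> then mu x * mu y * J x y else 0)
       \<le> (if ds x y < 2 * \<rho> then mu x * mu y else 0) * (42 / (\<rho> * m))"
      using J_transversal[of x y \<rho>] \<rho> rpos m mult_left_mono[of "J x y" "42 / (\<rho> * m)" "mu x * mu y"] by auto
  qed
  also have "\<dots> = (\<Sum>x\<in>I. \<Sum>y\<in>{y\<in>I. ds x y < 2 * \<rho>}. mu x * mu y) * (42 / (\<rho> * m))"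
    unfolding sum.inter_filter[OF finI] sum_distrib_right ..
  also have "\<dots> \<le> (C * (2 * \<rho>) powr s) * (42 / (\<rho> * m))"
  proof (intro mult_right_mono pair_mass)
    have "1 / 2 ^ k \<le> 768 / (2 ^ k :: real)" by (intro divide_right_mono) auto
    then show "1 / 2 ^ k \<le> 2 * \<rho>" using \<rho> rpos by linarith
  qed (use rpos m in auto)
  also have "\<dots> = (2 powr s * 42) * (C * (\<rho> powr s / \<rho>) / m)"
    using rpos by (simp add: powr_mult)
  also have "\<dots> = (2 powr s * 42) * (C * \<rho> powr (s - 1) / m)"
    using rpos by (simp add: powr_diff)
  also have "\<dots> \<le> (2 * 42) * (C * \<rho> powr (s - 1) / m)"
    using C m s powr_mono[of s 1 2] by (intro mult_right_mono) auto
  finally show ?thesis by simp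
qed


text \<open>The discriminant \<open>disc x a\<close> measures the transversality of the graphs of \<open>q x\<close> and \<open>q a\<close>: by
  \<open>slope_sq\<close> it is the squared slope of their difference at its zeros. In the tangential case the
  graph of \<open>q a\<close> becomes a lens over that of \<open>q x\<close>, of width about \<open>w\<close>, once \<open>q x\<close> is raised by
  \<open>5 * \<rho> * w\<^sup>2\<close>; see \<open>tang_below\<close> and \<open>tang_above\<close>.\<close>

definition tang :: "real \<Rightarrow> real \<Rightarrow> 'a \<Rightarrow> 'a \<Rightarrow> bool" where
  "tang \<rho> w x a \<longleftrightarrow> \<rho> \<le> ds x a \<and> ds x a < 2 * \<rho> \<and> c1 x < c1 a \<and> \<bar>disc x a\<bar> < \<rho>\<^sup>2 * w\<^sup>2 \<and>
     (\<rho> * w\<^sup>2 = 16 / 2 ^ k \<or> 32 / 2 ^ k \<le> \<rho> * w\<^sup>2 \<and> \<rho>\<^sup>2 * w\<^sup>2 / 2 \<le> \<bar>disc x a\<bar>)"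

definition vertex :: "'a \<Rightarrow> 'a \<Rightarrow> real" where
  "vertex x a = - (c2 a - c2 x) / (2 * (c1 a - c1 x))"

lemma vertex_mult:
  assumes "c1 x < c1 a"
  shows "c2 a - c2 x = - 2 * (c1 a - c1 x) * vertex x a"
proof -
  define z where "z = c1 a - c1 x"
  define d where "d = c2 a - c2 x"
  have "vertex x a = - d / (2 * z)" by (simp only: vertex_def z_def d_def)
  moreover have "0 < z" using assms by (simp add: z_def)
  ultimately have "d = - 2 * z * vertex x a" by simp
  then show ?thesis by (simp only: z_def d_def)
qed

lemma slope_vertex: "c1 x < c1 a \<Longrightarrow> slope x a t = 2 * (c1 a - c1 x) * (t - vertex x a)"
  unfolding slope_def by (simp only: vertex_mult) (simp add: algebra_simps)

lemma q_diff_vertex: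
  assumes "c1 x < c1 a"
  shows "q a t - q x t = (c1 a - c1 x) * (t - vertex x a)\<^sup>2 - disc x a / (4 * (c1 a - c1 x))"
proof -
  define z where "z = c1 a - c1 x"
  define p where "p = vertex x a"
  have z: "0 < z" using assms by (simp add: z_def)
  have p: "c2 a - c2 x = - 2 * z * p" unfolding p_def z_def using assms by (rule vertex_mult)
  show ?thesis
    unfolding q_diff disc_def p z_def[symmetric] p_def[symmetric]
    using z by (simp add: field_simps power2_eq_square)
qed

section \<open>Tangential pairs at distance \<rho> with lenses of width w\<close>

context
  fixes \<rho> w :: real
  assumes \<rho>: "0 < \<rho>" "\<rho> \<le> 1" and w: "0 < w" "w\<^sup>2 \<le> 1 / 24" and \<rho>w: "16 / 2 ^ k \<le> \<rho> * w\<^sup>2"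
begin

lemma w_le: "w \<le> 21 / 100"
proof (rule ccontr)
  assume "\<not> w \<le> 21 / 100"
  then have "(21 / 100)\<^sup>2 \<le> w\<^sup>2" by (intro power_mono) auto
  then show False using w(2) by (simp add: power2_eq_square)
qed

lemma grid_le: "1 / 2 ^ k \<le> \<rho> / 384"
proof -
  have "16 * (1 / 2 ^ k) \<le> \<rho> * w\<^sup>2" using \<rho>w by simp
  also have "\<dots> \<le> \<rho> * (1 / 24)" using \<rho> w by (intro mult_left_mono) auto
  finally show ?thesis by simp
qed

lemma grid_le_w: "16 / 2 ^ k \<le> w"
proof -
  have "\<rho> * w\<^sup>2 \<le> 1 * (w * 1)"
    unfolding power2_eq_square using \<rho> w w_le by (intro mult_mono) auto
  then show ?thesis using \<rho>w by linarith
qed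

context
  fixes x a :: 'a and j :: nat
  assumes tang: "tang \<rho> w x a" and j: "j \<in> T" and cell: "cell a j = cell x j"
begin

lemma slope_grid: "8 * \<rho> / 2 ^ k \<le> \<rho>\<^sup>2 * w\<^sup>2 / 2"
proof -
  have "8 * \<rho> / 2 ^ k = (\<rho> / 2) * (16 / 2 ^ k)" by simp
  also have "\<dots> \<le> (\<rho> / 2) * (\<rho> * w\<^sup>2)" using \<rho> \<rho>w by (intro mult_left_mono) auto
  finally show ?thesis by (simp add: power2_eq_square mult_ac)
qed

lemma tang_slope: "(slope x a (real j / 2 ^ k))\<^sup>2 \<le> 3 / 2 * (\<rho>\<^sup>2 * w\<^sup>2)"
  using slope_sq_bounds[OF cell, of \<rho>] slope_grid tang unfolding tang_def by linarith

text \<open>With a small leading coefficient, the difference polynomial would have small slope and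
  small value at the shared parameter, hence all coefficients below \<open>\<rho>\<close>. The bound
  \<open>w\<^sup>2 \<le> 1 / 24\<close> is what makes that slope at most
  \<open>\<rho> / 4\<close>.\<close>

lemma tang_curvature: "\<rho> / 16 \<le> c1 a - c1 x"
proof (rule ccontr)
  define t where "t = real j / 2 ^ k"
  define z1 where "z1 = c1 a - c1 x"
  define z2 where "z2 = c2 a - c2 x"
  define z3 where "z3 = c3 a - c3 x"
  assume "\<not> \<rho> / 16 \<le> c1 a - c1 x"
  then have z1: "0 < z1" "z1 < \<rho> / 16" using tang by (auto simp: tang_def z1_def)
  have t: "0 \<le> t" "t \<le> 1" using T_unit[OF j] by (auto simp: t_def)
  have "(slope x a t)\<^sup>2 \<le> 3 / 2 * (\<rho>\<^sup>2 * (1 / 24))"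
  proof -
    have "\<rho>\<^sup>2 * w\<^sup>2 \<le> \<rho>\<^sup>2 * (1 / 24)" using w by (intro mult_left_mono) auto
    then show ?thesis using tang_slope unfolding t_def by linarith
  qed
  also have "\<dots> = (\<rho> / 4)\<^sup>2" by (simp add: power2_eq_square)
  finally have "\<bar>slope x a t\<bar> \<le> \<bar>\<rho> / 4\<bar>" by (simp only: abs_le_square_iff)
  moreover have "slope x a t = 2 * (z1 * t) + z2" by (simp only: slope_def z1_def z2_def mult.assoc)
  ultimately have sl: "\<bar>2 * (z1 * t) + z2\<bar> \<le> \<rho> / 4" using \<rho> by simp
  have z1t: "0 \<le> z1 * t" "z1 * t \<le> z1" using z1 t by (auto intro: mult_left_le)
  then have z2: "\<bar>z2\<bar> \<le> \<rho> / 4 + \<rho> / 8" using sl z1 by linarith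
  have z1t2: "0 \<le> z1 * t\<^sup>2" "z1 * t\<^sup>2 \<le> z1" using z1 t by (auto intro!: mult_left_le simp: power_le_one)
  have z2t: "\<bar>z2 * t\<bar> \<le> \<bar>z2\<bar>" using t by (simp add: abs_mult mult_left_le)
  have "\<bar>z1 * t\<^sup>2 + z2 * t + z3\<bar> < \<rho> / 384"
    using same_cell_dist[OF cell] grid_le by (simp add: q_diff z1_def z2_def z3_def t_def)
  then have "\<bar>z3\<bar> < \<rho>" using z1t2 z2t z2 z1 \<rho> by linarith
  moreover have "\<bar>z2\<bar> < \<rho>" using z2 \<rho> by linarith
  moreover have "\<bar>z1\<bar> < \<rho>" using z1 \<rho> by linarith
  ultimately have "ds x a < \<rho>" by (simp add: ds_le_iff z1_def z2_def z3_def)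
  then show False using tang by (simp add: tang_def)
qed

text \<open>The slope is the distance to the vertex times a factor of at least
  \<open>\<rho> / 8\<close>; with \<open>tang_slope\<close> the squared distance is at most
  \<open>96 * w\<^sup>2\<close>.\<close>

lemma tang_vertex: "\<bar>real j / 2 ^ k - vertex x a\<bar> \<le> 10 * w"
proof -
  define t where "t = real j / 2 ^ k"
  define z where "z = c1 a - c1 x"
  have z: "\<rho> / 16 \<le> z" using tang_curvature by (simp add: z_def)
  have "(\<rho> / 8)\<^sup>2 * (t - vertex x a)\<^sup>2 \<le> (2 * z)\<^sup>2 * (t - vertex x a)\<^sup>2"
    using z \<rho> by (intro mult_right_mono power_mono) auto
  also have "\<dots> = (slope x a t)\<^sup>2"
    using tang by (simp add: slope_vertex tang_def z_def power_mult_distrib)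
  also have "\<dots> \<le> 3 / 2 * (\<rho>\<^sup>2 * w\<^sup>2)" using tang_slope by (simp add: t_def)
  finally have "\<rho>\<^sup>2 * (t - vertex x a)\<^sup>2 \<le> \<rho>\<^sup>2 * (96 * w\<^sup>2)" by (simp add: power_divide)
  then have "(t - vertex x a)\<^sup>2 \<le> 96 * w\<^sup>2" using \<rho> by simp
  also have "\<dots> \<le> (10 * w)\<^sup>2" by (simp add: power_mult_distrib)
  finally have "\<bar>t - vertex x a\<bar> \<le> \<bar>10 * w\<bar>" by (simp only: abs_le_square_iff)
  then show ?thesis using w by (simp add: t_def)
qed

lemma tang_vertex_range: "0 \<le> (vertex x a + 3) / 8 \<and> (vertex x a + 3) / 8 < 1"
proof -
  define t where "t = real j / 2 ^ k"
  have "0 \<le> t" "t \<le> 1" "\<bar>t - vertex x a\<bar> \<le> 10 * w" using T_unit[OF j] tang_vertex by (auto simp: t_def)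
  then have "0 \<le> vertex x a + 3" "vertex x a + 3 < 8" using w_le by linarith+
  then show ?thesis by simp
qed

lemma tang_depth: "\<bar>disc x a / (4 * (c1 a - c1 x))\<bar> \<le> 4 * \<rho> * w\<^sup>2"
proof -
  have z: "\<rho> / 4 \<le> 4 * (c1 a - c1 x)" using tang_curvature by simp
  have "\<bar>disc x a / (4 * (c1 a - c1 x))\<bar> = \<bar>disc x a\<bar> / (4 * (c1 a - c1 x))"
    using tang by (simp add: tang_def)
  also have "\<dots> \<le> (\<rho>\<^sup>2 * w\<^sup>2) / (\<rho> / 4)"
    using tang z \<rho> by (intro frac_le) (auto simp: tang_def)
  also have "\<dots> = 4 * \<rho> * w\<^sup>2" using \<rho> by (simp add: power2_eq_square)
  finally show ?thesis .
qed

lemma tang_below: "q a (vertex x a) < q x (vertex x a) + 5 * \<rho> * w\<^sup>2"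
proof -
  have "q a (vertex x a) - q x (vertex x a) = - (disc x a / (4 * (c1 a - c1 x)))"
    using q_diff_vertex[of x a "vertex x a"] tang by (simp add: tang_def)
  also have "\<dots> \<le> 4 * \<rho> * w\<^sup>2" using tang_depth by linarith
  also have "\<dots> < 5 * \<rho> * w\<^sup>2" using \<rho> w by simp
  finally show ?thesis by simp
qed

text \<open>At distance \<open>13 * w\<close> from the vertex the parabola has risen by at least
  \<open>169 / 16 * \<rho> * w\<^sup>2\<close>, which exceeds the shift with constant 5 plus the
  depth with constant 4 from \<open>tang_depth\<close>.\<close>

lemma tang_above:
  assumes "13 * w \<le> \<bar>t - vertex x a\<bar>"
  shows "q x t + 5 * \<rho> * w\<^sup>2 < q a t"
proof -
  have "(13 * w)\<^sup>2 \<le> (t - vertex x a)\<^sup>2"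
    using assms w by (subst abs_le_square_iff[symmetric]) auto
  then have "(\<rho> / 16) * (13 * w)\<^sup>2 \<le> (c1 a - c1 x) * (t - vertex x a)\<^sup>2"
    using tang_curvature \<rho> by (intro mult_mono) auto
  moreover have "(\<rho> / 16) * (13 * w)\<^sup>2 = (169 / 16) * (\<rho> * w\<^sup>2)" by (simp add: power_mult_distrib)
  moreover have "q a t - q x t = (c1 a - c1 x) * (t - vertex x a)\<^sup>2 - disc x a / (4 * (c1 a - c1 x))"
    using tang by (intro q_diff_vertex) (simp add: tang_def)
  moreover have "0 < \<rho> * w\<^sup>2" using \<rho> w by simp
  ultimately show ?thesis using tang_depth unfolding mult.assoc by linarith
qed

end

text \<open>In the finest class, \<open>\<rho> * w\<^sup>2 = 16 / 2 ^ k\<close>, there is no lower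
  bound on the slope, and shared parameters are counted by their closeness to the vertex. In all
  other classes the slope at a shared cell is at least \<open>\<rho> * w / 2\<close>. Both counts
  are of order \<open>1 / (\<rho> * w)\<close>.\<close>

lemma J_tang:
  assumes tang: "tang \<rho> w x a"
  shows "J x a \<le> 400 / (\<rho> * w * m)"
proof -
  let ?S = "{j\<in>T. cell a j = cell x j}"
  have rw: "0 < \<rho> * w" "\<rho> * w \<le> 1" using \<rho> w w_le by (auto intro: mult_le_one)
  have "real (card ?S) \<le> 400 / (\<rho> * w)"
  proof (cases "\<rho> * w\<^sup>2 = 16 / 2 ^ k")
    case True
    have "real (card ?S) \<le> 20 * w * 2 ^ k + 1"
    proof (rule card_le_diameter)
      fix i j assume ij: "i \<in> ?S" "j \<in> ?S"
      have "real j / 2 ^ k - real i / 2 ^ k \<le> 20 * w"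
        using tang_vertex[OF tang, of i] tang_vertex[OF tang, of j] ij by (auto simp: abs_le_iff)
      then show "real j - real i \<le> 20 * w * 2 ^ k" by (simp add: field_simps)
    qed (use finT w in auto)
    also have "2 ^ k = 16 / (\<rho> * w\<^sup>2)" using True \<rho> w by (simp add: field_simps)
    also have "20 * w * (16 / (\<rho> * w\<^sup>2)) + 1 = 320 / (\<rho> * w) + 1"
      using \<rho> w by (simp add: power2_eq_square)
    also have "\<dots> \<le> 400 / (\<rho> * w)" using rw by (simp add: field_simps)
    finally show ?thesis .
  next
    case False
    then have big: "32 / 2 ^ k \<le> \<rho> * w\<^sup>2" "\<rho>\<^sup>2 * w\<^sup>2 / 2 \<le> \<bar>disc x a\<bar>" using tang by (auto simp: tang_def)
    have "real (card ?S) \<le> 4 / (\<rho> * w / 2) + 2"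
    proof (rule card_quadratic_small_le[where k=k and ?z1.0="c1 a - c1 x" and ?z2.0="c2 a - c2 x" and ?z3.0="c3 a - c3 x"])
      fix j assume j: "j \<in> ?S"
      then show "\<bar>(c1 a - c1 x) * (real j / 2 ^ k)\<^sup>2 + (c2 a - c2 x) * (real j / 2 ^ k) + (c3 a - c3 x)\<bar> < 1 / 2 ^ k"
        using same_cell_dist[of a j x] by (simp add: q_diff)
      have "8 * \<rho> / 2 ^ k = (\<rho> / 4) * (32 / 2 ^ k)" by simp
      also have "\<dots> \<le> (\<rho> / 4) * (\<rho> * w\<^sup>2)" using \<rho> big by (intro mult_left_mono) auto
      also have "\<dots> = \<rho>\<^sup>2 * w\<^sup>2 / 4" by (simp add: power2_eq_square)
      finally have small: "8 * \<rho> / 2 ^ k \<le> \<rho>\<^sup>2 * w\<^sup>2 / 4" .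
      have "0 \<le> (slope x a (real j / 2 ^ k))\<^sup>2" "0 < \<rho>\<^sup>2 * w\<^sup>2" using \<rho> w by auto
      moreover have "\<bar>(slope x a (real j / 2 ^ k))\<^sup>2 - disc x a\<bar> \<le> \<rho>\<^sup>2 * w\<^sup>2 / 4"
        using small slope_sq_bounds[of a j x \<rho>] j tang by (auto intro: order_trans simp: tang_def)
      ultimately have "\<rho>\<^sup>2 * w\<^sup>2 / 4 \<le> (slope x a (real j / 2 ^ k))\<^sup>2"
        using big by linarith
      then have "(\<rho> * w / 2)\<^sup>2 \<le> (slope x a (real j / 2 ^ k))\<^sup>2" by (simp add: power_mult_distrib power_divide)
      then have "\<bar>\<rho> * w / 2\<bar> \<le> \<bar>slope x a (real j / 2 ^ k)\<bar>" by (simp only: abs_le_square_iff)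
      then show "\<rho> * w / 2 \<le> \<bar>2 * (c1 a - c1 x) * (real j / 2 ^ k) + (c2 a - c2 x)\<bar>"
        using rw by (simp add: slope_def)
    qed (use finT rw in auto)
    also have "\<dots> = 8 / (\<rho> * w) + 2" by simp
    also have "\<dots> \<le> 400 / (\<rho> * w)" using rw by (simp add: field_simps)
    finally show ?thesis .
  qed
  then have "real (card ?S) / m \<le> 400 / (\<rho> * w) / m" using m by (intro divide_right_mono) auto
  then show ?thesis using J_le[of x a] by simp
qed

text \<open>Scaled by the bound of \<open>J_tang\<close> to take values in \<open>[0, 1]\<close>.
  The condition \<open>c1 x < c1 a\<close> inside \<open>tang\<close> decides which of the two
  curves is the lens.\<close>

definition F :: "'a \<Rightarrow> 'a \<Rightarrow> real" where
  "F x a = (if tang \<rho> w x a then m * \<rho> * w / 400 * J x a else 0)"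

lemma F_nonneg: "0 \<le> F x a"
  using J_nonneg[of x a] m \<rho> w by (auto simp: F_def)

lemma F_le_one: "F x a \<le> 1"
proof (cases "tang \<rho> w x a")
  case True
  have "m * \<rho> * w / 400 * J x a \<le> m * \<rho> * w / 400 * (400 / (\<rho> * w * m))"
    using J_tang[OF True] m \<rho> w by (intro mult_left_mono) auto
  also have "\<dots> = 1" using m \<rho> w by simp
  finally show ?thesis by (simp add: F_def True)
qed (simp add: F_def)

lemma F_pos: "0 < F x a \<Longrightarrow> tang \<rho> w x a \<and> (\<exists>j\<in>T. cell a j = cell x j)"
  using J_pos_imp[of x a] J_nonneg[of x a] by (cases "J x a = 0") (auto simp: F_def split: if_splits)

text \<open>At each parameter the partners in the cell of \<open>y\<close> contribute at most 1 in
  total because of the division by \<open>N\<close>, so only the grid parameters in the window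
  count. The radius \<open>23 * w\<close> is \<open>13 * w\<close> for the lens position plus
  \<open>10 * w\<close> from \<open>tang_vertex\<close>.\<close>

lemma local_J:
  assumes y: "y \<in> I" and S: "S \<subseteq> I"
    and near: "\<And>x j. x \<in> S \<Longrightarrow> j \<in> T \<Longrightarrow> cell x j = cell y j \<Longrightarrow> \<bar>real j / 2 ^ k - t\<bar> \<le> 23 * w"
  shows "(\<Sum>x\<in>S. mu x * J y x) \<le> 47 * w * 2 ^ k"
proof -
  have finS: "finite S" using S finI finite_subset by blast
  let ?G = "{j\<in>T. \<bar>real j / 2 ^ k - t\<bar> \<le> 23 * w}"
  have "(\<Sum>x\<in>S. mu x * J y x) \<le> (\<Sum>j\<in>T. if \<bar>real j / 2 ^ k - t\<bar> \<le> 23 * w then 1 else 0)"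
    unfolding sum_J_cell[OF y S]
  proof (rule sum_mono)
    fix j assume j: "j \<in> T"
    have le: "(\<Sum>x\<in>{x\<in>S. cell x j = cell y j}. mu x) \<le> N y j"
      unfolding N_def using S finI mu by (intro sum_mono2) auto
    show "(if m \<le> N y j then (\<Sum>x\<in>{x\<in>S. cell x j = cell y j}. mu x) / N y j else 0)
      \<le> (if \<bar>real j / 2 ^ k - t\<bar> \<le> 23 * w then 1 else 0)"
    proof (cases "{x\<in>S. cell x j = cell y j} = {}")
      case True
      then show ?thesis by (simp only: True) simp
    next
      case False
      then have "\<bar>real j / 2 ^ k - t\<bar> \<le> 23 * w" using near j by blast
      then show ?thesis using le m by (auto simp: divide_le_eq)
    qed
  qed
  also have "\<dots> = real (card ?G)" by (simp add: sum.inter_filter[OF finT, symmetric])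
  also have "\<dots> \<le> 46 * w * 2 ^ k + 1"
  proof (rule card_le_diameter)
    fix i j assume "i \<in> ?G" "j \<in> ?G"
    then have "real j / 2 ^ k - real i / 2 ^ k \<le> 46 * w" by (auto simp: abs_le_iff)
    then show "real j - real i \<le> 46 * w * 2 ^ k" by (simp add: field_simps)
  qed (use finT w in auto)
  also have "\<dots> \<le> 47 * w * 2 ^ k" using grid_le_w by (simp add: field_simps)
  finally show ?thesis .
qed

text \<open>Supplies the bound \<open>V\<close> of \<open>sum_F_sq_le\<close>: the related pairs
  have total mass at most \<open>C * (4 * \<rho>) powr s\<close>.\<close>

lemma F_related_close:
  assumes "0 < F x a \<and> 0 < F y a \<or> 0 < F a x \<and> 0 < F a y"
  shows "ds x y < 4 * \<rho>"
  using assms F_pos[of x a] F_pos[of y a] F_pos[of a x] F_pos[of a y] ds_triangle[of x y a] ds_sym[of a y] ds_sym[of a x]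
  by (auto simp: tang_def)

text \<open>All curves in the role of \<open>x\<close> are raised by the same amount
  \<open>5 * \<rho> * w\<^sup>2\<close>. At the vertex of \<open>a\<close> over \<open>x\<close>,
  the graph of \<open>a\<close> lies below the raised graph of \<open>x\<close>, while a lens with a
  distant vertex lies above its raised base there. Combining two such comparisons at one point
  cancels the shift and leaves the sign of \<open>q a - q b\<close> or of \<open>q x - q y\<close>;
  the four vertices then carry the sign patterns of \<open>quadratic_order_identity\<close>.\<close>

lemma lens: "lens_system I I mu mu F (\<lambda>x a. (vertex x a + 3) / 8) (13 * w / 8) (m * \<rho> * w / 400 * (47 * w * 2 ^ k)) k"
proof
  let ?\<theta> = "\<lambda>x a. (vertex x a + 3) / 8" and ?\<eta> = "13 * w / 8"
  have below: "q a (vertex x a) < q x (vertex x a) + 5 * \<rho> * w\<^sup>2" if "0 < F x a" for x a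
    using F_pos[OF that] tang_below by blast
  have above: "q x t + 5 * \<rho> * w\<^sup>2 < q a t" if "0 < F x a" "13 * w \<le> \<bar>t - vertex x a\<bar>" for x a t
    using F_pos[OF that(1)] tang_above that(2) by blast
  show "finite I" by (fact finI)
  show "0 \<le> mu x" if "x \<in> I" for x by (rule mu[OF that])
  show "0 \<le> F x a" for x a by (rule F_nonneg)
  show "F x a \<le> 1" for x a by (rule F_le_one)
  show "0 \<le> m * \<rho> * w / 400 * (47 * w * 2 ^ k)" using m \<rho> w by auto
  show "(\<Sum>a\<in>{a\<in>I. \<bar>?\<theta> x a - t\<bar> < ?\<eta>}. mu a * F x a) \<le> m * \<rho> * w / 400 * (47 * w * 2 ^ k)" if x: "x \<in> I" for x t
  proof -
    let ?S = "{a\<in>I. tang \<rho> w x a \<and> \<bar>?\<theta> x a - t\<bar> < ?\<eta>}"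
    have "(\<Sum>a\<in>{a\<in>I. \<bar>?\<theta> x a - t\<bar> < ?\<eta>}. mu a * F x a) = (\<Sum>a\<in>?S. mu a * F x a)"
      using finI by (intro sum.mono_neutral_right) (auto simp: F_def)
    also have "\<dots> = m * \<rho> * w / 400 * (\<Sum>a\<in>?S. mu a * J x a)"
      unfolding sum_distrib_left by (intro sum.cong refl) (auto simp: F_def)
    also have "\<dots> \<le> m * \<rho> * w / 400 * (47 * w * 2 ^ k)"
    proof (intro mult_left_mono local_J[OF x, where t="8 * t - 3"])
      fix a j assume a: "a \<in> ?S" "j \<in> T" "cell a j = cell x j"
      have "\<bar>(vertex x a + 3) / 8 - t\<bar> < 13 * w / 8" using a by simp
      then have "\<bar>vertex x a - (8 * t - 3)\<bar> < 13 * w" by (rule abs_rescale)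
      moreover have "\<bar>real j / 2 ^ k - vertex x a\<bar> \<le> 10 * w" using tang_vertex[of x a j] a by blast
      ultimately show "\<bar>real j / 2 ^ k - (8 * t - 3)\<bar> \<le> 23 * w" by linarith
    qed (use m \<rho> w in auto)
    finally show ?thesis .
  qed
  show "(\<Sum>x\<in>{x\<in>I. \<bar>?\<theta> x a - t\<bar> < ?\<eta>}. mu x * F x a) \<le> m * \<rho> * w / 400 * (47 * w * 2 ^ k)" if a: "a \<in> I" for a t
  proof -
    let ?S = "{x\<in>I. tang \<rho> w x a \<and> \<bar>?\<theta> x a - t\<bar> < ?\<eta>}"
    have "(\<Sum>x\<in>{x\<in>I. \<bar>?\<theta> x a - t\<bar> < ?\<eta>}. mu x * F x a) = (\<Sum>x\<in>?S. mu x * F x a)"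
      using finI by (intro sum.mono_neutral_right) (auto simp: F_def)
    also have "\<dots> = m * \<rho> * w / 400 * (\<Sum>x\<in>?S. mu x * J a x)"
      unfolding sum_distrib_left by (intro sum.cong refl) (auto simp: F_def J_sym[of _ a])
    also have "\<dots> \<le> m * \<rho> * w / 400 * (47 * w * 2 ^ k)"
    proof (intro mult_left_mono local_J[OF a, where t="8 * t - 3"])
      fix x j assume x: "x \<in> ?S" "j \<in> T" "cell x j = cell a j"
      have "\<bar>(vertex x a + 3) / 8 - t\<bar> < 13 * w / 8" using x by simp
      then have "\<bar>vertex x a - (8 * t - 3)\<bar> < 13 * w" by (rule abs_rescale)
      moreover have "\<bar>real j / 2 ^ k - vertex x a\<bar> \<le> 10 * w" using tang_vertex[of x a j] x by simp
      ultimately show "\<bar>real j / 2 ^ k - (8 * t - 3)\<bar> \<le> 23 * w" by linarith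
    qed (use m \<rho> w in auto)
    finally show ?thesis .
  qed
  show "0 \<le> ?\<theta> x a \<and> ?\<theta> x a < 1" if "0 < F x a" for x a
    using F_pos[OF that] tang_vertex_range by blast
  have "1 / 2 ^ k \<le> 16 / (2 ^ k :: real)" by (intro divide_right_mono) auto
  also have "\<dots> \<le> ?\<eta>" using grid_le_w w by linarith
  finally show "1 / 2 ^ k \<le> ?\<eta>" .
  show "1 \<le> k" using grid_le \<rho> by (cases k) auto
  have cross: "q a (vertex x a) < q b (vertex x a)" 
    if "0 < F x a" "0 < F x b" "?\<eta> \<le> \<bar>?\<theta> x b - ?\<theta> x a\<bar>" for x a b
    using below[OF that(1)] above[OF that(2), of "vertex x a"] abs_rescale_diff[OF that(3)] by simp
  have cross': "q y (vertex x a) < q x (vertex x a)"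
    if "0 < F x a" "0 < F y a" "?\<eta> \<le> \<bar>?\<theta> y a - ?\<theta> x a\<bar>" for x y a
    using below[OF that(1)] above[OF that(2), of "vertex x a"] abs_rescale_diff[OF that(3)] by simp
  show "sgn (?\<theta> x b - ?\<theta> x a) * sgn (?\<theta> y b - ?\<theta> y a) = - (sgn (?\<theta> y a - ?\<theta> x a) * sgn (?\<theta> y b - ?\<theta> x b))"
    if F: "0 < F x a" "0 < F x b" "0 < F y a" "0 < F y b"
      and n: "?\<eta> \<le> \<bar>?\<theta> x b - ?\<theta> x a\<bar>" "?\<eta> \<le> \<bar>?\<theta> y b - ?\<theta> y a\<bar>"
      "?\<eta> \<le> \<bar>?\<theta> y a - ?\<theta> x a\<bar>" "?\<eta> \<le> \<bar>?\<theta> y b - ?\<theta> x b\<bar>" for x y a b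
  proof -
    have n': "?\<eta> \<le> \<bar>?\<theta> x a - ?\<theta> x b\<bar>" "?\<eta> \<le> \<bar>?\<theta> y a - ?\<theta> y b\<bar>"
      "?\<eta> \<le> \<bar>?\<theta> x a - ?\<theta> y a\<bar>" "?\<eta> \<le> \<bar>?\<theta> x b - ?\<theta> y b\<bar>"
      using n by (simp_all only: abs_minus_commute)
    have sg: "sgn (?\<theta> u v - ?\<theta> u' v') = sgn (vertex u v - vertex u' v')" for u v u' v'
      by (simp add: sgn_if)
    have "sgn (vertex x b - vertex x a) * sgn (vertex y b - vertex y a)
      = - (sgn (vertex y a - vertex x a) * sgn (vertex y b - vertex x b))"
    proof (rule quadratic_order_identity[of "c1 x - c1 y" "vertex x a" "c2 x - c2 y" "c3 x - c3 y" "vertex x b"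
          "vertex y a" "vertex y b" "c1 a - c1 b" "c2 a - c2 b" "c3 a - c3 b"], unfold q_diff[symmetric])
      show "0 < q x (vertex x a) - q y (vertex x a)" using cross'[OF F(1,3) n(3)] by simp
      show "0 < q x (vertex x b) - q y (vertex x b)" using cross'[OF F(2,4) n(4)] by simp
      show "q x (vertex y a) - q y (vertex y a) < 0" using cross'[OF F(3,1) n'(3)] by simp
      show "q x (vertex y b) - q y (vertex y b) < 0" using cross'[OF F(4,2) n'(4)] by simp
      show "q a (vertex x a) - q b (vertex x a) < 0" using cross[OF F(1,2) n(1)] by simp
      show "0 < q a (vertex x b) - q b (vertex x b)" using cross[OF F(2,1) n'(1)] by simp
      show "q a (vertex y a) - q b (vertex y a) < 0" using cross[OF F(3,4) n(2)] by simp
      show "0 < q a (vertex y b) - q b (vertex y b)" using cross[OF F(4,3) n'(2)] by simp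
    qed
    then show ?thesis by (simp only: sg)
  qed
  have zeros: "\<exists>Z. finite Z \<and> card Z \<le> 2 \<and> (\<forall>u v. (q x u - q y u) * (q x v - q y v) < 0 \<longrightarrow>
      (\<exists>z\<in>Z. min ((u + 3) / 8) ((v + 3) / 8) \<le> z \<and> z \<le> max ((u + 3) / 8) ((v + 3) / 8)))" for x y
  proof (cases "c1 x - c1 y = 0 \<and> c2 x - c2 y = 0 \<and> c3 x - c3 y = 0")
    case True
    then have "q x u - q y u = 0" for u unfolding q_diff by simp
    then show ?thesis by (intro exI[of _ "{}"]) simp
  next
    case False
    let ?Z = "{t. q x t - q y t = 0}"
    have Z: "finite ?Z \<and> card ?Z \<le> 2" unfolding q_diff by (rule quadratic_zero_set[OF False])
    show ?thesis
    proof (intro exI[of _ "(\<lambda>t. (t + 3) / 8) ` ?Z"] conjI allI impI)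
      show "finite ((\<lambda>t. (t + 3) / 8) ` ?Z)" using Z by simp
      show "card ((\<lambda>t. (t + 3) / 8) ` ?Z) \<le> 2" using Z card_image_le[of ?Z "\<lambda>t. (t + 3) / 8"] by linarith
      fix u v assume "(q x u - q y u) * (q x v - q y v) < 0"
      then obtain z where z: "min u v < z" "z < max u v" "q x z - q y z = 0"
        using quadratic_zero_between[of "c1 x - c1 y" u "c2 x - c2 y" "c3 x - c3 y" v] unfolding q_diff by auto
      then show "\<exists>z\<in>(\<lambda>t. (t + 3) / 8) ` ?Z. min ((u + 3) / 8) ((v + 3) / 8) \<le> z \<and> z \<le> max ((u + 3) / 8) ((v + 3) / 8)"
        by (intro bexI[of _ "(z + 3) / 8"]) (auto simp: min_def max_def split: if_splits)
    qed
  qed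
  show "\<exists>Z. finite Z \<and> card Z \<le> 2 \<and> (\<forall>a\<in>I. 0 < F x a \<longrightarrow> 0 < F y a \<longrightarrow> ?\<eta> \<le> \<bar>?\<theta> y a - ?\<theta> x a\<bar> \<longrightarrow>
         (\<exists>z\<in>Z. min (?\<theta> x a) (?\<theta> y a) \<le> z \<and> z \<le> max (?\<theta> x a) (?\<theta> y a)))" for x y
  proof -
    have "(q x (vertex x a) - q y (vertex x a)) * (q x (vertex y a) - q y (vertex y a)) < 0"
      if "0 < F x a" "0 < F y a" "?\<eta> \<le> \<bar>?\<theta> y a - ?\<theta> x a\<bar>" for a
      using cross'[OF that] cross'[OF that(2,1)] that(3) by (simp add: mult_less_0_iff abs_minus_commute)
    then show ?thesis using zeros[of x y] by blast
  qed
  show "\<exists>Z. finite Z \<and> card Z \<le> 2 \<and> (\<forall>x\<in>I. 0 < F x a \<longrightarrow> 0 < F x b \<longrightarrow> ?\<eta> \<le> \<bar>?\<theta> x b - ?\<theta> x a\<bar> \<longrightarrow>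
         (\<exists>z\<in>Z. min (?\<theta> x a) (?\<theta> x b) \<le> z \<and> z \<le> max (?\<theta> x a) (?\<theta> x b)))" for a b
  proof -
    have "(q a (vertex x a) - q b (vertex x a)) * (q a (vertex x b) - q b (vertex x b)) < 0"
      if "0 < F x a" "0 < F x b" "?\<eta> \<le> \<bar>?\<theta> x b - ?\<theta> x a\<bar>" for x
      using cross[OF that] cross[OF that(2,1)] that(3) by (simp add: mult_less_0_iff abs_minus_commute)
    then show ?thesis using zeros[of a b] by blast
  qed
qed

text \<open>With \<open>\<kappa> = m * \<rho> * w / 400\<close>, the lens bound has
  \<open>\<kappa>\<^sup>2\<close> on the left and \<open>\<kappa> * w\<close> on the right, so
  \<open>\<kappa>\<close> and \<open>w\<close> cancel. The bound is the same for all widths, and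
  summing over dyadic widths costs only a factor of order \<open>k\<close>.\<close>

lemma sum_J_tangential:
  "(\<Sum>x\<in>I. \<Sum>a\<in>I. if tang \<rho> w x a then mu x * mu a * J x a else 0)
     \<le> 2400 * real k * sqrt (2 ^ k * C * \<rho> powr (s - 1) / m)"
proof -
  interpret lens_system I I mu mu F "\<lambda>x a. (vertex x a + 3) / 8" "13 * w / 8" "m * \<rho> * w / 400 * (47 * w * 2 ^ k)" k
    by (rule lens)
  define S where "S = (\<Sum>x\<in>I. \<Sum>a\<in>I. if tang \<rho> w x a then mu x * mu a * J x a else 0)"
  define \<kappa> where "\<kappa> = m * \<rho> * w / 400"
  define V where "V = C * (4 * \<rho>) powr s"
  have \<kappa>: "0 < \<kappa>" using m \<rho> w by (simp add: \<kappa>_def)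
  have r4: "1 / 2 ^ k \<le> 4 * \<rho>" using grid_le \<rho> by linarith
  have V: "(\<Sum>x\<in>I. \<Sum>y\<in>I. if R x y then mu x * mu y else 0) \<le> V" if "\<And>x y. R x y \<Longrightarrow> ds x y < 4 * \<rho>" for R
  proof -
    have "(\<Sum>x\<in>I. \<Sum>y\<in>I. if R x y then mu x * mu y else 0) \<le> (\<Sum>x\<in>I. \<Sum>y\<in>I. if ds x y < 4 * \<rho> then mu x * mu y else 0)"
      using that mu by (intro sum_mono) auto
    also have "\<dots> = (\<Sum>x\<in>I. \<Sum>y\<in>{y\<in>I. ds x y < 4 * \<rho>}. mu x * mu y)" unfolding sum.inter_filter[OF finI] ..
    also have "\<dots> \<le> V" unfolding V_def by (rule pair_mass[OF r4])
    finally show ?thesis .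
  qed
  have V0: "0 \<le> V" using C by (simp add: V_def)
  have S\<kappa>: "(\<Sum>x\<in>I. \<Sum>a\<in>I. mu x * mu a * F x a) = \<kappa> * S"
    unfolding S_def sum_distrib_left F_def \<kappa>_def by (intro sum.cong refl) auto
  have "(\<Sum>x\<in>I. \<Sum>a\<in>I. mu x * mu a * F x a)\<^sup>2 \<le> (\<Sum>x\<in>I. mu x) * (72 * (real k)\<^sup>2 * (m * \<rho> * w / 400 * (47 * w * 2 ^ k)) * V)"
    by (rule sum_F_sq_le) (rule V, use F_related_close in blast)+
  also have "\<dots> \<le> 1 * (72 * (real k)\<^sup>2 * (m * \<rho> * w / 400 * (47 * w * 2 ^ k)) * V)"
    using mu_sum V0 m \<rho> w by (intro mult_right_mono) auto
  finally have "\<kappa> * (\<kappa> * S\<^sup>2) \<le> \<kappa> * (3384 * (real k)\<^sup>2 * w * 2 ^ k * V)"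
    unfolding S\<kappa> \<kappa>_def[symmetric] by (simp add: power2_eq_square mult_ac)
  then have "\<kappa> * S\<^sup>2 \<le> 3384 * (real k)\<^sup>2 * w * 2 ^ k * V" using \<kappa> by simp
  then have "w * (m * \<rho> * S\<^sup>2) \<le> w * (1353600 * (real k)\<^sup>2 * 2 ^ k * V)" by (simp add: \<kappa>_def mult_ac)
  then have "m * \<rho> * S\<^sup>2 \<le> 1353600 * (real k)\<^sup>2 * 2 ^ k * V" using w by simp
  then have "S\<^sup>2 \<le> 1353600 * (real k)\<^sup>2 * 2 ^ k * V / (m * \<rho>)" using m \<rho> by (simp add: pos_le_divide_eq mult_ac)
  also have "\<dots> = 1353600 * 4 powr s * ((real k)\<^sup>2 * (2 ^ k * C * (\<rho> powr s / \<rho>) / m))"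
    unfolding V_def using \<rho> by (simp add: powr_mult mult_ac)
  also have "\<dots> = 1353600 * 4 powr s * ((real k)\<^sup>2 * (2 ^ k * C * \<rho> powr (s - 1) / m))"
    using \<rho> by (simp add: powr_diff)
  also have "\<dots> \<le> 5760000 * ((real k)\<^sup>2 * (2 ^ k * C * \<rho> powr (s - 1) / m))"
    using C m s powr_mono[of s 1 4] by (intro mult_right_mono) auto
  finally have "S\<^sup>2 \<le> (2400 * real k)\<^sup>2 * (2 ^ k * C * \<rho> powr (s - 1) / m)" by (simp add: power_mult_distrib)
  then have "S \<le> sqrt ((2400 * real k)\<^sup>2 * (2 ^ k * C * \<rho> powr (s - 1) / m))" by (rule real_le_rsqrt)
  also have "\<dots> = 2400 * real k * sqrt (2 ^ k * C * \<rho> powr (s - 1) / m)"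
    by (simp only: real_sqrt_mult real_sqrt_abs abs_mult abs_numeral abs_of_nat)
  finally show ?thesis unfolding S_def .
qed

end

end

section \<open>Summation over all dyadic classes of pairs\<close>

context weighted_quadratics
begin

lemma heavy_mass_le_card: "heavy_mass \<le> 2 ^ k"
proof -
  have "heavy_mass \<le> (\<Sum>j\<in>T. 1)"
    unfolding heavy_mass_def
  proof (rule sum_mono)
    fix j
    have "(\<Sum>x\<in>{x\<in>I. m \<le> N x j}. mu x) \<le> (\<Sum>x\<in>I. mu x)"
      using finI mu by (intro sum_mono2) auto
    then show "(\<Sum>x\<in>{x\<in>I. m \<le> N x j}. mu x) \<le> 1" using mu_sum by linarith
  qed
  also have "\<dots> = real (card T)" by simp
  also have "\<dots> \<le> real (card {..<(2::nat) ^ k})" using T by (intro of_nat_mono card_mono) auto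
  finally show ?thesis by simp
qed

lemma disc_sym: "disc y x = disc x y"
  by (simp add: disc_def power2_eq_square algebra_simps)

text \<open>A pair with equal leading coefficients fits neither orientation of \<open>tang\<close>.
  Its discriminant is the square of the linear coefficient; if small, it forces the constant
  coefficient to be small at a shared cell too, against \<open>\<rho> \<le> ds x y\<close>.\<close>

lemma J_eq_zero_no_curvature:
  assumes "c1 x = c1 y" "\<rho> \<le> ds x y" "\<bar>disc x y\<bar> < \<rho>\<^sup>2 / 48" "768 / 2 ^ k \<le> \<rho>"
  shows "J x y = 0"
proof (rule ccontr)
  assume "J x y \<noteq> 0"
  then have "0 < J x y" using J_nonneg[of x y] by simp
  then obtain j where j: "j \<in> T" "cell y j = cell x j" using J_pos_imp by blast
  define t where "t = real j / 2 ^ k"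
  define z2 where "z2 = c2 y - c2 x"
  define z3 where "z3 = c3 y - c3 x"
  have rpos: "0 < \<rho>" using assms(4) by (rule less_le_trans[rotated]) simp
  have t: "0 \<le> t" "t \<le> 1" using T_unit[OF j(1)] by (auto simp: t_def)
  have "z2\<^sup>2 < \<rho>\<^sup>2 / 48" using assms(1,3) by (simp add: disc_def z2_def)
  also have "\<dots> \<le> (\<rho> / 2)\<^sup>2" by (simp add: power_divide divide_left_mono)
  finally have "z2\<^sup>2 \<le> (\<rho> / 2)\<^sup>2" by simp
  then have "\<bar>z2\<bar> \<le> \<bar>\<rho> / 2\<bar>" by (simp only: abs_le_square_iff)
  then have z2: "\<bar>z2\<bar> \<le> \<rho> / 2" using rpos by simp
  have "\<bar>z2 * t + z3\<bar> < 1 / 2 ^ k"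
    using same_cell_dist[OF j(2)] assms(1) by (simp add: q_diff z2_def z3_def t_def)
  moreover have "1 / 2 ^ k \<le> \<rho> / 768" using assms(4) by simp
  moreover have "\<bar>z2 * t\<bar> \<le> \<bar>z2\<bar>" using t by (simp add: abs_mult mult_left_le)
  ultimately have "\<bar>z3\<bar> < \<rho>" using z2 rpos by linarith
  moreover have "\<bar>z2\<bar> < \<rho>" using z2 rpos by linarith
  ultimately have "ds x y < \<rho>" using assms(1) rpos by (simp add: ds_le_iff z2_def z3_def)
  then show False using assms(2) by simp
qed

text \<open>The widths satisfy \<open>\<rho> * w\<^sup>2 = 16 * 2 ^ n / 2 ^ k\<close>: class 0
  collects the discriminants below the resolution, every other class one dyadic range. Rounding up
  to a power of two loses a factor 2, so \<open>\<rho>\<^sup>2 / 48\<close> leads to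
  \<open>w\<^sup>2 \<le> 1 / 24\<close>.\<close>

lemma tangency_class_exists:
  assumes "c1 x < c1 y" "\<rho> \<le> ds x y" "ds x y < 2 * \<rho>" "\<bar>disc x y\<bar> < \<rho>\<^sup>2 / 48" "768 / 2 ^ k \<le> \<rho>" "\<rho> \<le> 1"
  shows "\<exists>n\<le>k. 16 * 2 ^ n / (2 ^ k * \<rho>) \<le> 1 / 24 \<and> tang \<rho> (sqrt (16 * 2 ^ n / (2 ^ k * \<rho>))) x y"
proof -
  have rpos: "0 < \<rho>" using assms(5) by (rule less_le_trans[rotated]) simp
  have sq: "(sqrt (16 * 2 ^ n / (2 ^ k * \<rho>)))\<^sup>2 = 16 * 2 ^ n / (2 ^ k * \<rho>)" for n :: nat
    using rpos by simp
  have leq: "n \<le> k" if "16 * 2 ^ n / (2 ^ k * \<rho>) \<le> 1 / 24" "\<rho> < 2" for n :: nat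
  proof -
    have "384 * 2 ^ n \<le> 2 ^ k * \<rho>" using that rpos by (simp add: field_simps)
    also have "\<dots> \<le> 2 ^ k * 384" using that by (intro mult_left_mono) auto
    finally have "(2::real) ^ n \<le> 2 ^ k" by simp
    then show ?thesis by simp
  qed
  show ?thesis
  proof (cases "\<bar>disc x y\<bar> < 16 * \<rho> / 2 ^ k")
    case True
    have *: "16 * 2 ^ 0 / (2 ^ k * \<rho>) \<le> 1 / 24" using assms(5) rpos by (simp add: field_simps)
    have "tang \<rho> (sqrt (16 * 2 ^ 0 / (2 ^ k * \<rho>))) x y"
      unfolding tang_def sq using assms True rpos by (simp add: power2_eq_square mult.commute)
    then show ?thesis using * by (intro exI[of _ 0]) simp
  next
    case False
    define D where "D = \<bar>disc x y\<bar> * 2 ^ k / (16 * \<rho>)"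
    have D: "1 \<le> D" using False rpos by (simp add: D_def field_simps)
    have dD: "\<bar>disc x y\<bar> = D * (16 * \<rho> / 2 ^ k)" using rpos by (simp add: D_def)
    obtain n0 where "D < 2 ^ n0" using real_arch_pow[of 2 D] by auto
    define n where "n = (LEAST n. D < 2 ^ n)"
    have n: "D < 2 ^ n" unfolding n_def by (rule LeastI) fact
    then have "n \<noteq> 0" using D by (cases n) auto
    then obtain n' where n': "n = Suc n'" by (cases n) auto
    have "\<not> D < 2 ^ n'" using not_less_Least[of n' "\<lambda>n. D < 2 ^ n"] n' unfolding n_def by simp
    then have n2: "2 ^ n \<le> 2 * D" by (simp add: n')
    have n1: "2 \<le> (2::real) ^ n" by (simp add: n')
    have w: "16 * 2 ^ n / (2 ^ k * \<rho>) \<le> 1 / 24"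
    proof -
      have "16 * 2 ^ n / (2 ^ k * \<rho>) \<le> 16 * (2 * D) / (2 ^ k * \<rho>)"
        using n2 rpos by (intro divide_right_mono mult_left_mono) auto
      also have "\<dots> = 2 * \<bar>disc x y\<bar> / \<rho>\<^sup>2" unfolding dD using rpos by (simp add: power2_eq_square field_simps)
      also have "\<dots> \<le> 2 * (\<rho>\<^sup>2 / 48) / \<rho>\<^sup>2" using assms(4) rpos by (intro divide_right_mono) auto
      also have "\<dots> = 1 / 24" using rpos by simp
      finally show ?thesis .
    qed
    have eq: "\<rho>\<^sup>2 * (16 * 2 ^ n / (2 ^ k * \<rho>)) = 2 ^ n * (16 * \<rho> / 2 ^ k)"
      using rpos by (simp add: power2_eq_square)
    have eq1: "\<rho> * (16 * 2 ^ n / (2 ^ k * \<rho>)) = 2 ^ n * (16 / 2 ^ k)" using rpos by simp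
    have "tang \<rho> (sqrt (16 * 2 ^ n / (2 ^ k * \<rho>))) x y"
      unfolding tang_def sq eq eq1
    proof (intro conjI disjI2)
      show "\<bar>disc x y\<bar> < 2 ^ n * (16 * \<rho> / 2 ^ k)"
        unfolding dD using n rpos by (intro mult_strict_right_mono) auto
      have "2 * (16 / 2 ^ k) \<le> 2 ^ n * (16 / (2 ^ k :: real))" using n1 by (intro mult_right_mono) auto
      then show "32 / 2 ^ k \<le> 2 ^ n * (16 / (2 ^ k :: real))" by simp
      have "2 ^ n * (16 * \<rho> / 2 ^ k) \<le> (2 * D) * (16 * \<rho> / 2 ^ k)"
        using n2 rpos by (intro mult_right_mono) auto
      also have "\<dots> = 2 * \<bar>disc x y\<bar>" unfolding dD by simp
      finally have "2 ^ n * (16 * \<rho> / 2 ^ k) / 2 \<le> 2 * \<bar>disc x y\<bar> / 2"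
        by (rule divide_right_mono) simp
      then show "2 ^ n * (16 * \<rho> / 2 ^ k) / 2 \<le> \<bar>disc x y\<bar>" by simp
    qed (use assms in auto)
    moreover have "n \<le> k" using leq[OF w] assms(6) by linarith
    ultimately show ?thesis using w by blast
  qed
qed

text \<open>At radius \<open>1 / \<Lambda>\<close> the Frostman bound equals \<open>m / 2\<close>,
  so the closer pairs make up at most half of the heavy mass and are absorbed on the left. At the
  larger dyadic distances \<open>C * \<rho> powr (s - 1) / m\<close> is largest for the smallest
  radius, where it is at most \<open>\<Lambda>\<close>.\<close>

theorem heavy_mass_le:
  defines "\<Lambda> \<equiv> (2 * C / m) powr (1 / s)"
  shows "heavy_mass \<le> 20000 * (real k + 1) ^ 3 * (\<Lambda> + sqrt (2 ^ k * \<Lambda>))"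
proof -
  have Lpow: "\<Lambda> powr s = 2 * C / m" using C m s by (simp add: \<Lambda>_def powr_powr)
  have L1: "1 \<le> \<Lambda>" unfolding \<Lambda>_def using C m s by (intro ge_one_powr_ge_zero) (auto simp: field_simps)
  define i0 where "i0 = nat \<lceil>log 2 \<Lambda>\<rceil>"
  define r where "r i = 1 / (2 ^ i :: real)" for i :: nat
  have i0: "log 2 \<Lambda> \<le> real i0" "real i0 < log 2 \<Lambda> + 1"
  proof -
    have "0 \<le> log 2 \<Lambda>" using L1 by simp
    then have "real i0 = of_int \<lceil>log 2 \<Lambda>\<rceil>" by (simp add: i0_def)
    then show "log 2 \<Lambda> \<le> real i0" "real i0 < log 2 \<Lambda> + 1" by linarith+
  qed
  have "\<Lambda> = 2 powr (log 2 \<Lambda>)" using L1 by simp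
  also have "\<dots> \<le> 2 powr (real i0)" using i0 by (intro powr_mono) auto
  also have "\<dots> = 2 ^ i0" by (simp add: powr_realpow)
  finally have Lle: "\<Lambda> \<le> 2 ^ i0" .
  have "2 ^ i0 = 2 powr (real i0)" by (simp add: powr_realpow)
  also have "\<dots> \<le> 2 powr (log 2 \<Lambda> + 1)" using i0 by (intro powr_mono) auto
  also have "\<dots> = 2 * \<Lambda>" using L1 by (simp add: powr_add)
  finally have Lge: "2 ^ i0 \<le> 2 * \<Lambda>" .
  define B where "B = \<Lambda> + sqrt (2 ^ k * \<Lambda>)"
  have B: "\<Lambda> \<le> B" "sqrt (2 ^ k * \<Lambda>) \<le> B" "0 \<le> B" using L1 by (auto simp: B_def)
  have k3: "1 \<le> (real k + 1) ^ 3" by (intro one_le_power) auto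
  show ?thesis
  proof (cases "r i0 < 768 / 2 ^ k")
    case True
    \<comment> \<open>The critical radius is near or below the resolution; then \<open>2 ^ k\<close>
      is itself at most \<open>1600 * \<Lambda>\<close> and the trivial bound suffices.\<close>
    then have "(2::real) ^ k < 768 * 2 ^ i0" by (simp add: r_def field_simps)
    also have "\<dots> \<le> 1600 * \<Lambda>" using Lge L1 by linarith
    finally have "sqrt (2 ^ k * 2 ^ k) \<le> sqrt (2 ^ k * (1600 * \<Lambda>))"
      by (intro real_sqrt_le_mono mult_left_mono) auto
    also have "\<dots> = sqrt (1600 * (2 ^ k * \<Lambda>))" by (simp add: mult_ac)
    also have "\<dots> = 40 * sqrt (2 ^ k * \<Lambda>)"
    proof -
      have "sqrt 1600 = sqrt (40\<^sup>2)" by simp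
      then have "sqrt 1600 = 40" by (simp only: real_sqrt_abs abs_numeral)
      then show ?thesis by (simp only: real_sqrt_mult)
    qed
    finally have "2 ^ k \<le> 40 * B" using B(2) by simp
    then have "heavy_mass \<le> 40 * B" using heavy_mass_le_card by linarith
    also have "\<dots> \<le> 20000 * (real k + 1) ^ 3 * B" using k3 B(3) by (intro mult_right_mono; linarith)
    finally show ?thesis by (simp add: B_def)
  next
    case False
    then have r0: "768 / 2 ^ k \<le> r i0" by simp
    have i0k: "i0 \<le> k"
    proof -
      have "2 ^ i0 * 768 \<le> (2 ^ k :: real)" using r0 by (simp add: r_def field_simps)
      then have "(2::real) ^ i0 \<le> 2 ^ k" by (rule order_trans[rotated]) simp
      then show ?thesis by simp
    qed
    have ri: "768 / 2 ^ k \<le> r i" "r i \<le> 1" "0 < r i" if "i \<le> i0" for i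
    proof -
      have "r i0 \<le> r i" using that by (simp add: r_def divide_left_mono)
      then show "768 / 2 ^ k \<le> r i" using r0 by linarith
    qed (auto simp: r_def)
    have Cri: "C * r i powr (s - 1) / m \<le> \<Lambda>" if "i \<le> i0" for i
    proof -
      have "1 / (2 * \<Lambda>) \<le> 1 / 2 ^ i0" using Lge L1 by (intro divide_left_mono) auto
      also have "\<dots> \<le> r i" using that by (simp add: r_def divide_left_mono)
      finally have "r i powr (s - 1) \<le> (1 / (2 * \<Lambda>)) powr (s - 1)" using L1 s by (intro powr_mono2') auto
      also have "\<dots> = (2 * \<Lambda>) powr (1 - s)" using L1 by (simp add: powr_divide powr_minus_divide[symmetric])
      also have "\<dots> = (2 * \<Lambda>) / (2 * \<Lambda>) powr s" using L1 by (simp add: powr_diff)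
      also have "\<dots> = (2 * \<Lambda>) / (2 powr s * (2 * C / m))" using L1 Lpow by (simp add: powr_mult)
      also have "\<dots> \<le> (2 * \<Lambda>) / (1 * (2 * C / m))"
        using L1 C m s by (intro divide_left_mono mult_right_mono) (auto intro: ge_one_powr_ge_zero)
      also have "\<dots> = \<Lambda> * m / C" using C m by simp
      finally have "C * r i powr (s - 1) / m \<le> C * (\<Lambda> * m / C) / m"
        using C m by (intro divide_right_mono mult_left_mono) auto
      then show ?thesis using C m by simp
    qed
    have near: "(\<Sum>x\<in>I. \<Sum>y\<in>{y\<in>I. ds x y < r i0}. mu x * mu y * J x y) \<le> heavy_mass / 2"
    proof (rule sum_J_near)
      have "1 / 2 ^ k \<le> 768 / (2 ^ k :: real)" by (intro divide_right_mono) auto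
      then show "1 / 2 ^ k \<le> r i0" using r0 by linarith
      have "C * r i0 powr s \<le> C * (1 / \<Lambda>) powr s"
        using Lle L1 C s by (intro mult_left_mono powr_mono2) (auto simp: r_def intro!: divide_left_mono)
      also have "\<dots> = C / \<Lambda> powr s" using L1 by (simp add: powr_divide)
      also have "\<dots> = m / 2" using C m by (simp add: Lpow)
      finally show "C * r i0 powr s \<le> m / 2" .
    qed
    define wt where "wt i n = sqrt (16 * 2 ^ n / (2 ^ k * r i))" for i n :: nat
    define Q where "Q i = {n. n \<le> k \<and> 16 * 2 ^ n / (2 ^ k * r i) \<le> 1 / 24}" for i
    define tr where "tr i x y = (if ds x y < 2 * r i \<and> (r i)\<^sup>2 / 48 \<le> \<bar>disc x y\<bar> then mu x * mu y * J x y else 0)" for i x y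
    define tg where "tg i n x y = (if tang (r i) (wt i n) x y then mu x * mu y * J x y else 0)" for i n x y
    have finQ: "finite (Q i)" "real (card (Q i)) \<le> real k + 1" for i
    proof -
      have "Q i \<subseteq> {..k}" by (auto simp: Q_def)
      then show "finite (Q i)" "real (card (Q i)) \<le> real k + 1"
        using card_mono[of "{..k}" "Q i"] finite_subset[of "Q i" "{..k}"] by auto
    qed
    have nonneg: "0 \<le> tr i x y" "0 \<le> tg i n x y" if "x \<in> I" "y \<in> I" for i n x y
      using that mu J_nonneg by (auto simp: tr_def tg_def)
    \<comment> \<open>Both \<open>tg i n x y\<close> and \<open>tg i n y x\<close> are added because
      \<open>tang\<close> is oriented by the leading coefficients.\<close>
    have cover: "(if ds x y < r i0 then 0 else mu x * mu y * J x y)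
        \<le> (\<Sum>i\<in>{1..i0}. tr i x y + (\<Sum>n\<in>Q i. tg i n x y + tg i n y x))" if xy: "x \<in> I" "y \<in> I" for x y
    proof -
      have nn: "0 \<le> (\<Sum>n\<in>Q i. tg i n x y + tg i n y x)" for i
        using nonneg xy by (intro sum_nonneg add_nonneg_nonneg) auto
      have nn': "0 \<le> tr i x y + (\<Sum>n\<in>Q i. tg i n x y + tg i n y x)" for i
        using nonneg xy nn by (intro add_nonneg_nonneg) auto
      show ?thesis
      proof (cases "ds x y < r i0 \<or> J x y = 0")
        case True
        then show ?thesis using nn' by (auto intro!: sum_nonneg)
      next
        case False
        define i where "i = (LEAST i. r i \<le> ds x y)"
        have i: "r i \<le> ds x y" unfolding i_def by (rule LeastI[of _ i0]) (use False in simp)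
        have ii0: "i \<le> i0" unfolding i_def by (rule Least_le) (use False in simp)
        have "ds x y < 1" using coord[OF xy(1)] coord[OF xy(2)] by (auto simp: ds_le_iff abs_less_iff)
        then have "i \<noteq> 0" using i by (cases i) (auto simp: r_def)
        then obtain i' where i': "i = Suc i'" by (cases i) auto
        have "\<not> r i' \<le> ds x y" using not_less_Least[of i' "\<lambda>i. r i \<le> ds x y"] i' unfolding i_def by simp
        then have i2: "ds x y < 2 * r i" by (simp add: i' r_def)
        have mem: "i \<in> {1..i0}" using ii0 i' by simp
        have "mu x * mu y * J x y \<le> tr i x y + (\<Sum>n\<in>Q i. tg i n x y + tg i n y x)"
        proof (cases "(r i)\<^sup>2 / 48 \<le> \<bar>disc x y\<bar>")
          case True
          then show ?thesis using i2 nn[of i] by (simp add: tr_def)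
        next
          case d: False
          have "c1 x \<noteq> c1 y"
            using J_eq_zero_no_curvature[of x y "r i"] False i d ri(1)[OF ii0] by auto
          then consider "c1 x < c1 y" | "c1 y < c1 x" by linarith
          then have "\<exists>n\<in>Q i. mu x * mu y * J x y \<le> tg i n x y + tg i n y x"
          proof cases
            case 1
            then obtain n where n: "n \<in> Q i" "tang (r i) (wt i n) x y"
              using tangency_class_exists[of x y "r i"] i i2 d ri[OF ii0] by (auto simp: Q_def wt_def)
            then have "mu x * mu y * J x y \<le> tg i n x y + tg i n y x"
              using nonneg(2)[OF xy(2,1), of i n] by (simp add: tg_def[of i n x y])
            then show ?thesis using n by blast
          next
            case 2
            then obtain n where n: "n \<in> Q i" "tang (r i) (wt i n) y x"
              using tangency_class_exists[of y x "r i"] i i2 d ri[OF ii0] ds_sym[of x y] disc_sym[of x y]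
              by (auto simp: Q_def wt_def)
            then have "mu x * mu y * J x y \<le> tg i n x y + tg i n y x"
              using nonneg(2)[OF xy, of i n] J_sym[of x y] by (simp add: tg_def[of i n y x] mult.commute)
            then show ?thesis using n by blast
          qed
          then obtain n where n: "n \<in> Q i" "mu x * mu y * J x y \<le> tg i n x y + tg i n y x" by blast
          have "tg i n x y + tg i n y x \<le> (\<Sum>n\<in>Q i. tg i n x y + tg i n y x)"
            using finQ n nonneg xy by (intro member_le_sum add_nonneg_nonneg) auto
          then show ?thesis using n(2) nonneg(1)[OF xy, of i] by linarith
        qed
        also have "\<dots> \<le> (\<Sum>i\<in>{1..i0}. tr i x y + (\<Sum>n\<in>Q i. tg i n x y + tg i n y x))"
          using mem nn' by (intro member_le_sum) auto
        finally show ?thesis using False by simp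
      qed
    qed
    have "heavy_mass = (\<Sum>x\<in>I. \<Sum>y\<in>I. mu x * mu y * J x y)" by (rule sum_J[symmetric])
    also have "\<dots> = (\<Sum>x\<in>I. \<Sum>y\<in>{y\<in>I. ds x y < r i0}. mu x * mu y * J x y)
        + (\<Sum>x\<in>I. \<Sum>y\<in>I. if ds x y < r i0 then 0 else mu x * mu y * J x y)"
      unfolding sum.inter_filter[OF finI] sum.distrib[symmetric] by (intro sum.cong refl) auto
    also have "\<dots> \<le> heavy_mass / 2 + (\<Sum>x\<in>I. \<Sum>y\<in>I. \<Sum>i\<in>{1..i0}. tr i x y + (\<Sum>n\<in>Q i. tg i n x y + tg i n y x))"
      by (intro add_mono near sum_mono cover)
    finally have "heavy_mass \<le> 2 * (\<Sum>x\<in>I. \<Sum>y\<in>I. \<Sum>i\<in>{1..i0}. tr i x y + (\<Sum>n\<in>Q i. tg i n x y + tg i n y x))"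
      by simp
    also have "(\<Sum>x\<in>I. \<Sum>y\<in>I. \<Sum>i\<in>{1..i0}. tr i x y + (\<Sum>n\<in>Q i. tg i n x y + tg i n y x))
      = (\<Sum>i\<in>{1..i0}. \<Sum>x\<in>I. \<Sum>y\<in>I. tr i x y + (\<Sum>n\<in>Q i. tg i n x y + tg i n y x))"
      by (rule sum_swap3)
    also have "\<dots> \<le> (\<Sum>i\<in>{1..i0}. 84 * B + (real k + 1) * (4800 * real k * B))"
    proof (rule sum_mono)
      fix i assume "i \<in> {1..i0}"
      then have i: "i \<le> i0" by simp
      have sw: "(\<Sum>x\<in>I. \<Sum>y\<in>I. \<Sum>n\<in>Q i. tg i n x y + tg i n y x) = (\<Sum>n\<in>Q i. (\<Sum>x\<in>I. \<Sum>y\<in>I. tg i n x y) + (\<Sum>x\<in>I. \<Sum>y\<in>I. tg i n x y))"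
      proof -
        have "(\<Sum>x\<in>I. \<Sum>y\<in>I. \<Sum>n\<in>Q i. tg i n x y + tg i n y x) = (\<Sum>n\<in>Q i. \<Sum>x\<in>I. \<Sum>y\<in>I. tg i n x y + tg i n y x)"
          by (rule sum_swap3)
        also have "\<dots> = (\<Sum>n\<in>Q i. (\<Sum>x\<in>I. \<Sum>y\<in>I. tg i n x y) + (\<Sum>x\<in>I. \<Sum>y\<in>I. tg i n y x))"
          by (simp add: sum.distrib)
        also have "\<dots> = (\<Sum>n\<in>Q i. (\<Sum>x\<in>I. \<Sum>y\<in>I. tg i n x y) + (\<Sum>x\<in>I. \<Sum>y\<in>I. tg i n x y))"
          by (subst (2) sum.swap) (rule refl)
        finally show ?thesis .
      qed
      have trb: "(\<Sum>x\<in>I. \<Sum>y\<in>I. tr i x y) \<le> 84 * B"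
      proof -
        have "(\<Sum>x\<in>I. \<Sum>y\<in>I. tr i x y) \<le> 84 * (C * r i powr (s - 1) / m)"
          unfolding tr_def using sum_J_transversal[OF ri(1,2)[OF i]] by simp
        also have "\<dots> \<le> 84 * B" using Cri[OF i] B(1) by linarith
        finally show ?thesis .
      qed
      have tgb: "(\<Sum>x\<in>I. \<Sum>y\<in>I. tg i n x y) \<le> 2400 * real k * B" if n: "n \<in> Q i" for n
      proof -
        have pos: "0 < 2 ^ k * r i" using ri[OF i] by simp
        have wsq: "(wt i n)\<^sup>2 = 16 * 2 ^ n / (2 ^ k * r i)" using pos by (simp add: wt_def)
        have "(\<Sum>x\<in>I. \<Sum>y\<in>I. tg i n x y) \<le> 2400 * real k * sqrt (2 ^ k * C * r i powr (s - 1) / m)"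
          unfolding tg_def
        proof (rule sum_J_tangential[OF ri(3,2)[OF i]])
          show "0 < wt i n" using pos by (simp add: wt_def)
          show "(wt i n)\<^sup>2 \<le> 1 / 24" unfolding wsq using n by (simp add: Q_def)
          have "16 * 1 / 2 ^ k \<le> 16 * 2 ^ n / (2 ^ k :: real)" by (intro divide_right_mono mult_left_mono) auto
          then show "16 / 2 ^ k \<le> r i * (wt i n)\<^sup>2" unfolding wsq using ri(3)[OF i] by simp
        qed
        also have "\<dots> \<le> 2400 * real k * sqrt (2 ^ k * \<Lambda>)"
          using Cri[OF i] by (intro mult_left_mono real_sqrt_le_mono) (auto simp: mult.assoc simp flip: times_divide_eq_right)
        also have "\<dots> \<le> 2400 * real k * B" using B by (intro mult_left_mono) auto
        finally show ?thesis .
      qed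
      have "(\<Sum>x\<in>I. \<Sum>y\<in>I. tr i x y + (\<Sum>n\<in>Q i. tg i n x y + tg i n y x))
        = (\<Sum>x\<in>I. \<Sum>y\<in>I. tr i x y) + (\<Sum>x\<in>I. \<Sum>y\<in>I. \<Sum>n\<in>Q i. tg i n x y + tg i n y x)"
        by (simp add: sum.distrib)
      also have "\<dots> \<le> 84 * B + (\<Sum>n\<in>Q i. 2400 * real k * B + 2400 * real k * B)"
        unfolding sw by (intro add_mono trb sum_mono tgb)
      also have "\<dots> = 84 * B + real (card (Q i)) * (4800 * real k * B)" by simp
      also have "\<dots> \<le> 84 * B + (real k + 1) * (4800 * real k * B)"
        using finQ(2)[of i] B(3) by (intro add_mono mult_right_mono) auto
      finally show "(\<Sum>x\<in>I. \<Sum>y\<in>I. tr i x y + (\<Sum>n\<in>Q i. tg i n x y + tg i n y x)) \<le> 84 * B + (real k + 1) * (4800 * real k * B)" .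
    qed
    also have "\<dots> = real i0 * ((84 + 4800 * real k * (real k + 1)) * B)" by (simp add: algebra_simps)
    also have "\<dots> \<le> real k * ((84 + 4800 * real k * (real k + 1)) * B)"
      using i0k B by (intro mult_right_mono) auto
    also have "\<dots> = (84 * real k + 4800 * real k * real k * (real k + 1)) * B" by (simp add: algebra_simps)
    also have "\<dots> \<le> (10000 * (real k + 1) ^ 3) * B"
    proof (rule mult_right_mono)
      have "(10000 * (real k + 1) ^ 3) - (84 * real k + 4800 * real k * real k * (real k + 1))
         = 5200 * (real k)^3 + 25200 * (real k)^2 + 29916 * real k + 10000"
        by (simp add: power3_eq_cube power2_eq_square algebra_simps)
      also have "\<dots> \<ge> 0" by (intro add_nonneg_nonneg) auto
      finally show "84 * real k + 4800 * real k * real k * (real k + 1) \<le> 10000 * (real k + 1) ^ 3" by linarith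
    qed (rule B)
    finally show ?thesis by (simp add: B_def)
  qed
qed

end

section \<open>Null sets of Hausdorff measures\<close>

abbreviation hnull :: "real \<Rightarrow> 'a::metric_space set \<Rightarrow> bool" where
  "hnull s A \<equiv> hausdorff_measure s A = 0"

lemma diameter_le_dist:
  fixes S :: "'a::metric_space set"
  assumes "0 \<le> d" "\<And>x y. x \<in> S \<Longrightarrow> y \<in> S \<Longrightarrow> dist x y \<le> d"
  shows "diameter S \<le> d"
  using assms unfolding diameter_def by (auto intro!: cSUP_least)

lemma hnull_iff_cover:
  "hnull s A \<longleftrightarrow> (\<forall>\<delta>>0. \<forall>e>0. \<exists>U :: nat \<Rightarrow> 'a::metric_space set.
     A \<subseteq> (\<Union>i. U i) \<and> (\<forall>i. bounded (U i) \<and> diameter (U i) \<le> \<delta>) \<and>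
     (\<Sum>i. hausdorff_gauge s (U i)) \<le> ennreal e)"
proof -
  have "hausdorff_content s \<delta> A = 0 \<longleftrightarrow> (\<forall>e>0. \<exists>U. A \<subseteq> (\<Union>i. U i) \<and> (\<forall>i. bounded (U i) \<and> diameter (U i) \<le> \<delta>) \<and>
     (\<Sum>i. hausdorff_gauge s (U i)) \<le> ennreal e)" for \<delta>
  proof
    assume z: "hausdorff_content s \<delta> A = 0"
    show "\<forall>e>0. \<exists>U. A \<subseteq> (\<Union>i. U i) \<and> (\<forall>i. bounded (U i) \<and> diameter (U i) \<le> \<delta>) \<and>
     (\<Sum>i. hausdorff_gauge s (U i)) \<le> ennreal e"
    proof (intro allI impI)
      fix e :: real assume "0 < e"
      then have "hausdorff_content s \<delta> A < ennreal e" using z by simp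
      then show "\<exists>U. A \<subseteq> (\<Union>i. U i) \<and> (\<forall>i. bounded (U i) \<and> diameter (U i) \<le> \<delta>) \<and>
     (\<Sum>i. hausdorff_gauge s (U i)) \<le> ennreal e"
        unfolding hausdorff_content_def INF_less_iff by (auto intro: less_imp_le)
    qed
  next
    assume R: "\<forall>e>0. \<exists>U. A \<subseteq> (\<Union>i. U i) \<and> (\<forall>i. bounded (U i) \<and> diameter (U i) \<le> \<delta>) \<and>
     (\<Sum>i. hausdorff_gauge s (U i)) \<le> ennreal e"
    have "hausdorff_content s \<delta> A \<le> 0 + ennreal e" if e: "0 < e" for e
    proof -
      obtain U where "A \<subseteq> (\<Union>i. U i) \<and> (\<forall>i. bounded (U i) \<and> diameter (U i) \<le> \<delta>)"
        "(\<Sum>i. hausdorff_gauge s (U i)) \<le> ennreal e" using R[rule_format, OF e] by blast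
      then show ?thesis unfolding hausdorff_content_def add_0 by (intro INF_lower2[of U]) simp_all
    qed
    then have "hausdorff_content s \<delta> A \<le> 0" by (rule ennreal_le_epsilon)
    then show "hausdorff_content s \<delta> A = 0" by simp
  qed
  moreover have "hnull s A \<longleftrightarrow> (\<forall>\<delta>>0. hausdorff_content s \<delta> A = 0)"
    unfolding hausdorff_measure_def by (subst SUP_eq_iff) (auto simp: bot_ennreal)
  ultimately show ?thesis by simp
qed

lemma hnull_coverE:
  fixes A :: "'a::metric_space set"
  assumes "hnull s A" "0 < \<delta>" "0 < e"
  obtains U :: "nat \<Rightarrow> 'a set" where "A \<subseteq> (\<Union>i. U i)" "\<And>i. bounded (U i)" "\<And>i. diameter (U i) \<le> \<delta>"
     "(\<Sum>i. hausdorff_gauge s (U i)) \<le> ennreal e"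
  using assms unfolding hnull_iff_cover by metis

lemma hnull_subset: "hnull s B \<Longrightarrow> A \<subseteq> B \<Longrightarrow> hnull s A"
  unfolding hnull_iff_cover by (meson order_trans)

lemma hnull_empty: "hnull s {}"
  unfolding hnull_iff_cover
  by (intro allI impI exI[of _ "\<lambda>_. {}"]) (simp add: hausdorff_gauge_def)

lemma suminf_prod_decode:
  fixes f :: "nat \<Rightarrow> nat \<Rightarrow> ennreal"
  shows "(\<Sum>i. f (fst (prod_decode i)) (snd (prod_decode i))) = (\<Sum>k. \<Sum>j. f k j)"
  using suminf_ennreal_2dimen[of "\<lambda>k. \<Sum>j. f k j" "\<lambda>p. f (fst p) (snd p)"] by simp

lemma hnull_UN_nat:
  fixes A :: "nat \<Rightarrow> 'a::metric_space set"
  assumes "\<And>n. hnull s (A n)"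
  shows "hnull s (\<Union>n. A n)"
  unfolding hnull_iff_cover
proof (intro allI impI)
  fix \<delta> e :: real assume \<delta>: "0 < \<delta>" and e: "0 < e"
  have "\<exists>U. A n \<subseteq> (\<Union>i. U i) \<and> (\<forall>i. bounded (U i) \<and> diameter (U i) \<le> \<delta>) \<and>
     (\<Sum>i. hausdorff_gauge s (U i)) \<le> ennreal (e * (1 / 2) ^ Suc n)" for n
    using assms[of n] \<delta> e unfolding hnull_iff_cover by simp
  then obtain U where U: "\<And>n. A n \<subseteq> (\<Union>i. U n i)" "\<And>n i. bounded (U n i)" "\<And>n i. diameter (U n i) \<le> \<delta>"
     "\<And>n. (\<Sum>i. hausdorff_gauge s (U n i)) \<le> ennreal (e * (1 / 2) ^ Suc n)" by metis
  define W where "W i = (case prod_decode i of (n, j) \<Rightarrow> U n j)" for i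
  have "(\<Sum>i. hausdorff_gauge s (W i)) = (\<Sum>n. \<Sum>j. hausdorff_gauge s (U n j))"
    unfolding W_def case_prod_beta by (rule suminf_prod_decode)
  also have "\<dots> \<le> (\<Sum>n. ennreal (e * (1 / 2) ^ Suc n))"
    by (intro suminf_le U) auto
  also have "\<dots> = ennreal e"
  proof (rule suminf_ennreal_eq)
    show "(\<lambda>n. e * (1 / 2) ^ Suc n) sums e"
      using sums_mult[OF power_half_series, of e] by simp
  qed (use e in auto)
  finally have "(\<Sum>i. hausdorff_gauge s (W i)) \<le> ennreal e" .
  moreover have "(\<Union>n. A n) \<subseteq> (\<Union>i. W i)"
  proof
    fix x assume "x \<in> (\<Union>n. A n)"
    then obtain n j where "x \<in> U n j" using U(1) by blast
    then have "x \<in> W (prod_encode (n, j))" by (simp add: W_def)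
    then show "x \<in> (\<Union>i. W i)" by blast
  qed
  ultimately show "\<exists>U. (\<Union>n. A n) \<subseteq> (\<Union>i. U i) \<and> (\<forall>i. bounded (U i) \<and> diameter (U i) \<le> \<delta>) \<and>
     (\<Sum>i. hausdorff_gauge s (U i)) \<le> ennreal e"
    using U by (intro exI[of _ W]) (auto simp: W_def split: prod.split)
qed

lemma hnull_UN:
  assumes "countable I" "\<And>i. i \<in> I \<Longrightarrow> hnull s (A i)"
  shows "hnull s (\<Union>i\<in>I. A i)"
proof (cases "I = {}")
  case False
  have "hnull s (\<Union>n. A (from_nat_into I n))"
    using assms(2) from_nat_into[OF False] by (intro hnull_UN_nat) auto
  then show ?thesis
    by (rule hnull_subset) (use assms(1) False in \<open>auto, metis from_nat_into_surj\<close>)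
qed (simp add: hnull_empty)

lemma hnull_singleton:
  assumes "0 < s"
  shows "hnull s {x :: 'a::metric_space}"
  unfolding hnull_iff_cover
proof (intro allI impI)
  fix \<delta> e :: real assume "0 < \<delta>" "0 < e"
  have "hausdorff_gauge s {x} = 0" using assms by (simp add: hausdorff_gauge_def)
  then show "\<exists>U. {x} \<subseteq> (\<Union>i. U i) \<and> (\<forall>i. bounded (U i) \<and> diameter (U i) \<le> \<delta>) \<and>
     (\<Sum>i. hausdorff_gauge s (U i)) \<le> ennreal e"
    using \<open>0 < \<delta>\<close> by (intro exI[of _ "\<lambda>_. {x}"]) auto
qed

lemma hnull_Un: "hnull s A \<Longrightarrow> hnull s B \<Longrightarrow> hnull s (A \<union> B)"
  using hnull_UN[of "{True, False}" s "\<lambda>b. if b then A else B"] by (simp add: Un_commute)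

lemma hnull_lipschitz_image:
  fixes f :: "'a::metric_space \<Rightarrow> 'b::metric_space"
  assumes s: "0 \<le> s" and null: "hnull s A"
    and lip: "\<And>x y. x \<in> A \<Longrightarrow> y \<in> A \<Longrightarrow> dist (f x) (f y) \<le> C * dist x y"
  shows "hnull s (f ` A)"
  unfolding hnull_iff_cover
proof (intro allI impI)
  fix \<delta> e :: real assume \<delta>: "0 < \<delta>" and e: "0 < e"
  define L where "L = max C 1"
  have L: "1 \<le> L" "C \<le> L" by (auto simp: L_def)
  have lip': "dist (f x) (f y) \<le> L * dist x y" if "x \<in> A" "y \<in> A" for x y
    using lip[OF that] mult_right_mono[OF L(2), of "dist x y"] by simp
  have Ls: "0 < L powr s" using L by simp
  obtain U where U: "A \<subseteq> (\<Union>i. U i)" "\<And>i. bounded (U i)" "\<And>i. diameter (U i) \<le> \<delta> / L"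
     "(\<Sum>i. hausdorff_gauge s (U i)) \<le> ennreal (e / L powr s)"
    by (rule hnull_coverE[OF null, of "\<delta> / L" "e / L powr s"]) (use \<delta> e L Ls in auto)
  define W where "W i = f ` (A \<inter> U i)" for i
  have d0: "0 \<le> diameter (U i)" for i using U(2) by (rule diameter_ge_0)
  have dW: "dist x y \<le> L * diameter (U i)" if "x \<in> W i" "y \<in> W i" for x y i
  proof -
    obtain a b where ab: "a \<in> A" "a \<in> U i" "b \<in> A" "b \<in> U i" "x = f a" "y = f b" using \<open>x \<in> W i\<close> \<open>y \<in> W i\<close> unfolding W_def by blast
    have "dist x y \<le> L * dist a b" using lip' ab by simp
    also have "\<dots> \<le> L * diameter (U i)"
      using L diameter_bounded_bound[OF U(2) ab(2,4)] by (intro mult_left_mono) auto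
    finally show ?thesis .
  qed
  have diamW: "diameter (W i) \<le> L * diameter (U i)" for i
    using L d0 dW by (intro diameter_le_dist) auto
  have bW: "bounded (W i)" for i
  proof (cases "W i = {}")
    case False
    then obtain x where "x \<in> W i" by blast
    then have "\<forall>y\<in>W i. dist x y \<le> L * diameter (U i)" using dW by blast
    then show ?thesis unfolding bounded_def by blast
  qed simp
  have gW: "hausdorff_gauge s (W i) \<le> ennreal (L powr s) * hausdorff_gauge s (U i)" for i
  proof (cases "W i = {}")
    case False
    then have Ui: "U i \<noteq> {}" by (auto simp: W_def)
    show ?thesis
    proof (cases "s = 0")
      case False
      have "diameter (W i) powr s \<le> (L * diameter (U i)) powr s"
        using s diamW diameter_ge_0[OF bW] by (intro powr_mono2) auto
      also have "\<dots> = L powr s * diameter (U i) powr s" using L d0 by (simp add: powr_mult)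
      finally show ?thesis using \<open>W i \<noteq> {}\<close> Ui False
        by (simp add: hausdorff_gauge_def ennreal_mult[symmetric] ennreal_leI)
    qed (use \<open>W i \<noteq> {}\<close> Ui L in \<open>simp add: hausdorff_gauge_def\<close>)
  qed (simp add: hausdorff_gauge_def)
  have "(\<Sum>i. hausdorff_gauge s (W i)) \<le> (\<Sum>i. ennreal (L powr s) * hausdorff_gauge s (U i))"
    by (intro suminf_le gW) auto
  also have "\<dots> = ennreal (L powr s) * (\<Sum>i. hausdorff_gauge s (U i))" by simp
  also have "\<dots> \<le> ennreal (L powr s) * ennreal (e / L powr s)" by (intro mult_left_mono U) auto
  also have "\<dots> = ennreal e" using Ls e by (simp add: ennreal_mult[symmetric])
  finally have "(\<Sum>i. hausdorff_gauge s (W i)) \<le> ennreal e" .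
  moreover have "f ` A \<subseteq> (\<Union>i. W i)"
  proof
    fix y assume "y \<in> f ` A"
    then obtain x where x: "x \<in> A" "y = f x" by blast
    then obtain i where "x \<in> U i" using U(1) by blast
    then have "y \<in> W i" using x by (simp add: W_def)
    then show "y \<in> (\<Union>i. W i)" by blast
  qed
  moreover have "diameter (W i) \<le> \<delta>" for i
    using order_trans[OF diamW mult_left_mono[OF U(3)]] L by simp
  ultimately show "\<exists>U. f ` A \<subseteq> (\<Union>i. U i) \<and> (\<forall>i. bounded (U i) \<and> diameter (U i) \<le> \<delta>) \<and>
     (\<Sum>i. hausdorff_gauge s (U i)) \<le> ennreal e"
    using bW by blast
qed

lemma hnull_mono_exponent:
  fixes A :: "'a::metric_space set"
  assumes "0 \<le> u" "u \<le> v" "hnull u A"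
  shows "hnull v A"
  unfolding hnull_iff_cover
proof (intro allI impI)
  fix \<delta> e :: real assume \<delta>: "0 < \<delta>" and e: "0 < e"
  obtain U where U: "A \<subseteq> (\<Union>i. U i)" "\<And>i. bounded (U i)" "\<And>i. diameter (U i) \<le> min \<delta> 1"
     "(\<Sum>i. hausdorff_gauge u (U i)) \<le> ennreal e"
    by (rule hnull_coverE[OF assms(3), of "min \<delta> 1" e]) (use \<delta> e in auto)
  have "hausdorff_gauge v (U i) \<le> hausdorff_gauge u (U i)" for i
  proof -
    have d: "0 \<le> diameter (U i)" "diameter (U i) \<le> 1" using U(3)[of i] diameter_ge_0[OF U(2)] by auto
    have "diameter (U i) powr v \<le> diameter (U i) powr u"
      using d assms by (intro powr_mono') auto
    moreover have "diameter (U i) powr v \<le> 1" using d assms by (intro powr_le1) auto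
    ultimately show ?thesis using assms d
      by (auto simp: hausdorff_gauge_def ennreal_leI ennreal_le_1)
  qed
  then have "(\<Sum>i. hausdorff_gauge v (U i)) \<le> (\<Sum>i. hausdorff_gauge u (U i))" by (intro suminf_le) auto
  then have "(\<Sum>i. hausdorff_gauge v (U i)) \<le> ennreal e" using U(4) by (rule order_trans)
  then show "\<exists>U. A \<subseteq> (\<Union>i. U i) \<and> (\<forall>i. bounded (U i) \<and> diameter (U i) \<le> \<delta>) \<and>
     (\<Sum>i. hausdorff_gauge v (U i)) \<le> ennreal e"
    using U by (intro exI[of _ U]) auto
qed

lemma hausdorff_dim_le: "0 \<le> s \<Longrightarrow> hnull s A \<Longrightarrow> hausdorff_dim A \<le> ereal s"
  unfolding hausdorff_dim_def by (rule INF_lower2[of s]) auto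

lemma hausdorff_dim_nonneg: "0 \<le> hausdorff_dim A"
  unfolding hausdorff_dim_def by (rule INF_greatest) auto

lemma hnull_of_dim_less:
  assumes "hausdorff_dim A < ereal t"
  shows "hnull t A"
proof -
  obtain u where "0 \<le> u" "hnull u A" "ereal u < ereal t"
    using assms unfolding hausdorff_dim_def INF_less_iff by auto
  then show ?thesis using hnull_mono_exponent[of u t A] by simp
qed

lemma hausdorff_dim_le_if_null_above:
  assumes "0 \<le> d" "\<And>v. d < v \<Longrightarrow> hnull v A"
  shows "hausdorff_dim A \<le> ereal d"
proof (rule ereal_le_epsilon2)
  fix e :: real assume "0 < e"
  then have "hausdorff_dim A \<le> ereal (d + e)" using assms by (intro hausdorff_dim_le) auto
  then show "hausdorff_dim A \<le> ereal d + ereal e" by simp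
qed

text \<open>The Borel-Cantelli argument: every point lies in sets of arbitrarily fine levels, so
  each tail of the convergent series of gauges comes from a cover of \<open>A\<close>.\<close>

lemma hnull_limsup:
  fixes S :: "nat \<Rightarrow> nat \<Rightarrow> 'a::metric_space set"
  assumes v: "0 < v"
    and bdd: "\<And>k j. bounded (S k j)" and diam: "\<And>k j. diameter (S k j) \<le> 1 / 2 ^ k"
    and finJ: "\<And>k. finite (J k)"
    and summ: "summable (\<lambda>k. real (card (J k)) * (1 / 2 ^ k) powr v)"
    and cover: "\<And>x k0. x \<in> A \<Longrightarrow> \<exists>k\<ge>k0. \<exists>j\<in>J k. x \<in> S k j"
  shows "hnull v A"
  unfolding hnull_iff_cover
proof (intro allI impI)
  fix \<delta> e :: real assume \<delta>: "0 < \<delta>" and e: "0 < e"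
  let ?g = "\<lambda>k. real (card (J k)) * (1 / 2 ^ k) powr v"
  have "eventually (\<lambda>n. norm (\<Sum>i. ?g (i + n)) < e) sequentially"
    using suminf_exist_split[OF e summ] by (auto simp: eventually_sequentially)
  moreover have "eventually (\<lambda>n. (1 / 2) ^ n < \<delta>) sequentially"
    using \<delta> LIMSEQ_realpow_zero[of "1 / 2 :: real"] by (intro order_tendstoD) auto
  ultimately have "eventually (\<lambda>n. norm (\<Sum>i. ?g (i + n)) < e \<and> (1 / 2) ^ n < \<delta>) sequentially"
    by (rule eventually_conj)
  then obtain k0 where k0: "norm (\<Sum>i. ?g (i + k0)) < e" "(1 / 2) ^ k0 < \<delta>"
    by (auto simp: eventually_sequentially)
  define W where "W i = (case prod_decode i of (k, j) \<Rightarrow> if j \<in> J (k + k0) then S (k + k0) j else {})" for i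
  have half: "1 / 2 ^ (k + k0) \<le> \<delta>" for k
  proof -
    have "1 / 2 ^ (k + k0) \<le> 1 / (2 ^ k0 :: real)" by (intro divide_left_mono) auto
    then show ?thesis using k0(2) by (simp add: power_one_over)
  qed
  have g: "hausdorff_gauge v (S k j) \<le> ennreal ((1 / 2 ^ k) powr v)" for k j
  proof -
    have "diameter (S k j) powr v \<le> (1 / 2 ^ k) powr v"
      using v diam diameter_ge_0[OF bdd] by (intro powr_mono2) auto
    then show ?thesis using v by (auto simp: hausdorff_gauge_def intro: ennreal_leI)
  qed
  have inner: "(\<Sum>j. hausdorff_gauge v (if j \<in> J k then S k j else {})) \<le> ennreal (?g k)" for k
  proof -
    have "(\<Sum>j. hausdorff_gauge v (if j \<in> J k then S k j else {})) = (\<Sum>j\<in>J k. hausdorff_gauge v (if j \<in> J k then S k j else {}))"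
      by (rule suminf_finite[OF finJ]) (simp add: hausdorff_gauge_def)
    also have "\<dots> \<le> (\<Sum>j\<in>J k. ennreal ((1 / 2 ^ k) powr v))" using g by (intro sum_mono) auto
    also have "\<dots> = ennreal (?g k)" by (simp add: ennreal_mult ennreal_of_nat_eq_real_of_nat)
    finally show ?thesis .
  qed
  have "(\<Sum>i. hausdorff_gauge v (W i)) = (\<Sum>k. \<Sum>j. hausdorff_gauge v (if j \<in> J (k + k0) then S (k + k0) j else {}))"
    unfolding W_def case_prod_beta by (rule suminf_prod_decode)
  also have "\<dots> \<le> (\<Sum>k. ennreal (?g (k + k0)))" by (intro suminf_le inner) auto
  also have "\<dots> = ennreal (\<Sum>k. ?g (k + k0))"
    by (rule suminf_ennreal2) (auto intro: summable_ignore_initial_segment[OF summ])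
  also have "\<dots> \<le> ennreal e" using k0(1) by (intro ennreal_leI) auto
  finally have "(\<Sum>i. hausdorff_gauge v (W i)) \<le> ennreal e" .
  moreover have "A \<subseteq> (\<Union>i. W i)"
  proof
    fix x assume "x \<in> A"
    then obtain k j where kj: "k0 \<le> k" "j \<in> J k" "x \<in> S k j" using cover by blast
    then have "x \<in> W (prod_encode (k - k0, j))" by (simp add: W_def)
    then show "x \<in> (\<Union>i. W i)" by blast
  qed
  moreover have "bounded (W i) \<and> diameter (W i) \<le> \<delta>" for i
    using bdd order_trans[OF diam half] \<delta> by (auto simp: W_def split: prod.split)
  ultimately show "\<exists>U. A \<subseteq> (\<Union>i. U i) \<and> (\<forall>i. bounded (U i) \<and> diameter (U i) \<le> \<delta>) \<and>
     (\<Sum>i. hausdorff_gauge v (U i)) \<le> ennreal e"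
    by blast
qed

text \<open>Bounds the dimension of every projection by 1. Each level uses about
  \<open>2 ^ k\<close> intervals, including the index \<open>2 ^ k\<close> for the sake of the right
  endpoint, and \<open>v > 1\<close> makes the series geometric.\<close>

lemma hnull_real:
  assumes "1 < v"
  shows "hnull v (A :: real set)"
proof -
  have unit: "hnull v {real_of_int n..real_of_int n + 1}" for n
  proof (rule hnull_limsup[where S="\<lambda>k j. {real_of_int n + real j / 2 ^ k..real_of_int n + real (Suc j) / 2 ^ k}" and J="\<lambda>k. {..2 ^ k}"])
    have "summable (\<lambda>k. 2 * (2 powr (1 - v)) ^ k)"
      using assms powr_less_mono[of "1 - v" 0 2] by (intro summable_mult summable_geometric) auto
    then show "summable (\<lambda>k. real (card {..(2::nat) ^ k}) * (1 / 2 ^ k) powr v)"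
    proof (rule summable_comparison_test')
      fix k :: nat
      have eq: "(1 / 2 ^ k) powr v = 2 powr (- v * real k)"
        by (simp add: powr_realpow[symmetric] powr_divide powr_powr powr_minus_divide mult.commute)
      have "real (card {..(2::nat) ^ k}) \<le> 2 * 2 ^ k" by simp
      then have "real (card {..(2::nat) ^ k}) * (1 / 2 ^ k) powr v \<le> 2 * 2 ^ k * (1 / 2 ^ k) powr v"
        by (intro mult_right_mono) auto
      also have "\<dots> = 2 * (2 powr real k * 2 powr (- v * real k))" by (simp add: eq powr_realpow)
      also have "\<dots> = 2 * (2 powr (1 - v)) ^ k"
        by (simp add: powr_add[symmetric] powr_power algebra_simps)
      finally show "norm (real (card {..(2::nat) ^ k}) * (1 / 2 ^ k) powr v) \<le> 2 * (2 powr (1 - v)) ^ k" by simp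
    qed
    show "diameter {real_of_int n + real j / 2 ^ k..real_of_int n + real (Suc j) / 2 ^ k} \<le> 1 / 2 ^ k" for k j
      by (simp add: diff_divide_distrib[symmetric] divide_right_mono)
    fix x k0 assume x: "x \<in> {real_of_int n..real_of_int n + 1}"
    define y where "y = (x - real_of_int n) * 2 ^ k0"
    have y: "0 \<le> y" "y \<le> 2 ^ k0" using x by (auto simp: y_def mult_left_le_one_le)
    define j where "j = nat \<lfloor>y\<rfloor>"
    have j: "real j \<le> y" "y \<le> real (Suc j)" using y(1) by (auto simp: j_def) linarith
    have "real j \<le> 2 ^ k0" using j y by linarith
    then have "j \<le> 2 ^ k0" by simp
    moreover have "x = real_of_int n + y / 2 ^ k0" by (simp add: y_def)
    then have "x \<in> {real_of_int n + real j / 2 ^ k0..real_of_int n + real (Suc j) / 2 ^ k0}"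
      using j by (auto simp: divide_right_mono simp del: of_nat_Suc)
    ultimately show "\<exists>k\<ge>k0. \<exists>j\<in>{..2 ^ k}. x \<in> {real_of_int n + real j / 2 ^ k..real_of_int n + real (Suc j) / 2 ^ k}"
      by blast
  qed (use assms in auto)
  have "hnull v (\<Union>n\<in>(UNIV::int set). {real_of_int n..real_of_int n + 1})"
    by (intro hnull_UN unit) auto
  moreover have "A \<subseteq> (\<Union>n\<in>(UNIV::int set). {real_of_int n..real_of_int n + 1})"
  proof
    fix x assume "x \<in> A"
    have "x \<in> {real_of_int \<lfloor>x\<rfloor>..real_of_int \<lfloor>x\<rfloor> + 1}" by (simp add: less_imp_le)
    then show "x \<in> (\<Union>n\<in>(UNIV::int set). {real_of_int n..real_of_int n + 1})" by blast
  qed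
  ultimately show ?thesis by (rule hnull_subset)
qed

section \<open>Net contents\<close>

text \<open>\<open>code n x\<close> is the cell of generation \<open>n\<close> that contains
  \<open>x\<close>, and \<open>par\<close> maps a cell to its parent. Cells of any two generations
  are nested or disjoint, which makes covers by cells much easier to merge than covers by arbitrary
  sets.\<close>

locale tree_coding =
  fixes code :: "nat \<Rightarrow> 'x \<Rightarrow> 'c" and par :: "'c \<Rightarrow> 'c"
  assumes code_Suc: "par (code (Suc n) x) = code n x"
    and finite_children: "finite {c'. par c' = c}"
begin

lemma code_add: "(par ^^ i) (code (n + i) x) = code n x"
proof (induction i)
  case (Suc i)
  have "(par ^^ Suc i) (code (n + Suc i) x) = (par ^^ i) (par (code (Suc (n + i)) x))"
    by (simp add: funpow_swap1)
  then show ?case by (simp add: code_Suc Suc)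
qed simp

lemma code_le: "m \<le> n \<Longrightarrow> (par ^^ (n - m)) (code n x) = code m x"
  using code_add[of "n - m" m x] by simp

definition covers :: "(nat \<times> 'c) set \<Rightarrow> 'x set \<Rightarrow> bool" where
  "covers C A \<longleftrightarrow> (\<forall>x\<in>A. \<exists>n. (n, code n x) \<in> C)"

definition wt :: "real \<Rightarrow> nat \<times> 'c \<Rightarrow> ennreal" where
  "wt s p = ennreal ((1 / 2 ^ fst p) powr s)"

text \<open>A net content with cells of all generations allowed at once. It is finite on every cell,
  as the mass construction requires, and its vanishing still implies a null set; see
  \<open>hnull_of_content_zero\<close>.\<close>

definition content :: "real \<Rightarrow> 'x set \<Rightarrow> ennreal" where
  "content s A = (INF C\<in>{C. covers C A}. infsum (wt s) C)"

definition coarsest :: "(nat \<times> 'c) set \<Rightarrow> (nat \<times> 'c) set" where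
  "coarsest C = {p\<in>C. \<forall>m<fst p. (m, (par ^^ (fst p - m)) (snd p)) \<notin> C}"

lemma summable_ennreal: "f summable_on S" for f :: "'z \<Rightarrow> ennreal"
  by (simp add: nonneg_summable_on_complete)

lemma infsum_mono_set: "A \<subseteq> B \<Longrightarrow> infsum f A \<le> infsum f B" for f :: "'z \<Rightarrow> ennreal"
  by (intro infsum_mono_neutral summable_ennreal) auto

lemma infsum_Un_le: "infsum f (A \<union> B) \<le> infsum f A + infsum f B" for f :: "'z \<Rightarrow> ennreal"
proof -
  have "infsum f (A \<union> (B - A)) = infsum f A + infsum f (B - A)" by (intro infsum_Un_disjoint summable_ennreal) auto
  also have "\<dots> \<le> infsum f A + infsum f B" by (intro add_mono infsum_mono_set) auto
  finally show ?thesis by simp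
qed

lemma content_le: "covers C A \<Longrightarrow> content s A \<le> infsum (wt s) C"
  unfolding content_def by (rule INF_lower) simp

lemma content_Un_le: "content s (A \<union> B) \<le> content s A + content s B"
proof (rule ennreal_le_epsilon)
  fix e :: real assume fin: "content s A + content s B < top" and e: "0 < e"
  have "content s A < content s A + ennreal (e / 2)" "content s B < content s B + ennreal (e / 2)"
    using fin e ennreal_add_left_cancel_less[of _ 0 "ennreal (e / 2)"] by (auto simp: less_top)
  then obtain C D where C: "covers C A" "infsum (wt s) C < content s A + ennreal (e / 2)"
    and D: "covers D B" "infsum (wt s) D < content s B + ennreal (e / 2)"
    unfolding content_def INF_less_iff by auto
  have "content s (A \<union> B) \<le> infsum (wt s) (C \<union> D)"
    using C(1) D(1) by (intro content_le) (auto simp: covers_def)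
  also have "\<dots> \<le> infsum (wt s) C + infsum (wt s) D" by (rule infsum_Un_le)
  also have "\<dots> \<le> (content s A + ennreal (e / 2)) + (content s B + ennreal (e / 2))"
    using C(2) D(2) by (intro add_mono) auto
  also have "\<dots> = content s A + content s B + (ennreal (e / 2) + ennreal (e / 2))" by (simp add: add_ac)
  also have "ennreal (e / 2) + ennreal (e / 2) = ennreal e" using e by (simp flip: ennreal_plus)
  finally show "content s (A \<union> B) \<le> content s A + content s B + ennreal e" .
qed

lemma content_empty [simp]: "content s {} = 0"
  using content_le[of "{}" "{}" s] by (simp add: covers_def)

lemma content_UN_le: "finite I \<Longrightarrow> content s (\<Union>i\<in>I. A i) \<le> (\<Sum>i\<in>I. content s (A i))"
proof (induction I rule: finite_induct)
  case (insert i I)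
  have "content s (\<Union>i\<in>insert i I. A i) \<le> content s (A i) + content s (\<Union>i\<in>I. A i)"
    using content_Un_le[of s "A i"] by simp
  also have "\<dots> \<le> content s (A i) + (\<Sum>i\<in>I. content s (A i))" using insert.IH by (rule add_left_mono)
  finally show ?case using insert by simp
qed simp

lemma content_cell_le: "content s {x\<in>A. code n x = c} \<le> ennreal ((1 / 2 ^ n) powr s)"
  using content_le[of "{(n, c)}" "{x\<in>A. code n x = c}" s] by (simp add: covers_def wt_def)

lemma covers_coarsest: "covers (coarsest C) A \<longleftrightarrow> covers C A"
proof
  assume "covers C A"
  show "covers (coarsest C) A"
    unfolding covers_def
  proof
    fix x assume "x \<in> A"
    then have ex: "\<exists>n. (n, code n x) \<in> C" using \<open>covers C A\<close> by (simp add: covers_def)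
    define n where "n = (LEAST n. (n, code n x) \<in> C)"
    have "(n, code n x) \<in> C" unfolding n_def using ex by (rule LeastI_ex)
    moreover have "(m, code m x) \<notin> C" if "m < n" for m using that not_less_Least unfolding n_def by blast
    ultimately have "(n, code n x) \<in> coarsest C" by (auto simp: coarsest_def code_le)
    then show "\<exists>n. (n, code n x) \<in> coarsest C" by blast
  qed
qed (auto simp: covers_def coarsest_def)

text \<open>A set covered by both families is covered by what the coarsest boxes leave over.\<close>

lemma coarsest_Un_submodular:
  assumes W: "covers W A" and D: "covers D A"
  shows "infsum (wt s) (coarsest (W \<union> D)) + content s A \<le> infsum (wt s) W + infsum (wt s) D"
proof -
  let ?U = "coarsest (W \<union> D)"
  have "covers ((W \<union> D - ?U) \<union> (W \<inter> D)) A"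
    unfolding covers_def
  proof
    fix x assume "x \<in> A"
    obtain n where n: "(n, code n x) \<in> W" using W \<open>x \<in> A\<close> by (auto simp: covers_def)
    obtain m where m: "(m, code m x) \<in> D" using D \<open>x \<in> A\<close> by (auto simp: covers_def)
    consider "m = n" | "m < n" | "n < m" by linarith
    then show "\<exists>n. (n, code n x) \<in> (W \<union> D - ?U) \<union> (W \<inter> D)"
    proof cases
      case 1
      then show ?thesis using n m by blast
    next
      case 2
      then have "(n, code n x) \<notin> ?U" using m by (auto simp: coarsest_def code_le intro!: exI[of _ m])
      then show ?thesis using n by blast
    next
      case 3
      then have "(m, code m x) \<notin> ?U" using n by (auto simp: coarsest_def code_le intro!: exI[of _ n])
      then show ?thesis using m by blast
    qed
  qed
  then have "content s A \<le> infsum (wt s) ((W \<union> D - ?U) \<union> (W \<inter> D))" by (rule content_le)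
  also have "\<dots> \<le> infsum (wt s) (W \<union> D - ?U) + infsum (wt s) (W \<inter> D)" by (rule infsum_Un_le)
  finally have "infsum (wt s) ?U + content s A
     \<le> infsum (wt s) ?U + (infsum (wt s) (W \<union> D - ?U) + infsum (wt s) (W \<inter> D))"
    by (rule add_left_mono)
  also have "\<dots> = (infsum (wt s) ?U + infsum (wt s) (W \<union> D - ?U)) + infsum (wt s) (W \<inter> D)"
    by (simp add: add.assoc)
  also have "infsum (wt s) ?U + infsum (wt s) (W \<union> D - ?U) = infsum (wt s) (?U \<union> (W \<union> D - ?U))"
    by (intro infsum_Un_disjoint[symmetric] summable_ennreal) auto
  also have "?U \<union> (W \<union> D - ?U) = W \<union> (D - W)" by (auto simp: coarsest_def)
  also have "infsum (wt s) (W \<union> (D - W)) = infsum (wt s) W + infsum (wt s) (D - W)"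
    by (intro infsum_Un_disjoint summable_ennreal) auto
  also have "infsum (wt s) W + infsum (wt s) (D - W) + infsum (wt s) (W \<inter> D)
     = infsum (wt s) W + infsum (wt s) ((D - W) \<union> (W \<inter> D))"
    by (subst infsum_Un_disjoint) (auto simp: add.assoc summable_ennreal)
  also have "(D - W) \<union> (W \<inter> D) = D" by auto
  finally show ?thesis .
qed

text \<open>The increasing sets lemma. Nearly optimal covers of the \<open>A n\<close> are merged
  one after the other. The old and the new cover both cover \<open>A n\<close>, so by submodularity
  a merge costs only the increase of the content plus the new error; the errors
  \<open>e * (1 / 2) ^ Suc n\<close> add up to \<open>e\<close>.\<close>

lemma content_increasing_union:
  assumes inc: "\<And>n. A n \<subseteq> A (Suc n)" and lt: "ennreal c < content s (\<Union>n. A n)"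
  shows "\<exists>n. ennreal c < content s (A n)"
proof (rule ccontr)
  assume "\<not> (\<exists>n. ennreal c < content s (A n))"
  then have le: "content s (A n) \<le> ennreal c" for n by (simp add: not_less)
  have "content s (\<Union>n. A n) \<le> ennreal c + ennreal e" if e: "0 < e" for e
  proof -
    have "\<exists>C. covers C (A n) \<and> infsum (wt s) C \<le> content s (A n) + ennreal (e * (1 / 2) ^ Suc n)" for n
    proof -
      have "content s (A n) < content s (A n) + ennreal (e * (1 / 2) ^ Suc n)"
        using e le[of n] ennreal_add_left_cancel_less[of _ 0 "ennreal (e * (1 / 2) ^ Suc n)"]
        by (auto simp: top_unique)
      then obtain C where "covers C (A n)" "infsum (wt s) C < content s (A n) + ennreal (e * (1 / 2) ^ Suc n)"
        unfolding content_def INF_less_iff by auto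
      then show ?thesis by (auto intro: less_imp_le)
    qed
    then obtain C where C: "\<And>n. covers (C n) (A n)"
      "\<And>n. infsum (wt s) (C n) \<le> content s (A n) + ennreal (e * (1 / 2) ^ Suc n)" by metis
    define V where "V n = (\<Union>j\<le>n. C j)" for n
    have VSuc: "V (Suc n) = V n \<union> C (Suc n)" for n unfolding V_def by (auto simp: atMost_Suc)
    have covV: "covers (V n) (A n)" for n using C(1)[of n] unfolding V_def covers_def by blast
    have bound: "infsum (wt s) (coarsest (V n)) \<le> content s (A n) + ennreal (e * (1 - (1 / 2) ^ Suc n))" for n
    proof (induction n)
      case 0
      have "infsum (wt s) (coarsest (V 0)) \<le> infsum (wt s) (C 0)"
        by (intro infsum_mono_set) (auto simp: coarsest_def V_def)
      also have "\<dots> \<le> content s (A 0) + ennreal (e * (1 - (1 / 2) ^ Suc 0))" using C(2)[of 0] by simp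
      finally show ?case .
    next
      case (Suc n)
      have "coarsest (V (Suc n)) \<subseteq> coarsest (coarsest (V n) \<union> C (Suc n))"
        unfolding VSuc coarsest_def by auto
      then have "infsum (wt s) (coarsest (V (Suc n))) + content s (A n)
          \<le> infsum (wt s) (coarsest (coarsest (V n) \<union> C (Suc n))) + content s (A n)"
        by (intro add_right_mono infsum_mono_set)
      also have "\<dots> \<le> infsum (wt s) (coarsest (V n)) + infsum (wt s) (C (Suc n))"
      proof (rule coarsest_Un_submodular)
        show "covers (coarsest (V n)) (A n)" using covV by (simp add: covers_coarsest)
        show "covers (C (Suc n)) (A n)" using C(1)[of "Suc n"] inc[of n] by (auto simp: covers_def)
      qed
      also have "\<dots> \<le> (content s (A n) + ennreal (e * (1 - (1 / 2) ^ Suc n)))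
          + (content s (A (Suc n)) + ennreal (e * (1 / 2) ^ Suc (Suc n)))"
        by (intro add_mono Suc.IH C(2))
      also have "\<dots> = (content s (A (Suc n)) + (ennreal (e * (1 - (1 / 2) ^ Suc n)) + ennreal (e * (1 / 2) ^ Suc (Suc n))))
          + content s (A n)" by (simp add: add_ac)
      also have "ennreal (e * (1 - (1 / 2) ^ Suc n)) + ennreal (e * (1 / 2) ^ Suc (Suc n)) = ennreal (e * (1 - (1 / 2) ^ Suc (Suc n)))"
        using e order_trans[OF power_le_one[of "1 / 2 :: real" n], of 2]
        by (subst ennreal_plus[symmetric]) (auto simp: power_le_one algebra_simps intro!: mult_nonneg_nonneg)
      finally show ?case
        using le[of n] ennreal_add_left_cancel_le by (auto simp: add.commute top_unique)
    qed
    define W where "W = coarsest (\<Union>n. C n)"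
    have "covers W (\<Union>n. A n)" unfolding W_def covers_coarsest using C(1) unfolding covers_def by blast
    then have "content s (\<Union>n. A n) \<le> infsum (wt s) W" by (rule content_le)
    also have "\<dots> = (SUP F\<in>{F. finite F \<and> F \<subseteq> W}. sum (wt s) F)" by (rule nonneg_infsum_complete) simp
    also have "\<dots> \<le> ennreal c + ennreal e"
    proof (rule SUP_least)
      fix F assume "F \<in> {F. finite F \<and> F \<subseteq> W}"
      then have F: "finite F" "F \<subseteq> W" by auto
      have "\<forall>p\<in>F. \<exists>n. p \<in> C n" using F(2) by (auto simp: W_def coarsest_def)
      then obtain g where g: "\<And>p. p \<in> F \<Longrightarrow> p \<in> C (g p)" by metis
      define n where "n = Max (insert 0 (g ` F))"
      have gn: "g p \<le> n" if "p \<in> F" for p unfolding n_def using that F(1) by (intro Max_ge) auto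
      have "F \<subseteq> V n" using g gn unfolding V_def by blast
      moreover have "V n \<subseteq> (\<Union>n. C n)" unfolding V_def by blast
      \<comment> \<open>A cell without ancestors in the whole union has none in the smaller family
        \<open>V n\<close>.\<close>
      ultimately have "F \<subseteq> coarsest (V n)" using F(2) unfolding W_def coarsest_def by blast
      then have "sum (wt s) F \<le> infsum (wt s) (coarsest (V n))"
        using infsum_mono_set[of F "coarsest (V n)" "wt s"] F(1) by simp
      also have "\<dots> \<le> content s (A n) + ennreal (e * (1 - (1 / 2) ^ Suc n))" by (rule bound)
      also have "\<dots> \<le> ennreal c + ennreal e"
        using e by (intro add_mono le ennreal_leI) (auto simp: mult_left_le)
      finally show "sum (wt s) F \<le> ennreal c + ennreal e" .
    qed
    finally show ?thesis .
  qed
  then have "content s (\<Union>n. A n) \<le> ennreal c" by (rule ennreal_le_epsilon)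
  then show False using lt by simp
qed

subsection \<open>Frostman distributions\<close>

context
  fixes s :: real and A :: "'x set" and c0 :: 'c
  assumes A: "\<And>x. x \<in> A \<Longrightarrow> code 0 x = c0"
begin

definition cell_content :: "nat \<Rightarrow> 'c \<Rightarrow> real" where
  "cell_content n c = enn2real (content s {x\<in>A. code n x = c})"

text \<open>Mass is handed down in proportion to the contents of the children. If these all vanish
  the quotient is 0 by convention, which is consistent because the parent then has content and mass
  0.\<close>

primrec mass :: "nat \<Rightarrow> 'c \<Rightarrow> real" where
  "mass 0 c = (if c = c0 then cell_content 0 c0 else 0)"
| "mass (Suc n) c = mass n (par c) * cell_content (Suc n) c / (\<Sum>c'\<in>{c'. par c' = par c}. cell_content (Suc n) c')"

lemma content_cell_fin: "content s {x\<in>A. code n x = c} \<noteq> top"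
  using content_cell_le[of s A n c] by (auto simp: top_unique)

lemma cell_content_nonneg: "0 \<le> cell_content n c" by (simp add: cell_content_def)

lemma cell_content_le: "cell_content n c \<le> (1 / 2 ^ n) powr s"
  unfolding cell_content_def using content_cell_le[of s A n c] by (simp add: enn2real_leI)

lemma cell_content_split: "cell_content n c \<le> (\<Sum>c'\<in>{c'. par c' = c}. cell_content (Suc n) c')"
proof -
  have eq: "{x\<in>A. code n x = c} = (\<Union>c'\<in>{c'. par c' = c}. {x\<in>A. code (Suc n) x = c'})"
    by (auto simp: code_Suc)
  have "content s {x\<in>A. code n x = c} \<le> (\<Sum>c'\<in>{c'. par c' = c}. content s {x\<in>A. code (Suc n) x = c'})"
    unfolding eq by (rule content_UN_le[OF finite_children])
  also have "\<dots> = (\<Sum>c'\<in>{c'. par c' = c}. ennreal (cell_content (Suc n) c'))"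
    by (intro sum.cong refl) (simp add: cell_content_def content_cell_fin less_top[symmetric])
  also have "\<dots> = ennreal (\<Sum>c'\<in>{c'. par c' = c}. cell_content (Suc n) c')"
    by (rule sum_ennreal) (rule cell_content_nonneg)
  finally show ?thesis
    unfolding cell_content_def[of n] using cell_content_nonneg by (intro enn2real_leI sum_nonneg) auto
qed

text \<open>By subadditivity the contents of the children sum to at least the content of the parent,
  hence to at least its mass; so the share of a child never exceeds its own content.\<close>

lemma mass_bounds: "0 \<le> mass n c \<and> mass n c \<le> cell_content n c"
proof (induction n arbitrary: c)
  case (Suc n)
  let ?S = "\<Sum>c'\<in>{c'. par c' = par c}. cell_content (Suc n) c'"
  have S0: "0 \<le> ?S" using cell_content_nonneg by (intro sum_nonneg) auto
  have "mass n (par c) \<le> ?S" using Suc[of "par c"] cell_content_split[of n "par c"] by linarith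
  then have "mass n (par c) * cell_content (Suc n) c \<le> cell_content (Suc n) c * ?S"
    using cell_content_nonneg[of "Suc n" c] by (simp add: mult.commute mult_left_mono)
  then have "mass n (par c) * cell_content (Suc n) c / ?S \<le> cell_content (Suc n) c"
    using S0 cell_content_nonneg[of "Suc n" c] by (cases "?S = 0") (auto simp: divide_le_eq)
  then show ?case using Suc[of "par c"] S0 cell_content_nonneg[of "Suc n" c] by simp
qed (auto simp: cell_content_nonneg)

lemma mass_split: "mass n c = (\<Sum>c'\<in>{c'. par c' = c}. mass (Suc n) c')"
proof -
  let ?S = "\<Sum>c'\<in>{c'. par c' = c}. cell_content (Suc n) c'"
  have "(\<Sum>c'\<in>{c'. par c' = c}. mass (Suc n) c') = (\<Sum>c'\<in>{c'. par c' = c}. mass n c * cell_content (Suc n) c' / ?S)"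
    by (intro sum.cong refl) auto
  also have "\<dots> = mass n c * ?S / ?S" by (simp add: sum_distrib_left sum_divide_distrib)
  also have "\<dots> = mass n c"
    using mass_bounds[of n c] cell_content_split[of n c] by (cases "?S = 0") auto
  finally show ?thesis by simp
qed

lemma mass_pos: "0 < mass n c \<Longrightarrow> {x\<in>A. code n x = c} \<noteq> {}"
  using mass_bounds[of n c] unfolding cell_content_def by (intro notI) simp

lemma mass_support: "mass n c \<noteq> 0 \<Longrightarrow> (par ^^ n) c = c0"
  by (induction n arbitrary: c) (auto simp: funpow_swap1 split: if_splits)

lemma mass_top: "content s A \<noteq> 0 \<Longrightarrow> 0 < mass 0 c0"
proof -
  assume "content s A \<noteq> 0"
  moreover have "{x\<in>A. code 0 x = c0} = A" using A by auto
  ultimately show ?thesis using content_cell_fin[of 0 c0]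
    by (simp add: cell_content_def enn2real_positive_iff less_top zero_less_iff_neq_zero)
qed

lemma exists_frostman_mass:
  assumes "content s A \<noteq> 0"
  shows "\<exists>M :: nat \<Rightarrow> 'c \<Rightarrow> real. 0 < M 0 c0 \<and> (\<forall>n c. 0 \<le> M n c \<and> M n c \<le> (1 / 2 ^ n) powr s) \<and>
    (\<forall>n c. M n c = (\<Sum>c'\<in>{c'. par c' = c}. M (Suc n) c')) \<and>
    (\<forall>n c. 0 < M n c \<longrightarrow> {x\<in>A. code n x = c} \<noteq> {}) \<and> (\<forall>n c. M n c \<noteq> 0 \<longrightarrow> (par ^^ n) c = c0)"
  using mass_top[OF assms] mass_bounds order_trans[OF _ cell_content_le] mass_split mass_pos mass_support
  by (intro exI[of _ mass] conjI allI impI) blast+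

end

end

section \<open>Dyadic cubes and analytic sets\<close>

definition code3 :: "nat \<Rightarrow> real ^ 3 \<Rightarrow> int \<times> int \<times> int" where
  "code3 n x = (dcell n (x $ 1), dcell n (x $ 2), dcell n (x $ 3))"

definition par3 :: "int \<times> int \<times> int \<Rightarrow> int \<times> int \<times> int" where
  "par3 = (\<lambda>(a, b, c). (a div 2, b div 2, c div 2))"

global_interpretation cube: tree_coding code3 par3
proof
  show "par3 (code3 (Suc n) x) = code3 n x" for n x
    by (simp add: code3_def par3_def dcell_Suc)
  show "finite {c'. par3 c' = c}" for c
  proof -
    obtain i j k where c: "c = (i, j, k)" by (cases c) auto
    have "{c'. par3 c' = c} \<subseteq> {2 * i..2 * i + 1} \<times> {2 * j..2 * j + 1} \<times> {2 * k..2 * k + 1}"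
      by (auto simp: par3_def c)
    then show ?thesis by (rule finite_subset) simp
  qed
qed

lemma norm_le_sum3: "norm (x :: real ^ 3) \<le> \<bar>x $ 1\<bar> + \<bar>x $ 2\<bar> + \<bar>x $ 3\<bar>"
  using norm_le_l1_cart[of x] by (simp add: sum_3)

lemma code3_eq_imp_dist: 
  assumes "code3 n x = code3 n y"
  shows "dist x y \<le> 3 / 2 ^ n"
  using norm_le_sum3[of "x - y"] assms dcell_eq_imp_dist[of n "x $ 1" "y $ 1"]
    dcell_eq_imp_dist[of n "x $ 2" "y $ 2"] dcell_eq_imp_dist[of n "x $ 3" "y $ 3"]
  by (simp add: code3_def dist_norm)

text \<open>The covers in \<open>content\<close> obey no scale restriction, but each cell weighs at
  most the total, so for \<open>s > 0\<close> a cheap cover consists of small cells only.\<close>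

lemma hnull_of_content_zero:
  assumes s: "0 < s" and z: "cube.content s K = 0"
  shows "hnull s K"
  unfolding hnull_iff_cover
proof (intro allI impI)
  fix \<delta> e :: real assume \<delta>: "0 < \<delta>" and e: "0 < e"
  define h where "h = min (e / 3 powr s) ((\<delta> / 3) powr s)"
  have h: "0 < h" using \<delta> e by (simp add: h_def)
  then have "cube.content s K < ennreal h" using z by simp
  then obtain C where C: "cube.covers C K" "infsum (cube.wt s) C < ennreal h"
    unfolding cube.content_def INF_less_iff by auto
  have small: "1 / 2 ^ fst p < \<delta> / 3" if "p \<in> C" for p
  proof -
    have "cube.wt s p = infsum (cube.wt s) {p}" by simp
    also have "\<dots> \<le> infsum (cube.wt s) C" using that by (intro cube.infsum_mono_set) auto
    also have "\<dots> < ennreal h" by (rule C)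
    finally have "(1 / 2 ^ fst p) powr s < h" by (simp add: cube.wt_def ennreal_less_iff)
    then have "\<not> (\<delta> / 3) powr s \<le> (1 / 2 ^ fst p) powr s" by (simp add: h_def)
    moreover have "(\<delta> / 3) powr s \<le> (1 / 2 ^ fst p) powr s" if "\<delta> / 3 \<le> 1 / 2 ^ fst p"
      using s \<delta> that by (intro powr_mono2) auto
    ultimately show ?thesis by linarith
  qed
  define cb where "cb p = {x. code3 (fst p) x = snd p}" for p
  \<comment> \<open>The cover is enumerated through \<open>to_nat\<close>; indices that are not
    codes of its members receive the empty set.\<close>
  define U where "U i = (if \<exists>p\<in>C. to_nat p = i then cb (from_nat i) else {})" for i
  have dcb: "dist x y \<le> 3 / 2 ^ fst p" if "x \<in> cb p" "y \<in> cb p" for x y p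
    using that code3_eq_imp_dist by (auto simp: cb_def)
  have bcb: "bounded (cb p)" for p
  proof (cases "cb p = {}")
    case False
    then obtain x where "x \<in> cb p" by blast
    then have "\<forall>y\<in>cb p. dist x y \<le> 3 / 2 ^ fst p" using dcb by blast
    then show ?thesis unfolding bounded_def by blast
  qed simp
  have diam: "diameter (cb p) \<le> 3 / 2 ^ fst p" for p
    using dcb by (intro diameter_le_dist) auto
  have gauge: "hausdorff_gauge s (cb p) \<le> ennreal (3 powr s) * cube.wt s p" for p
  proof -
    have "diameter (cb p) powr s \<le> (3 * (1 / 2 ^ fst p)) powr s"
      using diam[of p] s diameter_ge_0[OF bcb] by (intro powr_mono2) auto
    also have "\<dots> = 3 powr s * (1 / 2 ^ fst p) powr s" by (rule powr_mult)
    finally show ?thesis using s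
      by (simp add: hausdorff_gauge_def cube.wt_def ennreal_mult[symmetric] ennreal_leI)
  qed
  have "(\<Sum>i. hausdorff_gauge s (U i)) \<le> ennreal (3 powr s) * infsum (cube.wt s) C"
  proof (rule suminf_le_const)
    fix n
    let ?I = "{i\<in>{..<n}. \<exists>p\<in>C. to_nat p = i}"
    have "(\<Sum>i<n. hausdorff_gauge s (U i)) = (\<Sum>i\<in>?I. hausdorff_gauge s (cb (from_nat i)))"
      by (subst sum.inter_filter) (auto simp: U_def hausdorff_gauge_def intro!: sum.cong)
    also have "\<dots> \<le> (\<Sum>i\<in>?I. ennreal (3 powr s) * cube.wt s (from_nat i))"
      by (intro sum_mono gauge)
    also have "\<dots> = ennreal (3 powr s) * (\<Sum>i\<in>?I. cube.wt s (from_nat i))" by (simp add: sum_distrib_left)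
    also have "(\<Sum>i\<in>?I. cube.wt s (from_nat i)) = (\<Sum>p\<in>from_nat ` ?I. cube.wt s p)"
      by (subst sum.reindex) (auto intro!: inj_onI)
    also have "\<dots> = infsum (cube.wt s) (from_nat ` ?I)" by simp
    also have "\<dots> \<le> infsum (cube.wt s) C" by (intro cube.infsum_mono_set) auto
    finally show "(\<Sum>i<n. hausdorff_gauge s (U i)) \<le> ennreal (3 powr s) * infsum (cube.wt s) C"
      by (simp add: mult_left_mono)
  qed simp
  also have "\<dots> \<le> ennreal (3 powr s) * ennreal (e / 3 powr s)"
  proof (intro mult_left_mono)
    have "infsum (cube.wt s) C \<le> ennreal h" using C(2) by simp
    also have "\<dots> \<le> ennreal (e / 3 powr s)" by (intro ennreal_leI) (simp add: h_def)
    finally show "infsum (cube.wt s) C \<le> ennreal (e / 3 powr s)" .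
  qed simp
  also have "\<dots> = ennreal e" using e by (simp add: ennreal_mult[symmetric])
  finally have "(\<Sum>i. hausdorff_gauge s (U i)) \<le> ennreal e" .
  moreover have "K \<subseteq> (\<Union>i. U i)"
  proof
    fix x assume "x \<in> K"
    then obtain n where "(n, code3 n x) \<in> C" using C(1) by (auto simp: cube.covers_def)
    then have "x \<in> U (to_nat (n, code3 n x))" by (auto simp: U_def cb_def)
    then show "x \<in> (\<Union>i. U i)" by blast
  qed
  moreover have "bounded (U i) \<and> diameter (U i) \<le> \<delta>" for i
  proof (cases "\<exists>p\<in>C. to_nat p = i")
    case True
    then obtain p where p: "p \<in> C" "U i = cb p" by (auto simp: U_def)
    have "3 / 2 ^ fst p \<le> \<delta>" using small[OF p(1)] by simp
    then show ?thesis unfolding p(2) using bcb diam[of p] by auto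
  qed (use \<delta> in \<open>simp add: U_def\<close>)
  ultimately show "\<exists>U. K \<subseteq> (\<Union>i. U i) \<and> (\<forall>i. bounded (U i) \<and> diameter (U i) \<le> \<delta>) \<and>
     (\<Sum>i. hausdorff_gauge s (U i)) \<le> ennreal e"
    by blast
qed

lemma infsum_UN_le:
  fixes f :: "'z \<Rightarrow> ennreal"
  shows "finite D \<Longrightarrow> infsum f (\<Union>d\<in>D. A d) \<le> (\<Sum>d\<in>D. infsum f (A d))"
proof (induction D rule: finite_induct)
  case (insert d D)
  have "infsum f (\<Union>d\<in>insert d D. A d) \<le> infsum f (A d) + infsum f (\<Union>d\<in>D. A d)"
    using cube.infsum_Un_le[of f "A d"] by simp
  also have "\<dots> \<le> infsum f (A d) + (\<Sum>d\<in>D. infsum f (A d))" using insert.IH by (rule add_left_mono)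
  finally show ?case using insert by simp
qed simp

text \<open>A dyadic cube lies in the open cube of three times its side, which is contained in the
  union of the 27 cubes of the same generation around it, itself included.\<close>

lemma content_open_enlargement:
  assumes "cube.covers C A"
  shows "\<exists>G. open G \<and> A \<subseteq> G \<and> (\<forall>B\<subseteq>G. cube.content s B \<le> 27 * infsum (cube.wt s) C)"
proof -
  define near where "near n a t \<longleftrightarrow> \<bar>2 ^ n * t - (real_of_int a + 1 / 2)\<bar> < 3 / 2" for n :: nat and a t
  have near_self: "near n (dcell n t) t" for n t unfolding near_def dcell_def by linarith
  have near_imp: "dcell n t - a \<in> {-1, 0, 1}" if "near n a t" for n a t
  proof -
    have "real_of_int a - 1 < 2 ^ n * t" "2 ^ n * t < real_of_int a + 2"
      using that unfolding near_def by linarith+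
    then have "a - 1 \<le> dcell n t" "dcell n t < a + 2" unfolding dcell_def by linarith+
    then show ?thesis by auto
  qed
  define O3 where "O3 p = {x :: real ^ 3. near (fst p) (fst (snd p)) (x $ 1) \<and>
     near (fst p) (fst (snd (snd p))) (x $ 2) \<and> near (fst p) (snd (snd (snd p))) (x $ 3)}" for p
  define G where "G = (\<Union>p\<in>C. O3 p)"
  define shift where "shift d p = (fst p, fst (snd p) + fst d, fst (snd (snd p)) + fst (snd d), snd (snd (snd p)) + snd (snd d))"
    for d :: "int \<times> int \<times> int" and p :: "nat \<times> int \<times> int \<times> int"
  define D :: "(int \<times> int \<times> int) set" where "D = {-1, 0, 1} \<times> {-1, 0, 1} \<times> {-1, 0, 1}"
  have D: "finite D" "card D = 27" by (simp_all add: D_def card_cartesian_product)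
  have "open (O3 p)" for p
    unfolding O3_def near_def by (intro open_Collect_conj open_Collect_less continuous_intros)
  then have "open G" unfolding G_def by blast
  moreover have "A \<subseteq> G"
  proof
    fix x assume "x \<in> A"
    then obtain n where "(n, code3 n x) \<in> C" using assms by (auto simp: cube.covers_def)
    moreover have "x \<in> O3 (n, code3 n x)" by (simp add: O3_def code3_def near_self)
    ultimately show "x \<in> G" unfolding G_def by blast
  qed
  moreover have "cube.content s B \<le> 27 * infsum (cube.wt s) C" if "B \<subseteq> G" for B
  proof -
    have "cube.covers (\<Union>d\<in>D. shift d ` C) B"
      unfolding cube.covers_def
    proof
      fix x assume "x \<in> B"
      then obtain n a b c where p: "(n, a, b, c) \<in> C" "x \<in> O3 (n, a, b, c)"
        using \<open>B \<subseteq> G\<close> unfolding G_def by (metis UN_E prod_cases4 subsetD)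
      define d where "d = (dcell n (x $ 1) - a, dcell n (x $ 2) - b, dcell n (x $ 3) - c)"
      have "near n a (x $ 1)" "near n b (x $ 2)" "near n c (x $ 3)" using p(2) by (auto simp: O3_def)
      then have "d \<in> D" unfolding D_def d_def mem_Times_iff fst_conv snd_conv by (intro conjI near_imp)
      moreover have "(n, code3 n x) = shift d (n, a, b, c)" by (simp add: shift_def d_def code3_def)
      ultimately show "\<exists>n. (n, code3 n x) \<in> (\<Union>d\<in>D. shift d ` C)" using p(1) by blast
    qed
    then have "cube.content s B \<le> infsum (cube.wt s) (\<Union>d\<in>D. shift d ` C)" by (rule cube.content_le)
    also have "\<dots> \<le> (\<Sum>d\<in>D. infsum (cube.wt s) (shift d ` C))" by (rule infsum_UN_le[OF D(1)])
    also have "\<dots> = (\<Sum>d\<in>D. infsum (cube.wt s) C)"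
    proof (rule sum.cong)
      fix d
      have "inj_on (shift d) C" by (auto simp: inj_on_def shift_def prod_eq_iff)
      then have "infsum (cube.wt s) (shift d ` C) = infsum (cube.wt s \<circ> shift d) C" by (rule infsum_reindex)
      also have "cube.wt s \<circ> shift d = cube.wt s" by (auto simp: cube.wt_def shift_def)
      finally show "infsum (cube.wt s) (shift d ` C) = infsum (cube.wt s) C" .
    qed simp
    also have "\<dots> = 27 * infsum (cube.wt s) C" by (simp add: D)
    finally show ?thesis .
  qed
  ultimately show ?thesis by blast
qed

section \<open>Compact subsets of analytic sets with positive content\<close>

lemma baire_bounded_compact: "compact {x :: nat \<Rightarrow> nat. \<forall>i. x i \<le> b i}"
proof -
  have "compactin (product_topology (\<lambda>i. euclidean) UNIV) (PiE UNIV (\<lambda>i. {..b i}))"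
    by (subst compactin_PiE) (auto intro: finite_imp_compact)
  then have "compact (PiE UNIV (\<lambda>i. {..b i}))"
    by (simp add: euclidean_product_topology)
  then show ?thesis by (simp add: PiE_UNIV_domain Pi_def)
qed

text \<open>Counterexamples \<open>x j\<close> for all \<open>j\<close> would be bounded in each
  coordinate, since only finitely many of them can exceed \<open>b i\<close> there, and so lie in a
  compact box. A point common to all the closed sets \<open>T j\<close> then obeys every bound and
  yet is mapped outside \<open>G\<close>.\<close>

lemma baire_truncation:
  fixes f :: "(nat \<Rightarrow> nat) \<Rightarrow> 'a::topological_space"
  assumes f: "continuous_on UNIV f" and G: "open G" and sub: "f ` {x. \<forall>i. x i \<le> b i} \<subseteq> G"
  shows "\<exists>j. f ` {x. \<forall>i<j. x i \<le> b i} \<subseteq> G"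
proof (rule ccontr)
  assume "\<not> (\<exists>j. f ` {x. \<forall>i<j. x i \<le> b i} \<subseteq> G)"
  then have "\<forall>j. \<exists>x. (\<forall>i<j. x i \<le> b i) \<and> f x \<notin> G" by blast
  then obtain x where x: "\<And>j i. i < j \<Longrightarrow> x j i \<le> b i" "\<And>j. f (x j) \<notin> G" by metis
  define B where "B i = Max (insert (b i) ((\<lambda>j. x j i) ` {..i}))" for i
  have xB: "x j i \<le> B i" for j i
  proof (cases "i < j")
    case True
    then have "x j i \<le> b i" by (rule x)
    also have "\<dots> \<le> B i" unfolding B_def by (intro Max_ge) auto
    finally show ?thesis .
  next
    case False
    then show ?thesis unfolding B_def by (intro Max_ge) auto
  qed
  define T where "T j = {y. (\<forall>i<j. y i \<le> b i)} \<inter> f -` (- G)" for j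
  have cl: "closed (T j)" for j
  proof -
    have "closed {y :: nat \<Rightarrow> nat. y i \<le> b i}" for i
    proof -
      have "closed ((\<lambda>y :: nat \<Rightarrow> nat. y i) -` {..b i})"
        by (intro closed_vimage continuous_on_product_coordinates) simp
      then show ?thesis by (simp add: vimage_def)
    qed
    then have "closed {y :: nat \<Rightarrow> nat. \<forall>i<j. y i \<le> b i}"
      by (intro closed_Collect_all closed_Collect_imp) auto
    moreover have "closed (f -` (- G))" using f G by (simp add: closed_vimage closed_Compl)
    ultimately show ?thesis unfolding T_def by (rule closed_Int)
  qed
  have "{y. \<forall>i. y i \<le> B i} \<inter> \<Inter>(range T) \<noteq> {}"
  proof (rule compact_imp_fip[OF baire_bounded_compact])
    fix F' assume F': "finite F'" "F' \<subseteq> range T"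
    then obtain J where J: "finite J" "F' = T ` J" by (metis finite_subset_image)
    define n where "n = Max (insert 0 J)"
    have "x n \<in> T j" if "j \<in> J" for j
    proof -
      have "j \<le> n" using that J(1) unfolding n_def by (intro Max_ge) auto
      then show ?thesis using x unfolding T_def by auto
    qed
    then show "{y. \<forall>i. y i \<le> B i} \<inter> \<Inter>F' \<noteq> {}" using J(2) xB[of n] by blast
  qed (use cl in auto)
  then obtain y where y: "\<And>j. y \<in> T j" by blast
  have "y i \<le> b i" for i using y[of "Suc i"] by (simp add: T_def)
  moreover have "f y \<notin> G" using y[of 0] by (simp add: T_def)
  ultimately show False using sub by blast
qed

text \<open>Choquet's capacitability argument. Coordinates are bounded one at a time, and the
  increasing sets lemma keeps the content of the image above \<open>c\<close>. The limiting box is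
  compact. If its image had content 0, a cover of weight below \<open>c / 27\<close> could be
  enlarged to an open set that contains the image of some finite stage, whose content would then be
  at most \<open>c\<close>.\<close>

lemma compact_subset_positive_content:
  fixes f :: "(nat \<Rightarrow> nat) \<Rightarrow> real ^ 3"
  assumes f: "continuous_on UNIV f" and pos: "cube.content s (range f) \<noteq> 0"
  shows "\<exists>K\<subseteq>range f. compact K \<and> cube.content s K \<noteq> 0"
proof -
  have "0 < cube.content s (range f)" using pos by (simp add: zero_less_iff_neq_zero)
  then obtain y where y: "0 < y" "y < cube.content s (range f)" using dense by blast
  define c where "c = enn2real y"
  have "y < top" using y(2) by (auto simp: less_top[symmetric] top_unique)
  then have c: "0 < c" "ennreal c < cube.content s (range f)"
    using y by (auto simp: c_def enn2real_positive_iff)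
  define S where "S L = {x :: nat \<Rightarrow> nat. \<forall>i<length L. x i \<le> L ! i}" for L
  have step: "\<exists>N. ennreal c < cube.content s (f ` S (L @ [N]))" if L: "ennreal c < cube.content s (f ` S L)" for L
  proof -
    have SN: "S (L @ [N]) = {x\<in>S L. x (length L) \<le> N}" for N
      by (auto simp: S_def nth_append less_Suc_eq)
    have "(\<Union>N. f ` S (L @ [N])) = f ` S L" unfolding SN by auto
    then have "ennreal c < cube.content s (\<Union>N. f ` S (L @ [N]))" using L by simp
    moreover have "f ` S (L @ [N]) \<subseteq> f ` S (L @ [Suc N])" for N unfolding SN by auto
    ultimately show ?thesis by (intro cube.content_increasing_union)
  qed
  define nxt where "nxt L = L @ [SOME N. ennreal c < cube.content s (f ` S (L @ [N]))]" for L
  define Ls where "Ls k = (nxt ^^ k) []" for k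
  have P: "ennreal c < cube.content s (f ` S (Ls k))" for k
  proof (induction k)
    case 0
    show ?case using c by (simp add: Ls_def S_def)
  next
    case (Suc k)
    then show ?case using someI_ex[OF step[OF Suc]] by (simp add: Ls_def nxt_def)
  qed
  have LS: "Ls (Suc k) = nxt (Ls k)" for k by (simp add: Ls_def)
  have len: "length (Ls k) = k" for k
    by (induction k) (simp_all add: LS nxt_def, simp add: Ls_def)
  define b where "b i = Ls (Suc i) ! i" for i
  have nth: "Ls k ! i = b i" if "i < k" for i k
    using that
  proof (induction k)
    case (Suc k)
    show ?case
    proof (cases "i = k")
      case False
      then show ?thesis using Suc len[of k] by (simp add: LS nxt_def nth_append)
    qed (simp add: b_def)
  qed simp
  have S_eq: "S (Ls k) = {x. \<forall>i<k. x i \<le> b i}" for k by (auto simp: S_def len nth)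
  let ?K = "f ` {x. \<forall>i. x i \<le> b i}"
  have "compact ?K"
    by (intro compact_continuous_image baire_bounded_compact continuous_on_subset[OF f]) auto
  moreover have "cube.content s ?K \<noteq> 0"
  proof
    assume "cube.content s ?K = 0"
    then have "cube.content s ?K < ennreal (c / 27)" using c by simp
    then obtain C where C: "cube.covers C ?K" "infsum (cube.wt s) C < ennreal (c / 27)"
      unfolding cube.content_def INF_less_iff by auto
    obtain G where G: "open G" "?K \<subseteq> G" "\<And>B. B \<subseteq> G \<Longrightarrow> cube.content s B \<le> 27 * infsum (cube.wt s) C"
      using content_open_enlargement[OF C(1), of s] by blast
    obtain j where "f ` {x. \<forall>i<j. x i \<le> b i} \<subseteq> G" using baire_truncation[OF f G(1,2)] by blast
    then have "cube.content s (f ` S (Ls j)) \<le> 27 * infsum (cube.wt s) C" unfolding S_eq by (rule G)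
    also have "\<dots> \<le> 27 * ennreal (c / 27)" using C(2) by (intro mult_left_mono) auto
    also have "\<dots> = ennreal c" using c by (simp add: ennreal_mult[symmetric] flip: ennreal_numeral)
    finally show False using P[of j] by simp
  qed
  moreover have "?K \<subseteq> range f" by (rule image_mono) simp
  ultimately show ?thesis by (intro exI[of _ ?K] conjI)
qed

text \<open>A compact set meets finitely many unit cubes, so one of them, \<open>c0\<close>, has
  positive content and serves as the root of the tree. Compactness of \<open>K'\<close> is retained
  because finite subcovers are needed later.\<close>

theorem analytic_frostman:
  fixes K :: "(real ^ 3) set"
  assumes s: "0 < s" and K: "analytic_set K" and pos: "\<not> hnull s K"
  obtains K' c0 and M :: "nat \<Rightarrow> int \<times> int \<times> int \<Rightarrow> real"
  where "compact K'" "K' \<subseteq> K" "0 < M 0 c0" "\<And>n c. 0 \<le> M n c" "\<And>n c. M n c \<le> (1 / 2 ^ n) powr s"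
    "\<And>n c. M n c = (\<Sum>c'\<in>{c'. par3 c' = c}. M (Suc n) c')"
    "\<And>n c. 0 < M n c \<Longrightarrow> \<exists>x\<in>K'. code3 n x = c" "\<And>n c. M n c \<noteq> 0 \<Longrightarrow> (par3 ^^ n) c = c0"
proof -
  have pos': "cube.content s K \<noteq> 0" using pos hnull_of_content_zero[OF s] by blast
  then have "K \<noteq> {}" by auto
  then obtain f :: "(nat \<Rightarrow> nat) \<Rightarrow> real ^ 3" where f: "continuous_on UNIV f" "K = range f"
    using K by (auto simp: analytic_set_def)
  obtain K' where K': "K' \<subseteq> K" "compact K'" "cube.content s K' \<noteq> 0"
    using compact_subset_positive_content[OF f(1)] pos' f(2) by blast
  have fin: "finite (code3 0 ` K')"
  proof -
    obtain B where B: "\<And>x. x \<in> K' \<Longrightarrow> norm x \<le> B"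
      using compact_imp_bounded[OF K'(2)] by (auto simp: bounded_iff)
    have "dcell 0 (x $ i) \<in> {\<lfloor>- B\<rfloor>..\<lceil>B\<rceil>}" if "x \<in> K'" for x i
    proof -
      have "\<bar>x $ i\<bar> \<le> B" using component_le_norm_cart[of x i] B[OF that] by linarith
      then have "- B \<le> x $ i" "x $ i \<le> B" by linarith+
      then show ?thesis unfolding dcell_def by (simp add: floor_mono) linarith
    qed
    then have "code3 0 ` K' \<subseteq> {\<lfloor>- B\<rfloor>..\<lceil>B\<rceil>} \<times> {\<lfloor>- B\<rfloor>..\<lceil>B\<rceil>} \<times> {\<lfloor>- B\<rfloor>..\<lceil>B\<rceil>}"
      by (auto simp: code3_def)
    then show ?thesis by (rule finite_subset) simp
  qed
  have "K' = (\<Union>c\<in>code3 0 ` K'. {x\<in>K'. code3 0 x = c})" by auto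
  then have "cube.content s K' \<le> (\<Sum>c\<in>code3 0 ` K'. cube.content s {x\<in>K'. code3 0 x = c})"
    using cube.content_UN_le[OF fin, of s "\<lambda>c. {x\<in>K'. code3 0 x = c}"] by simp
  then obtain c0 where c0: "cube.content s {x\<in>K'. code3 0 x = c0} \<noteq> 0"
    using K'(3) fin by (metis (no_types, lifting) le_zero_eq sum.neutral)
  show thesis
  proof -
    have "\<exists>M. 0 < M 0 c0 \<and> (\<forall>n c. 0 \<le> M n c \<and> M n c \<le> (1 / 2 ^ n) powr s) \<and>
    (\<forall>n c. M n c = (\<Sum>c'\<in>{c'. par3 c' = c}. M (Suc n) c')) \<and>
    (\<forall>n c. 0 < M n c \<longrightarrow> {x\<in>{x\<in>K'. code3 0 x = c0}. code3 n x = c} \<noteq> {}) \<and> (\<forall>n c. M n c \<noteq> 0 \<longrightarrow> (par3 ^^ n) c = c0)"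
      by (rule cube.exists_frostman_mass) (use c0 in auto)
    then obtain M where M: "0 < M 0 c0" "\<forall>n c. 0 \<le> M n c \<and> M n c \<le> (1 / 2 ^ n) powr s"
      "\<forall>n c. M n c = (\<Sum>c'\<in>{c'. par3 c' = c}. M (Suc n) c')"
      "\<forall>n c. 0 < M n c \<longrightarrow> {x\<in>{x\<in>K'. code3 0 x = c0}. code3 n x = c} \<noteq> {}" "\<forall>n c. M n c \<noteq> 0 \<longrightarrow> (par3 ^^ n) c = c0"
      by blast
    show thesis
    proof (rule that[of K' M c0])
      show "compact K'" "K' \<subseteq> K" by (fact K')+
      show "0 < M 0 c0" by (fact M(1))
      show "0 \<le> M n c" "M n c \<le> (1 / 2 ^ n) powr s" for n c using M(2) by blast+
      show "M n c = (\<Sum>c'\<in>{c'. par3 c' = c}. M (Suc n) c')" for n c by (rule M(3)[THEN spec, THEN spec])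
      show "\<exists>x\<in>K'. code3 n x = c" if "0 < M n c" for n c using M(4) that by blast
      show "(par3 ^^ n) c = c0" if "M n c \<noteq> 0" for n c using M(5) that by blast
    qed
  qed
qed

section \<open>Small projections at dyadic scales\<close>

lemma par3_funpow: "(par3 ^^ i) (a, b, c) = (a div 2 ^ i, b div 2 ^ i, c div 2 ^ i)"
proof (induction i)
  case (Suc i)
  have "x div 2 ^ i div 2 = x div (2 ^ i * 2)" for x :: int by (simp add: div_mult2_eq zdiv_zmult2_eq)
  moreover have "(par3 ^^ Suc i) (a, b, c) = par3 (a div 2 ^ i, b div 2 ^ i, c div 2 ^ i)" by (simp add: Suc)
  ultimately show ?case by (simp add: par3_def mult.commute)
qed simp

lemma div_pow_close:
  fixes a b :: int
  assumes "\<bar>a - b\<bar> < 2 ^ i"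
  shows "a div 2 ^ i - b div 2 ^ i \<in> {-1, 0, 1}"
proof -
  have "a div 2 ^ i \<le> (b + 2 ^ i) div 2 ^ i" using assms by (intro zdiv_mono1) auto
  moreover have "b div 2 ^ i \<le> (a + 2 ^ i) div 2 ^ i" using assms by (intro zdiv_mono1) auto
  ultimately have "a div 2 ^ i \<le> b div 2 ^ i + 1" "b div 2 ^ i \<le> a div 2 ^ i + 1" by simp_all
  then show ?thesis by auto
qed

lemma finite_descendants: "finite {c. (par3 ^^ k) c = d}"
proof -
  obtain a b c where d: "d = (a, b, c)" by (cases d) auto
  have r: "x \<in> {y * 2 ^ k..y * 2 ^ k + 2 ^ k}" if "x div 2 ^ k = y" for x y :: int
  proof -
    have "x div 2 ^ k * 2 ^ k + x mod 2 ^ k = x" "0 \<le> x mod 2 ^ k" "x mod 2 ^ k < 2 ^ k"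
      by (rule div_mult_mod_eq) simp_all
    then show ?thesis unfolding that[symmetric] atLeastAtMost_iff by linarith
  qed
  have "{c. (par3 ^^ k) c = d} \<subseteq> {a * 2 ^ k..a * 2 ^ k + 2 ^ k} \<times> {b * 2 ^ k..b * 2 ^ k + 2 ^ k} \<times> {c * 2 ^ k..c * 2 ^ k + 2 ^ k}"
    using r by (auto simp: par3_funpow d)
  then show ?thesis by (rule finite_subset) simp
qed

lemma dyadic_between:
  fixes r :: real
  assumes "0 < r" "r < 1"
  obtains j where "1 / 2 ^ Suc j \<le> r" "r < 1 / 2 ^ j"
proof -
  obtain n where "(1 / 2) ^ n < r" using real_arch_pow_inv[of r "1 / 2"] assms by auto
  then have ex: "\<exists>n. 1 / 2 ^ n \<le> r" by (auto simp: power_one_over intro: less_imp_le)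
  define n where "n = (LEAST n. 1 / 2 ^ n \<le> r)"
  have n: "1 / 2 ^ n \<le> r" unfolding n_def using ex by (rule LeastI_ex)
  then have "n \<noteq> 0" using assms by (cases n) auto
  then obtain j where j: "n = Suc j" by (cases n) auto
  have "\<not> 1 / 2 ^ j \<le> r" using not_less_Least[of j "\<lambda>n. 1 / 2 ^ n \<le> r"] j unfolding n_def by simp
  then show thesis using that[of j] n j by simp
qed

text \<open>A set of diameter 0 has no dyadic scale; the lower limit \<open>r i\<close> repairs this
  at a total cost of \<open>1 / 4\<close>. The diameters contribute another \<open>1 / 4\<close>,
  and rounding up to powers of two at most doubles the sum.\<close>

lemma hnull_dyadic_cover:
  fixes B :: "real set"
  assumes t: "0 < t" "t \<le> 1" and null: "hnull t B"
  shows "\<exists>(\<kappa> :: nat \<Rightarrow> nat) y. (\<forall>i. k0 \<le> \<kappa> i) \<and> B \<subseteq> (\<Union>i. {v. \<bar>v - y i\<bar> < 1 / 2 ^ \<kappa> i}) \<and>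
    (\<forall>n. (\<Sum>i<n. (1 / 2 ^ \<kappa> i) powr t) \<le> 1)"
proof -
  obtain U :: "nat \<Rightarrow> real set" where U: "B \<subseteq> (\<Union>i. U i)" "\<And>i. bounded (U i)" "\<And>i. diameter (U i) \<le> 1 / 2 ^ (k0 + 2)"
     "(\<Sum>i. hausdorff_gauge t (U i)) \<le> ennreal (1 / 4)"
    by (rule hnull_coverE[OF null, of "1 / 2 ^ (k0 + 2)" "1 / 4"]) auto
  have d0: "0 \<le> diameter (U i)" for i by (rule diameter_ge_0[OF U(2)])
  define r where "r i = min (1 / 2 ^ (k0 + 2)) ((1 / 2 ^ (i + 3)) powr (1 / t))" for i
  define D where "D i = max (diameter (U i)) (r i)" for i
  have r0: "0 < r i" for i by (simp add: r_def)
  have rt: "r i powr t \<le> 1 / 2 ^ (i + 3)" for i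
  proof -
    have "r i powr t \<le> ((1 / 2 ^ (i + 3)) powr (1 / t)) powr t"
      using r0[of i] t by (intro powr_mono2) (auto simp: r_def)
    also have "\<dots> = 1 / 2 ^ (i + 3)" using t by (simp add: powr_powr)
    finally show ?thesis .
  qed
  have D0: "0 < D i" for i using r0[of i] by (simp add: D_def)
  have Dle: "D i \<le> 1 / 2 ^ (k0 + 2)" for i using U(3)[of i] by (simp add: D_def r_def)
  have D1: "D i < 1" for i
  proof -
    have "1 / 2 ^ (k0 + 2) < (1::real)" using power_gt1[of "2::real" "k0 + 1"] by simp
    then show ?thesis using Dle[of i] by linarith
  qed
  have "\<exists>j. 1 / 2 ^ Suc j \<le> D i \<and> D i < 1 / 2 ^ j" for i
    using dyadic_between[OF D0 D1] by metis
  then obtain \<kappa> where \<kappa>: "\<And>i. 1 / 2 ^ Suc (\<kappa> i) \<le> D i" "\<And>i. D i < 1 / 2 ^ \<kappa> i" by metis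
  have \<kappa>0: "k0 \<le> \<kappa> i" for i
  proof -
    have "1 / 2 ^ Suc (\<kappa> i) \<le> 1 / (2::real) ^ (k0 + 2)" using \<kappa>(1)[of i] Dle[of i] by linarith
    then have "(2::real) ^ (k0 + 2) \<le> 2 ^ Suc (\<kappa> i)" by (simp add: field_simps)
    then have "k0 + 2 \<le> Suc (\<kappa> i)" by (rule power_le_imp_le_exp[rotated]) simp
    then show ?thesis by simp
  qed
  define y where "y i = (SOME v. v \<in> U i)" for i
  have near: "\<bar>v - y i\<bar> < 1 / 2 ^ \<kappa> i" if "v \<in> U i" for v i
  proof -
    have "y i \<in> U i" unfolding y_def using that by (rule someI)
    then have "\<bar>v - y i\<bar> \<le> diameter (U i)" using diameter_bounded_bound[OF U(2) that] by (simp add: dist_real_def)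
    also have "\<dots> \<le> D i" by (simp add: D_def)
    finally show ?thesis using \<kappa>(2)[of i] by linarith
  qed
  have "(\<Sum>i<n. (1 / 2 ^ \<kappa> i) powr t) \<le> 1" for n
  proof -
    have term_le: "(1 / 2 ^ \<kappa> i) powr t \<le> 2 * (diameter (U i) powr t + 1 / 2 ^ (i + 3))" for i
    proof -
      have "(1 / 2 ^ \<kappa> i) powr t \<le> (2 * D i) powr t" using \<kappa>(1)[of i] t by (intro powr_mono2) auto
      also have "\<dots> = 2 powr t * D i powr t" by (rule powr_mult)
      also have "\<dots> \<le> 2 * D i powr t" using powr_mono[of t 1 2] t by (intro mult_right_mono) auto
      also have "D i powr t \<le> diameter (U i) powr t + r i powr t" by (auto simp: D_def max_def)
      also have "\<dots> \<le> diameter (U i) powr t + 1 / 2 ^ (i + 3)" using rt by simp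
      finally show ?thesis by simp
    qed
    have "ennreal (\<Sum>i<n. diameter (U i) powr t) = (\<Sum>i<n. ennreal (diameter (U i) powr t))" by (simp add: sum_ennreal)
    also have "\<dots> = (\<Sum>i<n. hausdorff_gauge t (U i))"
      using t by (intro sum.cong refl) (auto simp: hausdorff_gauge_def)
    also have "\<dots> \<le> (\<Sum>i. hausdorff_gauge t (U i))" by (rule sum_le_suminf) auto
    also have "\<dots> \<le> ennreal (1 / 4)" by (rule U)
    finally have s1: "(\<Sum>i<n. diameter (U i) powr t) \<le> 1 / 4" by (simp add: ennreal_le_iff)
    have s2: "(\<Sum>i<n. 1 / 2 ^ (i + 3)) \<le> (1 / 4 :: real)"
    proof -
      have "(\<Sum>i<n. 1 / 2 ^ (i + 3)) = 1 / 4 - 1 / (2::real) ^ (n + 2)"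
        by (induction n) (simp_all add: power_add field_simps)
      then show ?thesis by simp
    qed
    have "(\<Sum>i<n. (1 / 2 ^ \<kappa> i) powr t) \<le> (\<Sum>i<n. 2 * (diameter (U i) powr t + 1 / 2 ^ (i + 3)))"
      by (intro sum_mono term_le)
    also have "\<dots> = 2 * ((\<Sum>i<n. diameter (U i) powr t) + (\<Sum>i<n. 1 / 2 ^ (i + 3)))"
      by (simp add: sum_distrib_left sum.distrib)
    also have "\<dots> \<le> 2 * (1 / 4 + 1 / 4)" by (intro mult_left_mono add_mono s1 s2) simp
    also have "\<dots> = 1" by simp
    finally show ?thesis .
  qed
  moreover have "B \<subseteq> (\<Union>i. {v. \<bar>v - y i\<bar> < 1 / 2 ^ \<kappa> i})" using U(1) near by blast
  ultimately show ?thesis using \<kappa>0 by blast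
qed

text \<open>Half of the exponential decay absorbs the power of \<open>k\<close>.\<close>

lemma summable_powr_geometric:
  fixes b c :: real
  assumes "0 < c"
  shows "summable (\<lambda>k. (real k + 2) powr b * 2 powr (- c * real k))"
proof -
  define n where "n = nat \<lceil>max b 0\<rceil>"
  have nb: "b \<le> real n" by (simp add: n_def) linarith
  define h where "h = c * ln 2 / 2"
  have h: "0 < h" using assms by (simp add: h_def)
  have "filterlim (\<lambda>k. 2 + real k) at_top sequentially"
    by (rule filterlim_tendsto_add_at_top[OF tendsto_const filterlim_real_sequentially])
  then have "filterlim (\<lambda>k. h * (real k + 2)) at_top sequentially"
    by (intro filterlim_tendsto_pos_mult_at_top[OF tendsto_const h]) (simp add: add.commute)
  then have "(\<lambda>k. (h * (real k + 2)) ^ n / exp (h * (real k + 2))) \<longlonglongrightarrow> 0"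
    by (rule filterlim_compose[OF tendsto_power_div_exp_0])
  then have "eventually (\<lambda>k. (h * (real k + 2)) ^ n / exp (h * (real k + 2)) < 1) sequentially"
    by (intro order_tendstoD(2)) auto
  then have ev: "eventually (\<lambda>k. norm ((real k + 2) powr b * 2 powr (- c * real k)) \<le> (exp (2 * h) / h ^ n) * (2 powr (- c / 2)) ^ k) sequentially"
  proof eventually_elim
    case (elim k)
    have "(h * (real k + 2)) ^ n \<le> exp (h * (real k + 2))" using elim by (simp add: divide_less_eq)
    then have "(real k + 2) ^ n * h ^ n \<le> exp (h * (real k + 2))" by (simp only: power_mult_distrib mult.commute)
    then have p: "(real k + 2) ^ n \<le> exp (h * (real k + 2)) / h ^ n"
      by (simp only: pos_le_divide_eq[OF zero_less_power[OF h]])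
    have "(real k + 2) powr b \<le> (real k + 2) powr real n" using nb by (intro powr_mono) auto
    also have "\<dots> = (real k + 2) ^ n" by (simp add: powr_realpow)
    also note p
    finally have "(real k + 2) powr b * 2 powr (- c * real k) \<le> exp (h * (real k + 2)) / h ^ n * 2 powr (- c * real k)"
      by (intro mult_right_mono) auto
    also have "\<dots> = (exp (2 * h) / h ^ n) * (2 powr (c / 2 * real k) * 2 powr (- c * real k))"
    proof -
      have "h * (real k + 2) = 2 * h + c / 2 * real k * ln 2" by (simp add: h_def algebra_simps)
      then have "exp (h * (real k + 2)) = exp (2 * h) * 2 powr (c / 2 * real k)" by (simp add: powr_def exp_add)
      then show ?thesis by simp
    qed
    also have "2 powr (c / 2 * real k) * 2 powr (- c * real k) = (2 powr (- c / 2)) ^ k"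
      by (simp add: powr_add[symmetric] powr_power algebra_simps)
    finally show ?case by simp
  qed
  have "summable (\<lambda>k. (exp (2 * h) / h ^ n) * (2 powr (- c / 2)) ^ k)"
    using assms powr_less_mono[of "- c / 2" 0 2] by (intro summable_mult summable_geometric) auto
  then show ?thesis by (rule summable_comparison_test_ev[OF ev])
qed

section \<open>The Frostman distribution as a weighted family of quadratics\<close>

definition quad :: "real \<Rightarrow> real ^ 3 \<Rightarrow> real" where
  "quad t x = x $ 1 * t\<^sup>2 + x $ 2 * t + x $ 3"

locale dyadic_frostman =
  fixes K :: "(real ^ 3) set" and c0 :: "int \<times> int \<times> int"
    and M :: "nat \<Rightarrow> int \<times> int \<times> int \<Rightarrow> real" and s t0 :: real
  assumes cpt: "compact K" and M_pos: "0 < M 0 c0" and M_ge: "0 \<le> M n c"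
    and M_le: "M n c \<le> (1 / 2 ^ n) powr s"
    and M_split: "M n c = (\<Sum>c'\<in>{c'. par3 c' = c}. M (Suc n) c')"
    and M_hit: "0 < M n c \<Longrightarrow> \<exists>x\<in>K. code3 n x = c"
    and M_supp: "M n c \<noteq> 0 \<Longrightarrow> (par3 ^^ n) c = c0"
    and s: "s \<le> 1" and t0: "0 < t0" "t0 < s"
begin

abbreviation "mu0 \<equiv> M 0 c0"

lemma mu0_le: "mu0 \<le> 1"
  using M_le[of 0 c0] by simp

definition "Ik k = {c. (par3 ^^ k) c = c0}" for k
text \<open>A cube is represented by its lower corner, taken relative to the root cube so that the
  coordinates lie in \<open>[0, 1)\<close>.\<close>

definition "X1 k c = real_of_int (fst c) / 2 ^ k - real_of_int (fst c0)" for k and c :: "int \<times> int \<times> int"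
definition "X2 k c = real_of_int (fst (snd c)) / 2 ^ k - real_of_int (fst (snd c0))" for k and c :: "int \<times> int \<times> int"
definition "X3 k c = real_of_int (snd (snd c)) / 2 ^ k - real_of_int (snd (snd c0))" for k and c :: "int \<times> int \<times> int"
text \<open>34 is twice the number 17 of cells that have to be allotted to one covering interval,
  and \<open>(k + 1) * (k + 2)\<close> comes from the telescoping series that distributes the mass
  over the scales.\<close>

definition "mk k = mu0 / (34 * (real k + 1) * (real k + 2)) * 2 powr (- t0 * real k)" for k
definition "qk k c t = X1 k c * t\<^sup>2 + X2 k c * t + X3 k c" for k c t
definition "cellk k c j = \<lfloor>2 ^ k * qk k c (real j / 2 ^ k)\<rfloor>" for k c and j :: nat
definition "Nk k c j = (\<Sum>d\<in>{d\<in>Ik k. cellk k d j = cellk k c j}. M k d)" for k c j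
definition "Tk k = {j. j < 2 ^ k \<and> mu0 / (2 * (real k + 1) * (real k + 2)) \<le> (\<Sum>c\<in>{c\<in>Ik k. mk k \<le> Nk k c j}. M k c)}" for k

lemma M_descend: "(\<Sum>c\<in>{c. (par3 ^^ i) c = d}. M (n + i) c) = M n d"
proof (induction i)
  case (Suc i)
  have eq: "{c. (par3 ^^ Suc i) c = d} = (\<Union>c'\<in>{c. (par3 ^^ i) c = d}. {c. par3 c = c'})"
    by (auto simp: funpow_swap1)
  have "(\<Sum>c\<in>{c. (par3 ^^ Suc i) c = d}. M (n + Suc i) c)
     = (\<Sum>c'\<in>{c. (par3 ^^ i) c = d}. \<Sum>c\<in>{c. par3 c = c'}. M (n + Suc i) c)"
    unfolding eq by (rule sum.UNION_disjoint) (auto simp: finite_descendants cube.finite_children)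
  also have "\<dots> = (\<Sum>c'\<in>{c. (par3 ^^ i) c = d}. M (n + i) c')"
    by (intro sum.cong refl) (simp add: M_split[of "n + i"])
  finally show ?case using Suc by simp
qed simp

lemma fin_Ik: "finite (Ik k)" unfolding Ik_def by (rule finite_descendants)

lemma sum_Ik: "(\<Sum>c\<in>Ik k. M k c) = mu0"
  using M_descend[where i=k and d=c0 and n=0] by (simp add: Ik_def)

lemma coord_range:
  assumes "x div 2 ^ k = y"
  shows "0 \<le> real_of_int x / 2 ^ k - real_of_int y \<and> real_of_int x / 2 ^ k - real_of_int y < 1"
proof -
  have "\<lfloor>real_of_int x / of_int (2 ^ k)\<rfloor> = y" using assms by (simp only: floor_divide_of_int_eq)
  then have "\<lfloor>real_of_int x / 2 ^ k\<rfloor> = y" by simp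
  then show ?thesis by linarith
qed

lemma X_range:
  assumes "c \<in> Ik k"
  shows "0 \<le> X1 k c \<and> X1 k c < 1" "0 \<le> X2 k c \<and> X2 k c < 1" "0 \<le> X3 k c \<and> X3 k c < 1"
proof -
  obtain a b e where c: "c = (a, b, e)" by (cases c) auto
  have H: "a div 2 ^ k = fst c0" "b div 2 ^ k = fst (snd c0)" "e div 2 ^ k = snd (snd c0)"
    using assms by (auto simp: Ik_def c par3_funpow)
  show "0 \<le> X1 k c \<and> X1 k c < 1" using coord_range[OF H(1)] by (simp add: X1_def c)
  show "0 \<le> X2 k c \<and> X2 k c < 1" using coord_range[OF H(2)] by (simp add: X2_def c)
  show "0 \<le> X3 k c \<and> X3 k c < 1" using coord_range[OF H(3)] by (simp add: X3_def c)
qed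

text \<open>For \<open>1 / 2 ^ Suc j \<le> r < 1 / 2 ^ j\<close> the ball meets at most 27 cubes of
  generation \<open>j\<close>; replacing \<open>1 / 2 ^ j\<close> by \<open>2 * r\<close> costs the
  factor \<open>2 powr s \<le> 2\<close>.\<close>

lemma ball_mass:
  assumes x: "x \<in> Ik k" and r: "1 / 2 ^ k \<le> r"
  shows "(\<Sum>y\<in>{y\<in>Ik k. max \<bar>X1 k y - X1 k x\<bar> (max \<bar>X2 k y - X2 k x\<bar> \<bar>X3 k y - X3 k x\<bar>) < r}. M k y) \<le> 54 * r powr s"
    (is "sum _ ?S \<le> _")
proof (cases "1 \<le> r")
  case True
  have "(\<Sum>y\<in>?S. M k y) \<le> (\<Sum>y\<in>Ik k. M k y)" using fin_Ik M_ge by (intro sum_mono2) auto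
  also have "\<dots> \<le> 1" using sum_Ik mu0_le by simp
  also have "1 \<le> r powr s" using True t0 by (intro ge_one_powr_ge_zero) auto
  also have "r powr s \<le> 54 * r powr s" by simp
  finally show ?thesis .
next
  case False
  have r0: "0 < r" using r by (rule less_le_trans[rotated]) simp
  obtain j where j: "1 / 2 ^ Suc j \<le> r" "r < 1 / 2 ^ j" using dyadic_between[OF r0] False by auto
  have "1 / 2 ^ k < 1 / (2 ^ j :: real)" using r j by linarith
  then have "(2::real) ^ j < 2 ^ k" by (simp add: field_simps)
  then have jk: "j < k" by simp
  define i where "i = k - j"
  have k: "k = j + i" using jk by (simp add: i_def)
  obtain a b e where xe: "x = (a, b, e)" by (cases x) auto
  define E where "E = {a div 2 ^ i - 1..a div 2 ^ i + 1} \<times> {b div 2 ^ i - 1..b div 2 ^ i + 1} \<times> {e div 2 ^ i - 1..e div 2 ^ i + 1}"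
  have E: "finite E" "card E = 27" by (simp_all add: E_def card_cartesian_product)
  have close: "u div 2 ^ i \<in> {v div 2 ^ i - 1..v div 2 ^ i + 1}"
    if "\<bar>(real_of_int u / 2 ^ k - w) - (real_of_int v / 2 ^ k - w)\<bar> < r" for u v :: int and w
  proof -
    have "(real_of_int u / 2 ^ k - w) - (real_of_int v / 2 ^ k - w) = real_of_int (u - v) / 2 ^ k"
      by (simp add: diff_divide_distrib)
    then have "\<bar>real_of_int (u - v)\<bar> / 2 ^ k < 1 / 2 ^ j" using that j(2) by simp
    then have "\<bar>real_of_int (u - v)\<bar> < 2 ^ i" by (simp add: k power_add field_simps)
    then have "real_of_int \<bar>u - v\<bar> < real_of_int (2 ^ i)" by simp
    then have "\<bar>u - v\<bar> < 2 ^ i" by (simp only: of_int_less_iff)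
    from div_pow_close[OF this] show ?thesis by auto
  qed
  have "?S \<subseteq> (\<Union>d\<in>E. {y. (par3 ^^ i) y = d})"
  proof
    fix y assume y: "y \<in> ?S"
    obtain a' b' e' where ye: "y = (a', b', e')" by (cases y) auto
    have "(par3 ^^ i) y \<in> E"
      using y close unfolding E_def ye xe par3_funpow X1_def X2_def X3_def by simp
    then show "y \<in> (\<Union>d\<in>E. {y. (par3 ^^ i) y = d})" by blast
  qed
  then have "(\<Sum>y\<in>?S. M k y) \<le> (\<Sum>y\<in>(\<Union>d\<in>E. {y. (par3 ^^ i) y = d}). M k y)"
    using E M_ge finite_descendants by (intro sum_mono2) auto
  also have "\<dots> = (\<Sum>d\<in>E. \<Sum>y\<in>{y. (par3 ^^ i) y = d}. M k y)"
    by (rule sum.UNION_disjoint) (use E finite_descendants in auto)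
  also have "\<dots> = (\<Sum>d\<in>E. M j d)" unfolding k by (simp add: M_descend)
  also have "\<dots> \<le> (\<Sum>d\<in>E. (1 / 2 ^ j) powr s)" by (intro sum_mono M_le)
  also have "\<dots> = 27 * (1 / 2 ^ j) powr s" by (simp add: E)
  also have "\<dots> \<le> 27 * (2 * r) powr s"
    using j(1) t0 by (intro mult_left_mono powr_mono2) auto
  also have "\<dots> = 27 * (2 powr s * r powr s)" by (simp add: powr_mult)
  also have "\<dots> \<le> 27 * (2 * r powr s)"
    using powr_mono[of s 1 2] s by (intro mult_left_mono mult_right_mono) auto
  finally show ?thesis by simp
qed

lemma mk_bounds: "0 < mk k" "mk k \<le> 1"
proof -
  show "0 < mk k" using M_pos by (auto simp: mk_def)
  have "mk k \<le> 1 / (34 * (real k + 1) * (real k + 2)) * 1"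
    unfolding mk_def using mu0_le M_pos t0 powr_mono[of "- t0 * real k" 0 2]
    by (intro mult_mono divide_right_mono) auto
  also have "\<dots> \<le> 1"
  proof -
    have "1 * 1 * 1 \<le> 34 * (real k + 1) * (real k + 2)" by (intro mult_mono) auto
    then show ?thesis by simp
  qed
  finally show "mk k \<le> 1" .
qed

lemma weighted: "weighted_quadratics (Ik k) (X1 k) (X2 k) (X3 k) (M k) k s (mk k) 54 (Tk k)"
proof
  show "(\<Sum>x\<in>Ik k. M k x) \<le> 1" using sum_Ik mu0_le by simp
  show "0 < s" using t0 by simp
qed (use fin_Ik M_ge X_range s mk_bounds ball_mass in \<open>auto simp: Tk_def\<close>)

text \<open>Each parameter in \<open>Tk k\<close> contributes at least
  \<open>mu0 / (2 * (k + 1) * (k + 2))\<close> to the heavy mass, which \<open>heavy_mass_le\<close>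
  bounds with \<open>C = 54\<close>.\<close>

lemma card_Tk:
  defines "\<Lambda> k \<equiv> (108 / mk k) powr (1 / s)"
  shows "real (card (Tk k)) * mu0 \<le> 40000 * (real k + 2) ^ 5 * (\<Lambda> k + sqrt (2 ^ k * \<Lambda> k))"
proof -
  interpret wq: weighted_quadratics "Ik k" "X1 k" "X2 k" "X3 k" "M k" k s "mk k" 54 "Tk k" by (rule weighted)
  have cell: "wq.cell c j = cellk k c j" for c j by (simp add: wq.cell_def wq.q_def cellk_def qk_def)
  have N: "wq.N c j = Nk k c j" for c j by (simp add: wq.N_def Nk_def cell)
  have "real (card (Tk k)) * (mu0 / (2 * (real k + 1) * (real k + 2))) \<le> wq.heavy_mass"
    unfolding wq.heavy_mass_def N using sum_bounded_below[of "Tk k" "mu0 / (2 * (real k + 1) * (real k + 2))"]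
    by (auto simp: Tk_def)
  also have "\<dots> \<le> 20000 * (real k + 1) ^ 3 * (\<Lambda> k + sqrt (2 ^ k * \<Lambda> k))"
    using wq.heavy_mass_le by (simp add: \<Lambda>_def)
  finally have "real (card (Tk k)) * mu0 \<le> (20000 * (real k + 1) ^ 3 * (\<Lambda> k + sqrt (2 ^ k * \<Lambda> k))) * (2 * (real k + 1) * (real k + 2))"
    by (simp add: pos_divide_le_eq)
  also have "\<dots> = 40000 * ((real k + 1) ^ 4 * (real k + 2)) * (\<Lambda> k + sqrt (2 ^ k * \<Lambda> k))"
  proof -
    have "(20000 * x ^ 3 * z) * (2 * x * y) = 40000 * (x ^ 4 * y) * z" for x y z :: real
      by (simp add: power_numeral_reduce mult_ac)
    then show ?thesis .
  qed
  also have "\<dots> \<le> 40000 * ((real k + 2) ^ 4 * (real k + 2)) * (\<Lambda> k + sqrt (2 ^ k * \<Lambda> k))"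
    by (intro mult_right_mono mult_left_mono power_mono add_nonneg_nonneg) (auto simp: \<Lambda>_def)
  also have "(real k + 2) ^ 4 * (real k + 2) = (real k + 2) ^ 5" by (simp add: power_numeral_reduce)
  finally show ?thesis .
qed

lemma summable_card_Tk:
  assumes v: "(1 + t0 / s) / 2 < v"
  shows "summable (\<lambda>k. real (card (Tk k)) * (1 / 2 ^ k) powr v)"
proof (rule summable_comparison_test)
  \<comment> \<open>Up to powers of \<open>k\<close>, \<open>\<Lambda>\<close> is at most
    \<open>2 powr (t0 / s * k)\<close> and \<open>sqrt (2 ^ k * \<Lambda>)\<close> at most
    \<open>2 powr (a * k)\<close>, which is the larger because \<open>t0 / s \<le> a\<close>. The
    3672 in \<open>A\<close> is \<open>34 * 108\<close>.\<close>
  define a where "a = (1 + t0 / s) / 2"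
  define A where "A = (3672 / mu0) powr (1 / s)"
  have s0: "0 < s" using t0 by simp
  have A1: "1 \<le> A" unfolding A_def using M_pos mu0_le s0 by (intro ge_one_powr_ge_zero) (auto simp: field_simps)
  have ta: "t0 / s \<le> a" using t0 s0 by (simp add: a_def field_simps)
  show "summable (\<lambda>k. 80000 * A / mu0 * ((real k + 2) powr (5 + 2 / s) * 2 powr (- (v - a) * real k)))"
    by (intro summable_mult summable_powr_geometric) (use v in \<open>simp add: a_def\<close>)
  have "norm (real (card (Tk k)) * (1 / 2 ^ k) powr v)
      \<le> 80000 * A / mu0 * ((real k + 2) powr (5 + 2 / s) * 2 powr (- (v - a) * real k))" for k
  proof -
    define \<Lambda> where "\<Lambda> = (108 / mk k) powr (1 / s)"
    define L where "L = A * (real k + 2) powr (2 / s)"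
    have L1: "1 \<le> L"
    proof -
      have "1 * 1 \<le> L" unfolding L_def using A1 s0 by (intro mult_mono ge_one_powr_ge_zero) auto
      then show ?thesis by simp
    qed
    have "108 / mk k = 108 * (34 * (real k + 1) * (real k + 2)) / mu0 * 2 powr (t0 * real k)"
      using M_pos by (simp add: mk_def powr_minus divide_inverse)
    also have "\<dots> \<le> 108 * (34 * (real k + 2) * (real k + 2)) / mu0 * 2 powr (t0 * real k)"
      using M_pos by (intro mult_right_mono divide_right_mono mult_left_mono) auto
    also have "\<dots> = 3672 / mu0 * (real k + 2) powr 2 * 2 powr (t0 * real k)"
      by (simp add: powr_numeral power2_eq_square)
    finally have "\<Lambda> \<le> (3672 / mu0 * (real k + 2) powr 2 * 2 powr (t0 * real k)) powr (1 / s)"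
      unfolding \<Lambda>_def using s0 mk_bounds[of k] by (intro powr_mono2) auto
    also have "\<dots> = L * 2 powr (t0 / s * real k)"
      unfolding L_def A_def powr_mult powr_powr by simp
    finally have L\<Lambda>: "\<Lambda> \<le> L * 2 powr (t0 / s * real k)" .
    also have "\<dots> \<le> L * 2 powr (a * real k)"
      using L1 ta by (intro mult_left_mono powr_mono mult_right_mono) auto
    finally have b1: "\<Lambda> \<le> L * 2 powr (a * real k)" .
    have "2 ^ k * \<Lambda> \<le> 2 powr real k * (L * 2 powr (t0 / s * real k))"
      using L\<Lambda> by (simp add: powr_realpow)
    also have "\<dots> = L * (2 powr (a * real k))\<^sup>2"
    proof -
      have "real k + t0 / s * real k = a * real k + a * real k" 
        by (simp add: a_def field_simps)
      then have "2 powr real k * 2 powr (t0 / s * real k) = (2 powr (a * real k))\<^sup>2"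
        by (simp only: power2_eq_square powr_add[symmetric])
      then show ?thesis by (simp add: mult.left_commute)
    qed
    also have "\<dots> \<le> L\<^sup>2 * (2 powr (a * real k))\<^sup>2"
      using L1 by (intro mult_right_mono) (auto simp: power2_eq_square)
    also have "\<dots> = (L * 2 powr (a * real k))\<^sup>2" by (simp add: power_mult_distrib)
    finally have b2: "sqrt (2 ^ k * \<Lambda>) \<le> L * 2 powr (a * real k)"
      using L1 by (intro real_le_lsqrt) auto
    have "real (card (Tk k)) * mu0 \<le> 40000 * (real k + 2) ^ 5 * (\<Lambda> + sqrt (2 ^ k * \<Lambda>))"
      unfolding \<Lambda>_def by (rule card_Tk)
    also have "\<dots> \<le> 40000 * (real k + 2) ^ 5 * (L * 2 powr (a * real k) + L * 2 powr (a * real k))"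
      using b1 b2 by (intro mult_left_mono add_mono) auto
    also have "\<dots> = 80000 * A * ((real k + 2) powr 5 * (real k + 2) powr (2 / s)) * 2 powr (a * real k)"
      by (simp add: L_def powr_numeral)
    also have "\<dots> = 80000 * A * (real k + 2) powr (5 + 2 / s) * 2 powr (a * real k)" by (simp add: powr_add)
    finally have "real (card (Tk k)) \<le> 80000 * A / mu0 * ((real k + 2) powr (5 + 2 / s) * 2 powr (a * real k))"
      using M_pos by (simp add: field_simps)
    then have "real (card (Tk k)) * 2 powr (- v * real k)
      \<le> 80000 * A / mu0 * ((real k + 2) powr (5 + 2 / s) * 2 powr (a * real k)) * 2 powr (- v * real k)"
      by (rule mult_right_mono) simp
    also have "80000 * A / mu0 * ((real k + 2) powr (5 + 2 / s) * 2 powr (a * real k)) * 2 powr (- v * real k)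
      = 80000 * A / mu0 * ((real k + 2) powr (5 + 2 / s) * (2 powr (a * real k) * 2 powr (- v * real k)))"
      by simp
    also have "2 powr (a * real k) * 2 powr (- v * real k) = 2 powr (- (v - a) * real k)"
      by (simp add: powr_add[symmetric] algebra_simps)
    finally have "real (card (Tk k)) * 2 powr (- v * real k)
      \<le> 80000 * A / mu0 * ((real k + 2) powr (5 + 2 / s) * 2 powr (- (v - a) * real k))" .
    moreover have "(1 / 2 ^ k) powr v = 2 powr (- v * real k)"
      by (simp add: powr_realpow[symmetric] powr_divide powr_powr powr_minus_divide mult.commute)
    ultimately show ?thesis by simp
  qed
  then show "\<exists>N. \<forall>n\<ge>N. norm (real (card (Tk n)) * (1 / 2 ^ n) powr v) \<le> 80000 * A / mu0 * ((real n + 2) powr (5 + 2 / s) * 2 powr (- (v - a) * real n))"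
    by blast
qed

lemma corner_close:
  assumes c: "code3 k x = c" and t: "0 \<le> t" "t \<le> 1"
  shows "\<bar>(quad t x - quad t (vector [real_of_int (fst c0), real_of_int (fst (snd c0)), real_of_int (snd (snd c0))])) - qk k c t\<bar> \<le> 3 / 2 ^ k"
proof -
  have frac: "0 \<le> x $ i - real_of_int (dcell k (x $ i)) / 2 ^ k \<and> x $ i - real_of_int (dcell k (x $ i)) / 2 ^ k \<le> 1 / 2 ^ k" for i
  proof -
    have "real_of_int (dcell k (x $ i)) \<le> 2 ^ k * x $ i" "2 ^ k * x $ i \<le> real_of_int (dcell k (x $ i)) + 1"
      unfolding dcell_def by linarith+
    moreover have "x $ i - real_of_int (dcell k (x $ i)) / 2 ^ k = (2 ^ k * x $ i - real_of_int (dcell k (x $ i))) / 2 ^ k"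
      by (simp add: diff_divide_distrib)
    ultimately show ?thesis by (auto intro: divide_right_mono)
  qed
  define d where "d i = x $ i - real_of_int (dcell k (x $ i)) / 2 ^ k" for i
  have d: "0 \<le> d i" "d i \<le> 1 / 2 ^ k" for i using frac by (auto simp: d_def)
  have eq: "(quad t x - quad t (vector [real_of_int (fst c0), real_of_int (fst (snd c0)), real_of_int (snd (snd c0))])) - qk k c t
     = d 1 * t\<^sup>2 + d 2 * t + d 3"
    unfolding c[symmetric] by (simp add: quad_def qk_def X1_def X2_def X3_def code3_def d_def vector_3 algebra_simps)
  have "0 \<le> d 1 * t\<^sup>2" "d 1 * t\<^sup>2 \<le> 1 / 2 ^ k" "0 \<le> d 2 * t" "d 2 * t \<le> 1 / 2 ^ k"
    using d[of 1] d[of 2] t by (auto intro: order_trans[OF mult_left_le] simp: power_le_one)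
  then show ?thesis unfolding eq using d[of 3] by (simp add: abs_le_iff)
qed

text \<open>With coefficients in \<open>[0, 1)\<close> the derivative is at most 3 on the unit
  interval.\<close>

lemma grid_close:
  assumes c: "c \<in> Ik k" and t: "0 \<le> u" "u \<le> t" "t \<le> 1" "t \<le> u + 1 / 2 ^ k"
  shows "\<bar>qk k c t - qk k c u\<bar> \<le> 3 / 2 ^ k"
proof -
  have eq: "qk k c t - qk k c u = X1 k c * ((t - u) * (t + u)) + X2 k c * (t - u)"
    by (simp add: qk_def power2_eq_square algebra_simps)
  have "0 \<le> t - u" "t - u \<le> 1 / 2 ^ k" using t by auto
  moreover have "(t - u) * (t + u) \<le> 1 / 2 ^ k * 2" using t by (intro mult_mono) auto
  moreover have "0 \<le> (t - u) * (t + u)" using t by simp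
  moreover have "0 \<le> X1 k c" "X1 k c \<le> 1" "0 \<le> X2 k c" "X2 k c \<le> 1" using X_range[OF c] by auto
  ultimately have "0 \<le> X1 k c * ((t - u) * (t + u))" "X1 k c * ((t - u) * (t + u)) \<le> 1 / 2 ^ k * 2"
     "0 \<le> X2 k c * (t - u)" "X2 k c * (t - u) \<le> 1 / 2 ^ k"
    using mult_left_le_one_le[of "(t - u) * (t + u)" "X1 k c"] mult_left_le_one_le[of "t - u" "X2 k c"] by auto
  then show ?thesis unfolding eq by (simp add: abs_le_iff)
qed

end

context dyadic_frostman
begin

lemma sum_telescope_le: "(\<Sum>k\<in>{k0..n}. 1 / ((real k + 1) * (real k + 2))) \<le> 1"
proof -
  have "(\<Sum>k\<le>n. 1 / ((real k + 1) * (real k + 2))) = 1 - 1 / (real n + 2)"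
  proof (induction n)
    case (Suc n)
    have "1 / ((real (Suc n) + 1) * (real (Suc n) + 2)) = 1 / (real n + 2) - 1 / (real (Suc n) + 2)"
      by (simp add: field_simps)
    then show ?case by (simp only: sum.atMost_Suc Suc)
  qed simp
  moreover have "(\<Sum>k\<in>{k0..n}. 1 / ((real k + 1) * (real k + 2))) \<le> (\<Sum>k\<le>n. 1 / ((real k + 1) * (real k + 2)))"
    by (intro sum_mono2) auto
  moreover have "0 \<le> 1 / (real n + 2)" by simp
  ultimately show ?thesis by linarith
qed

text \<open>The mass is shared among intervals of scales \<open>k0\<close> to \<open>n\<close>, so
  some scale \<open>k\<close> receives at least \<open>mu0 / ((k + 1) * (k + 2))\<close>. At most
  \<open>2 powr (t0 * k)\<close> intervals have that scale, and \<open>mk k\<close> is chosen so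
  that the light cells they meet hold at most half of this mass; the rest is heavy.\<close>

lemma null_projection_in_Tk:
  assumes t: "0 \<le> t" "t < 1" and null: "hnull t0 (quad t ` K)"
  shows "\<exists>k\<ge>k0. \<exists>j\<in>Tk k. t \<in> {real j / 2 ^ k..real (Suc j) / 2 ^ k}"
proof -
  have t01: "t0 \<le> 1" using t0 s by simp
  obtain \<kappa> :: "nat \<Rightarrow> nat" and y where \<kappa>: "\<And>i. k0 \<le> \<kappa> i"
    and cov: "quad t ` K \<subseteq> (\<Union>i. {v. \<bar>v - y i\<bar> < 1 / 2 ^ \<kappa> i})"
    and small: "\<And>n. (\<Sum>i<n. (1 / 2 ^ \<kappa> i) powr t0) \<le> 1"
    using hnull_dyadic_cover[OF t0(1) t01 null, of k0] by blast
  define G where "G i = {x. \<bar>quad t x - y i\<bar> < 1 / 2 ^ \<kappa> i}" for i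
  have "open (G i)" for i
    unfolding G_def quad_def by (intro open_Collect_less continuous_intros)
  moreover have "K \<subseteq> (\<Union>i\<in>UNIV. G i)"
  proof
    fix x assume "x \<in> K"
    then obtain i where "\<bar>quad t x - y i\<bar> < 1 / 2 ^ \<kappa> i" using cov by blast
    then show "x \<in> (\<Union>i\<in>UNIV. G i)" by (auto simp: G_def)
  qed
  \<comment> \<open>With finitely many intervals there is a finest generation \<open>n\<close> at
    which all of the mass can be compared.\<close>
  ultimately obtain F where F: "finite F" "K \<subseteq> (\<Union>i\<in>F. G i)"
    using compactE_image[OF cpt, of UNIV G] by metis
  define n where "n = Max (insert k0 (\<kappa> ` F))"
  have n: "k0 \<le> n" "\<And>i. i \<in> F \<Longrightarrow> \<kappa> i \<le> n" using F(1) by (auto simp: n_def)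
  \<comment> \<open>Two indices are needed: the intervals of scale \<open>k\<close> are weighed at
    the common generation \<open>n\<close>, but their cells are counted at generation
    \<open>k\<close>. Ancestors of cubes in \<open>Q k n\<close> belong to \<open>Q k k\<close>,
    which links the two.\<close>
  define Q where "Q k l = {c\<in>Ik l. \<exists>i\<in>F. \<kappa> i = k \<and> (\<exists>x\<in>G i. code3 l x = c)}" for k l
  have finQ: "finite (Q k l)" for k l using fin_Ik by (simp add: Q_def)
  define a where "a k = (\<Sum>c\<in>Q k n. M n c)" for k
  have "mu0 \<le> (\<Sum>k\<in>{k0..n}. a k)"
  proof -
    have "mu0 = (\<Sum>c\<in>Ik n. M n c)" by (rule sum_Ik[symmetric])
    also have "\<dots> \<le> (\<Sum>c\<in>Ik n. \<Sum>k\<in>{k0..n}. if c \<in> Q k n then M n c else 0)"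
    proof (rule sum_mono)
      fix c assume c: "c \<in> Ik n"
      show "M n c \<le> (\<Sum>k\<in>{k0..n}. if c \<in> Q k n then M n c else 0)"
      proof (cases "M n c = 0")
        case False
        then have "0 < M n c" using M_ge[of n c] by simp
        then obtain x where x: "x \<in> K" "code3 n x = c" using M_hit by blast
        then obtain i where i: "i \<in> F" "x \<in> G i" using F(2) by blast
        have "c \<in> Q (\<kappa> i) n" using c i x by (auto simp: Q_def)
        then have "M n c = (if c \<in> Q (\<kappa> i) n then M n c else 0)" by simp
        also have "\<dots> \<le> (\<Sum>k\<in>{k0..n}. if c \<in> Q k n then M n c else 0)"
          using M_ge i n \<kappa> by (intro member_le_sum) auto
        finally show ?thesis .
      qed (auto intro: sum_nonneg)
    qed
    also have "\<dots> = (\<Sum>k\<in>{k0..n}. \<Sum>c\<in>Ik n. if c \<in> Q k n then M n c else 0)" by (rule sum.swap)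
    also have "\<dots> = (\<Sum>k\<in>{k0..n}. a k)"
    proof (rule sum.cong)
      fix k
      have "Q k n = {c\<in>Ik n. c \<in> Q k n}" by (auto simp: Q_def)
      then show "(\<Sum>c\<in>Ik n. if c \<in> Q k n then M n c else 0) = a k"
        unfolding a_def by (simp only: sum.inter_filter[OF fin_Ik, symmetric])
    qed simp
    finally show ?thesis .
  qed
  then have "\<exists>k\<in>{k0..n}. mu0 / ((real k + 1) * (real k + 2)) \<le> a k"
  proof (rule contrapos_pp)
    assume "\<not> (\<exists>k\<in>{k0..n}. mu0 / ((real k + 1) * (real k + 2)) \<le> a k)"
    then have "(\<Sum>k\<in>{k0..n}. a k) < (\<Sum>k\<in>{k0..n}. mu0 / ((real k + 1) * (real k + 2)))"
      using n(1) by (intro sum_strict_mono) (auto simp: not_le)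
    also have "\<dots> = mu0 * (\<Sum>k\<in>{k0..n}. 1 / ((real k + 1) * (real k + 2)))" by (simp add: sum_distrib_left)
    also have "\<dots> \<le> mu0 * 1" using M_pos by (intro mult_left_mono sum_telescope_le) auto
    finally show "\<not> mu0 \<le> (\<Sum>k\<in>{k0..n}. a k)" by simp
  qed
  then obtain k where k: "k0 \<le> k" "k \<le> n" and ak: "mu0 / ((real k + 1) * (real k + 2)) \<le> a k" by auto
  have "a k \<le> (\<Sum>d\<in>Q k k. M k d)"
  proof -
    have "a k \<le> (\<Sum>c\<in>(\<Union>d\<in>Q k k. {c. (par3 ^^ (n - k)) c = d}). M n c)"
      unfolding a_def
    proof (intro sum_mono2)
      show "Q k n \<subseteq> (\<Union>d\<in>Q k k. {c. (par3 ^^ (n - k)) c = d})"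
      proof
        fix c assume "c \<in> Q k n"
        then obtain i x where ix: "c \<in> Ik n" "i \<in> F" "\<kappa> i = k" "x \<in> G i" "code3 n x = c" by (auto simp: Q_def)
        have e: "(par3 ^^ (n - k)) c = code3 k x" using cube.code_le[OF k(2), of x] ix by simp
        have "(par3 ^^ k) (code3 k x) = (par3 ^^ (k + (n - k))) c" by (simp only: funpow_add o_apply e)
        also have "\<dots> = c0" using ix(1) k(2) by (simp add: Ik_def)
        finally have "code3 k x \<in> Q k k" using ix by (auto simp: Q_def Ik_def)
        then show "c \<in> (\<Union>d\<in>Q k k. {c. (par3 ^^ (n - k)) c = d})" using e by blast
      qed
    qed (use finQ finite_descendants M_ge in auto)
    also have "\<dots> = (\<Sum>d\<in>Q k k. \<Sum>c\<in>{c. (par3 ^^ (n - k)) c = d}. M n c)"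
      by (rule sum.UNION_disjoint) (use finQ finite_descendants in auto)
    also have "\<dots> = (\<Sum>d\<in>Q k k. M k d)"
      using M_descend[where i = "n - k" and n = k] k(2) by simp
    finally show ?thesis .
  qed
  then have Qmass: "mu0 / ((real k + 1) * (real k + 2)) \<le> (\<Sum>d\<in>Q k k. M k d)" using ak by linarith
  define Fk where "Fk = {i\<in>F. \<kappa> i = k}"
  have finFk: "finite Fk" using F(1) by (simp add: Fk_def)
  have cardFk: "real (card Fk) \<le> 2 powr (t0 * real k)"
  proof -
    obtain N where N: "Fk \<subseteq> {..<N}" using finFk finite_nat_iff_bounded by blast
    have "real (card Fk) * (1 / 2 ^ k) powr t0 = (\<Sum>i\<in>Fk. (1 / 2 ^ \<kappa> i) powr t0)" by (simp add: Fk_def)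
    also have "\<dots> \<le> (\<Sum>i<N. (1 / 2 ^ \<kappa> i) powr t0)" using N by (intro sum_mono2) auto
    also have "\<dots> \<le> 1" by (rule small)
    finally have "real (card Fk) * (1 / 2 ^ k) powr t0 \<le> 1" .
    moreover have "(1 / 2 ^ k) powr t0 = 1 / 2 powr (t0 * real k)"
      by (simp add: powr_realpow[symmetric] powr_divide powr_powr mult.commute)
    ultimately show ?thesis by (simp add: divide_le_eq)
  qed
  define j where "j = nat \<lfloor>2 ^ k * t\<rfloor>"
  define u where "u = real j / 2 ^ k"
  have j: "real j \<le> 2 ^ k * t" "2 ^ k * t < real j + 1" using t by (auto simp: j_def)
  have jlt: "j < 2 ^ k"
  proof -
    have "2 ^ k * t < 2 ^ k * 1" using t by (intro mult_strict_left_mono) auto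
    then have "real j < 2 ^ k" using j by linarith
    then show ?thesis by simp
  qed
  have u: "0 \<le> u" "u \<le> t" "t \<le> u + 1 / 2 ^ k" using j by (auto simp: u_def field_simps)
  define Y where "Y i = 2 ^ k * (y i - quad t (vector [real_of_int (fst c0), real_of_int (fst (snd c0)), real_of_int (snd (snd c0))]))" for i
  \<comment> \<open>In units of \<open>1 / 2 ^ k\<close> the errors are 1 for the interval, 3 for
    replacing a point by the corner of its cube and 3 for rounding \<open>t\<close> down to the
    grid. Their sum 7 becomes 8 after taking floors, hence 17 cells per interval.\<close>
  have cell: "\<exists>i\<in>Fk. cellk k d j \<in> {\<lfloor>Y i\<rfloor> - 8..\<lfloor>Y i\<rfloor> + 8}" if d: "d \<in> Q k k" for d
  proof -
    obtain i x where ix: "d \<in> Ik k" "i \<in> F" "\<kappa> i = k" "x \<in> G i" "code3 k x = d" using d by (auto simp: Q_def)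
    define p where "p = quad t (vector [real_of_int (fst c0), real_of_int (fst (snd c0)), real_of_int (snd (snd c0))])"
    define e where "e = 1 / (2::real) ^ k"
    have "\<bar>quad t x - y i\<bar> < e" using ix by (simp add: G_def e_def)
    moreover have "\<bar>(quad t x - p) - qk k d t\<bar> \<le> 3 * e"
      using corner_close[OF ix(5)] t by (simp add: p_def e_def)
    moreover have "\<bar>qk k d t - qk k d u\<bar> \<le> 3 * e"
      using grid_close[OF ix(1) u(1,2) _ u(3)] t by (simp add: e_def)
    ultimately have "\<bar>qk k d u - (y i - p)\<bar> < 7 * e" by linarith
    then have "2 ^ k * \<bar>qk k d u - (y i - p)\<bar> < 2 ^ k * (7 * e)" by (intro mult_strict_left_mono) auto
    then have "\<bar>2 ^ k * (qk k d u - (y i - p))\<bar> < 7" by (simp add: abs_mult e_def)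
    then have "\<bar>2 ^ k * qk k d u - Y i\<bar> < 7" by (simp add: Y_def p_def right_diff_distrib)
    then have "cellk k d j \<in> {\<lfloor>Y i\<rfloor> - 8..\<lfloor>Y i\<rfloor> + 8}"
      unfolding cellk_def u_def[symmetric] atLeastAtMost_iff by linarith
    moreover have "i \<in> Fk" using ix by (simp add: Fk_def)
    ultimately show ?thesis by blast
  qed
  define Z where "Z = (\<Union>i\<in>Fk. {\<lfloor>Y i\<rfloor> - 8..\<lfloor>Y i\<rfloor> + 8})"
  have finZ: "finite Z" using finFk by (simp add: Z_def)
  have cardZ: "real (card Z) \<le> 17 * 2 powr (t0 * real k)"
  proof -
    have "card Z \<le> (\<Sum>i\<in>Fk. card {\<lfloor>Y i\<rfloor> - 8..\<lfloor>Y i\<rfloor> + 8})" unfolding Z_def by (rule card_UN_le[OF finFk])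
    also have "\<dots> = 17 * card Fk" by simp
    finally have "real (card Z) \<le> 17 * real (card Fk)" by simp
    then show ?thesis using cardFk by linarith
  qed
  define light where "light d \<longleftrightarrow> \<not> mk k \<le> Nk k d j" for d
  have "(\<Sum>d\<in>{d\<in>Q k k. light d}. M k d) \<le> (\<Sum>d\<in>(\<Union>z\<in>Z. {d\<in>Ik k. cellk k d j = z \<and> light d}). M k d)"
  proof (intro sum_mono2)
    show "{d\<in>Q k k. light d} \<subseteq> (\<Union>z\<in>Z. {d\<in>Ik k. cellk k d j = z \<and> light d})"
      using cell by (auto simp: Z_def) (auto simp: Q_def)
  qed (use finZ fin_Ik M_ge in auto)
  also have "\<dots> = (\<Sum>z\<in>Z. \<Sum>d\<in>{d\<in>Ik k. cellk k d j = z \<and> light d}. M k d)"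
    by (rule sum.UNION_disjoint) (use finZ fin_Ik in auto)
  also have "\<dots> \<le> (\<Sum>z\<in>Z. mk k)"
  proof (rule sum_mono)
    fix z
    show "(\<Sum>d\<in>{d\<in>Ik k. cellk k d j = z \<and> light d}. M k d) \<le> mk k"
    proof (cases "{d\<in>Ik k. cellk k d j = z \<and> light d} = {}")
      case True
      then show ?thesis using mk_bounds(1)[of k] by (simp only: True) simp
    next
      case False
      then obtain d where d: "d \<in> Ik k" "cellk k d j = z" "light d" by blast
      have "(\<Sum>d\<in>{d\<in>Ik k. cellk k d j = z \<and> light d}. M k d) \<le> Nk k d j"
        unfolding Nk_def using d fin_Ik M_ge by (intro sum_mono2) auto
      then show ?thesis using d(3) by (simp add: light_def)
    qed
  qed
  also have "\<dots> = real (card Z) * mk k" by simp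
  also have "\<dots> \<le> (17 * 2 powr (t0 * real k)) * mk k"
    using cardZ mk_bounds(1)[of k] by (intro mult_right_mono) auto
  also have "\<dots> = mu0 / (2 * (real k + 1) * (real k + 2))"
  proof -
    have "2 powr (t0 * real k) * 2 powr (- t0 * real k) = 1" by (simp add: powr_minus field_simps)
    then have "(17 * 2 powr (t0 * real k)) * mk k = 17 * (mu0 / (34 * (real k + 1) * (real k + 2)))"
      unfolding mk_def by (simp add: field_simps)
    also have "17 * (a / (34 * x * y)) = a / (2 * x * y)" for a x y :: real
      by (simp add: divide_simps)
    finally show ?thesis .
  qed
  finally have lightmass: "(\<Sum>d\<in>{d\<in>Q k k. light d}. M k d) \<le> mu0 / (2 * (real k + 1) * (real k + 2))" .
  have "(\<Sum>d\<in>Q k k. M k d) = (\<Sum>d\<in>{d\<in>Q k k. light d}. M k d) + (\<Sum>d\<in>{d\<in>Q k k. \<not> light d}. M k d)"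
    using finQ by (subst sum.union_disjoint[symmetric]) (auto intro!: sum.cong)
  also have "(\<Sum>d\<in>{d\<in>Q k k. \<not> light d}. M k d) \<le> (\<Sum>c\<in>{c\<in>Ik k. mk k \<le> Nk k c j}. M k c)"
    using fin_Ik M_ge by (intro sum_mono2) (auto simp: Q_def light_def)
  finally have "mu0 / ((real k + 1) * (real k + 2)) - mu0 / (2 * (real k + 1) * (real k + 2))
      \<le> (\<Sum>c\<in>{c\<in>Ik k. mk k \<le> Nk k c j}. M k c)"
    using Qmass lightmass by linarith
  moreover have "z / (x * y) - z / (2 * x * y) = z / (2 * x * y)" for x y z :: real
    by (simp add: divide_simps)
  ultimately have "mu0 / (2 * (real k + 1) * (real k + 2)) \<le> (\<Sum>c\<in>{c\<in>Ik k. mk k \<le> Nk k c j}. M k c)"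
    by (simp only:)
  then have "j \<in> Tk k" using jlt by (simp add: Tk_def)
  moreover have "t \<in> {real j / 2 ^ k..real (Suc j) / 2 ^ k}"
    using u by (simp add: u_def add_divide_distrib)
  ultimately show ?thesis using k(1) by blast
qed

lemma hnull_exceptional:
  assumes "(1 + t0 / s) / 2 < v"
  shows "hnull v {t. 0 \<le> t \<and> t < 1 \<and> hnull t0 (quad t ` K)}"
proof (rule hnull_limsup[where S = "\<lambda>k j. {real j / 2 ^ k..real (Suc j) / 2 ^ k}" and J = Tk])
  have "0 < (1 + t0 / s) / 2" using t0 by (simp add: add_pos_pos)
  then show "0 < v" using assms by (rule less_trans)
  show "finite (Tk k)" for k by (rule finite_subset[of _ "{..<2 ^ k}"]) (auto simp: Tk_def)
  show "summable (\<lambda>k. real (card (Tk k)) * (1 / 2 ^ k) powr v)" by (rule summable_card_Tk[OF assms])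
  show "diameter {real j / 2 ^ k..real (Suc j) / 2 ^ k} \<le> 1 / 2 ^ k" for k j
    by (simp add: diff_divide_distrib[symmetric] divide_right_mono)
qed (use null_projection_in_Tk in auto)

end

theorem quad_exceptional_set:
  fixes K :: "(real ^ 3) set"
  assumes K: "analytic_set K" "\<not> hnull s K" and t0: "0 < t0" "t0 < s" and s: "s \<le> 1"
    and v: "(1 + t0 / s) / 2 < v"
  shows "hnull v {t. 0 \<le> t \<and> t < 1 \<and> hnull t0 (quad t ` K)}"
proof -
  have "0 < s" using t0 by simp
  then show ?thesis
  proof (rule analytic_frostman[OF _ K])
    fix K' c0 M
    assume H: "compact K'" "K' \<subseteq> K" "0 < M 0 c0" "\<And>n c. 0 \<le> M n c" "\<And>n c. M n c \<le> (1 / 2 ^ n) powr s"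
      "\<And>n c. M n c = (\<Sum>c'\<in>{c'. par3 c' = c}. M (Suc n) c')"
      "\<And>n c. 0 < M n c \<Longrightarrow> \<exists>x\<in>K'. code3 n x = c" "\<And>n c. M n c \<noteq> 0 \<Longrightarrow> (par3 ^^ n) c = c0"
    interpret dyadic_frostman K' c0 M s t0
    proof
      show "compact K'" "0 < M 0 c0" "s \<le> 1" "0 < t0" "t0 < s" by fact+
      show "0 \<le> M n c" "M n c \<le> (1 / 2 ^ n) powr s" for n c by (rule H)+
      show "M n c = (\<Sum>c'\<in>{c'. par3 c' = c}. M (Suc n) c')" for n c by (rule H)
      show "\<exists>x\<in>K'. code3 n x = c" if "0 < M n c" for n c using that by (rule H)
      show "(par3 ^^ n) c = c0" if "M n c \<noteq> 0" for n c using that by (rule H)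
    qed
    have "{t. 0 \<le> t \<and> t < 1 \<and> hnull t0 (quad t ` K)} \<subseteq> {t. 0 \<le> t \<and> t < 1 \<and> hnull t0 (quad t ` K')}"
      using hnull_subset[OF _ image_mono[OF H(2)]] by blast
    with hnull_exceptional[OF v] show "hnull v {t. 0 \<le> t \<and> t < 1 \<and> hnull t0 (quad t ` K)}" by (rule hnull_subset)
  qed
qed

section \<open>Projections along a circle\<close>

lemma analytic_continuous_image:
  assumes "continuous_on UNIV g" "analytic_set K"
  shows "analytic_set (g ` K)"
proof (cases "K = {}")
  case False
  then obtain f :: "(nat \<Rightarrow> nat) \<Rightarrow> 'a" where "continuous_on UNIV f" "K = range f"
    using assms(2) by (auto simp: analytic_set_def)
  then have "continuous_on UNIV (g \<circ> f)" "g ` K = range (g \<circ> f)"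
    using assms(1) continuous_on_compose2[of UNIV g UNIV f] by (auto simp: o_def)
  then show ?thesis by (auto simp: analytic_set_def)
qed (simp add: analytic_set_def)

lemma hausdorff_dim_lipschitz_le:
  assumes "\<And>x y. x \<in> A \<Longrightarrow> y \<in> A \<Longrightarrow> dist (f x) (f y) \<le> C * dist x y"
  shows "hausdorff_dim (f ` A) \<le> hausdorff_dim A"
  unfolding hausdorff_dim_def by (rule INF_superset_mono) (auto intro!: hnull_lipschitz_image assms)

lemma hausdorff_dim_proj_le:
  fixes K :: "'a::euclidean_space set"
  assumes "norm e = 1"
  shows "hausdorff_dim (proj e ` K) \<le> min (hausdorff_dim K) 1"
proof -
  have "dist (proj e x) (proj e y) \<le> 1 * dist x y" for x y
    using Cauchy_Schwarz_ineq2[of "x - y" e] assms by (simp add: proj_def dist_norm inner_diff_left)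
  then have "hausdorff_dim (proj e ` K) \<le> hausdorff_dim K" by (intro hausdorff_dim_lipschitz_le)
  moreover have "hausdorff_dim (proj e ` K) \<le> ereal 1"
    by (rule hausdorff_dim_le_if_null_above) (auto intro: hnull_real)
  ultimately show ?thesis by (simp add: one_ereal_def)
qed

lemma plane_orthonormal_frame:
  fixes V :: "(real ^ 3) set"
  assumes "affine V" "aff_dim V = 2" "0 \<notin> V"
  obtains c u v where "c \<noteq> 0" "norm u = 1" "norm v = 1" "u \<bullet> v = 0" "c \<bullet> u = 0" "c \<bullet> v = 0"
    "\<And>e. e \<in> V \<Longrightarrow> \<exists>\<alpha> \<beta>. e = c + \<alpha> *\<^sub>R u + \<beta> *\<^sub>R v"
proof -
  have "V \<noteq> {}" using assms(2) by auto
  then obtain a where a: "a \<in> V" by blast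
  define S where "S = (+) (- a) ` V"
  have "subspace S" unfolding S_def using affine_diffs_subspace[OF assms(1) a] by simp
  moreover have dim: "dim S = 2"
    using aff_dim_eq_dim[of a V] assms(1,2) a by (simp add: S_def hull_same)
  ultimately obtain B where B: "B \<subseteq> S" "pairwise orthogonal B" "\<And>x. x \<in> B \<Longrightarrow> norm x = 1"
     "independent B" "card B = dim S" "span B = S"
    using orthonormal_basis_subspace by metis
  then obtain u v where uv: "B = {u, v}" "u \<noteq> v" using dim by (auto simp: card_2_iff)
  have o: "u \<bullet> v = 0" using B(2) uv by (auto simp: pairwise_def orthogonal_def)
  have n: "norm u = 1" "norm v = 1" using B(3) uv by auto
  then have nn: "u \<bullet> u = 1" "v \<bullet> v = 1" by (simp_all add: norm_eq_1)
  \<comment> \<open>The foot of the perpendicular from the origin to \<open>V\<close>, which is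
    nonzero because \<open>0 \<notin> V\<close>.\<close>
  define c where "c = a - (a \<bullet> u) *\<^sub>R u - (a \<bullet> v) *\<^sub>R v"
  have sp: "\<exists>p q. x = p *\<^sub>R u + q *\<^sub>R v" if "x \<in> S" for x
  proof -
    have "x \<in> span {u, v}" using that B(6) uv by simp
    then show ?thesis by (auto simp: span_insert span_singleton algebra_simps)
  qed
  have "c - a \<in> span {u, v}"
  proof -
    have "c - a = - (a \<bullet> u) *\<^sub>R u + - (a \<bullet> v) *\<^sub>R v" by (simp add: c_def)
    then show ?thesis by (simp only:) (intro span_add span_scale span_base; simp)
  qed
  then have "c - a \<in> S" using B(6) uv by simp
  then have "c \<in> V" by (auto simp: S_def)
  then have "c \<noteq> 0" using assms(3) by auto
  moreover have "c \<bullet> u = 0" "c \<bullet> v = 0" using o nn inner_commute[of v u] by (simp_all add: c_def inner_diff_left)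
  moreover have "\<exists>\<alpha> \<beta>. e = c + \<alpha> *\<^sub>R u + \<beta> *\<^sub>R v" if "e \<in> V" for e
  proof -
    have "- a + e \<in> S" using that by (auto simp: S_def)
    then obtain p q where "- a + e = p *\<^sub>R u + q *\<^sub>R v" using sp by blast
    then have "e = a + (p *\<^sub>R u + q *\<^sub>R v)" by (metis add.commute add_minus_cancel minus_add_cancel)
    then have "e = c + (p + a \<bullet> u) *\<^sub>R u + (q + a \<bullet> v) *\<^sub>R v"
      by (simp add: c_def algebra_simps)
    then show ?thesis by blast
  qed
  ultimately show thesis using that n o by blast
qed

text \<open>Stereographic projection from the point with \<open>\<alpha> = - R\<close>;
  \<open>t\<close> is the tangent of half the angle.\<close>

lemma rational_circle_point:
  fixes \<alpha> \<beta> R :: real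
  assumes "0 < R" "\<alpha>\<^sup>2 + \<beta>\<^sup>2 = R\<^sup>2" "\<alpha> \<noteq> - R"
  defines "t \<equiv> \<beta> / (R + \<alpha>)"
  shows "\<alpha> = R * (2 / (1 + t\<^sup>2) - 1)" "\<beta> = 2 * R * (t / (1 + t\<^sup>2))"
proof -
  have ne: "R + \<alpha> \<noteq> 0" using assms(3) by auto
  have "(1 + t\<^sup>2) * (R + \<alpha>)\<^sup>2 = (R + \<alpha>)\<^sup>2 + \<beta>\<^sup>2"
    using ne by (simp add: t_def power_divide distrib_right)
  also have "\<dots> = 2 * R * (R + \<alpha>)" using assms(2) by (simp add: power2_eq_square algebra_simps)
  finally have "((1 + t\<^sup>2) * (R + \<alpha>)) * (R + \<alpha>) = (2 * R) * (R + \<alpha>)" by (simp add: power2_eq_square mult_ac)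
  then have eq: "(1 + t\<^sup>2) * (R + \<alpha>) = 2 * R" using ne by simp
  have pos: "0 < 1 + t\<^sup>2" by (simp add: add_pos_nonneg)
  have "R + \<alpha> = 2 * R / (1 + t\<^sup>2)" using eq pos by (simp add: field_simps)
  then show "\<alpha> = R * (2 / (1 + t\<^sup>2) - 1)" by (simp add: algebra_simps)
  have "\<beta> = t * (R + \<alpha>)" using ne by (simp add: t_def)
  also have "\<dots> = t * (2 * R / (1 + t\<^sup>2))" using \<open>R + \<alpha> = 2 * R / (1 + t\<^sup>2)\<close> by simp
  finally show "\<beta> = 2 * R * (t / (1 + t\<^sup>2))" by simp
qed

lemma abs_le_one_plus_square: "\<bar>t\<bar> \<le> (1 + t\<^sup>2) / 2" for t :: real
  using zero_le_power2[of "\<bar>t\<bar> - 1"] by (simp add: power2_eq_square algebra_simps)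

lemma rational_circle_lipschitz:
  fixes t u :: real
  shows "\<bar>1 / (1 + t\<^sup>2) - 1 / (1 + u\<^sup>2)\<bar> \<le> \<bar>t - u\<bar>" "\<bar>t / (1 + t\<^sup>2) - u / (1 + u\<^sup>2)\<bar> \<le> \<bar>t - u\<bar>"
proof -
  have pos: "0 < 1 + t\<^sup>2" "0 < 1 + u\<^sup>2" by (simp_all add: add_pos_nonneg)
  have one: "1 + t\<^sup>2 \<le> (1 + t\<^sup>2) * (1 + u\<^sup>2)" "1 + u\<^sup>2 \<le> (1 + t\<^sup>2) * (1 + u\<^sup>2)"
    by (simp_all add: algebra_simps)
  have "\<bar>u + t\<bar> \<le> (1 + t\<^sup>2) * (1 + u\<^sup>2)"
  proof -
    have "\<bar>u + t\<bar> \<le> (1 + u\<^sup>2) / 2 + (1 + t\<^sup>2) / 2"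
      using abs_le_one_plus_square[of t] abs_le_one_plus_square[of u] abs_triangle_ineq[of u t] by linarith
    also have "\<dots> \<le> (1 + t\<^sup>2) * (1 + u\<^sup>2) / 2 + (1 + t\<^sup>2) * (1 + u\<^sup>2) / 2"
      using one by (intro add_mono divide_right_mono) auto
    finally show ?thesis by simp
  qed
  then have "\<bar>u - t\<bar> * \<bar>u + t\<bar> / ((1 + t\<^sup>2) * (1 + u\<^sup>2)) \<le> \<bar>u - t\<bar>"
    using pos by (simp add: divide_le_eq mult_left_mono)
  moreover have "1 / (1 + t\<^sup>2) - 1 / (1 + u\<^sup>2) = (u - t) * (u + t) / ((1 + t\<^sup>2) * (1 + u\<^sup>2))"
    using pos by (simp add: divide_simps) (simp add: power2_eq_square algebra_simps)
  ultimately show "\<bar>1 / (1 + t\<^sup>2) - 1 / (1 + u\<^sup>2)\<bar> \<le> \<bar>t - u\<bar>"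
    using pos by (simp add: abs_mult abs_minus_commute)
  have "\<bar>1 - t * u\<bar> \<le> (1 + t\<^sup>2) * (1 + u\<^sup>2)"
  proof -
    have "2 * (\<bar>t\<bar> * \<bar>u\<bar>) \<le> t\<^sup>2 + u\<^sup>2"
      using zero_le_power2[of "\<bar>t\<bar> - \<bar>u\<bar>"] by (simp add: power2_eq_square algebra_simps)
    moreover have "0 \<le> \<bar>t\<bar> * \<bar>u\<bar>" by simp
    ultimately have "\<bar>t\<bar> * \<bar>u\<bar> \<le> t\<^sup>2 + u\<^sup>2" by linarith
    moreover have "\<bar>1 - t * u\<bar> \<le> 1 + \<bar>t\<bar> * \<bar>u\<bar>" using abs_triangle_ineq4[of 1 "t * u"] by (simp add: abs_mult)
    ultimately have "\<bar>1 - t * u\<bar> \<le> 1 + t\<^sup>2 + u\<^sup>2" by linarith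
    also have "\<dots> \<le> (1 + t\<^sup>2) * (1 + u\<^sup>2)" by (simp add: algebra_simps)
    finally show ?thesis .
  qed
  then have "\<bar>t - u\<bar> * \<bar>1 - t * u\<bar> / ((1 + t\<^sup>2) * (1 + u\<^sup>2)) \<le> \<bar>t - u\<bar>"
    using pos by (simp add: divide_le_eq mult_left_mono)
  moreover have "t / (1 + t\<^sup>2) - u / (1 + u\<^sup>2) = (t - u) * (1 - t * u) / ((1 + t\<^sup>2) * (1 + u\<^sup>2))"
    using pos by (simp add: divide_simps) (simp add: power2_eq_square algebra_simps)
  ultimately show "\<bar>t / (1 + t\<^sup>2) - u / (1 + u\<^sup>2)\<bar> \<le> \<bar>t - u\<bar>"
    using pos by (simp add: abs_mult)
qed

text \<open>In the rational parameter the projections become, up to a nonvanishing factor, the values of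
  the quadratic polynomials whose coefficients are the coordinates of a linear image of the point.\<close>

definition frame_coords :: "real ^ 3 \<Rightarrow> real ^ 3 \<Rightarrow> real ^ 3 \<Rightarrow> real \<Rightarrow> real \<Rightarrow> real ^ 3 \<Rightarrow> real ^ 3" where
  "frame_coords c u v R n x = (let y1 = c \<bullet> x - R * (u \<bullet> x); y2 = 2 * R * (v \<bullet> x); y3 = c \<bullet> x + R * (u \<bullet> x) in
     vector [y1, y2 + 2 * n * y1, y3 + n * y2 + n\<^sup>2 * y1])"

lemma linear_frame_coords: "linear (frame_coords c u v R n)"
  by (rule linearI) (simp_all add: frame_coords_def Let_def vec_eq_iff forall_3 vector_3 inner_add_right algebra_simps)

text \<open>A vector in the kernel is orthogonal to the three nonzero, pairwise orthogonal vectors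
  \<open>c\<close>, \<open>u\<close>, \<open>v\<close>, so it vanishes in dimension 3. Here
  \<open>c \<noteq> 0\<close> is essential: a great circle sees only two of the three
  dimensions.\<close>

lemma inj_frame_coords:
  assumes "c \<noteq> 0" "norm u = 1" "norm v = 1" "u \<bullet> v = 0" "c \<bullet> u = 0" "c \<bullet> v = 0" "0 < R"
  shows "inj (frame_coords c u v R n)"
proof -
  have "x = 0" if "frame_coords c u v R n x = 0" for x
  proof (rule ccontr)
    assume "x \<noteq> 0"
    have z: "frame_coords c u v R n x $ 1 = 0" "frame_coords c u v R n x $ 2 = 0" "frame_coords c u v R n x $ 3 = 0"
      using that by simp_all
    have "c \<bullet> x - R * (u \<bullet> x) = 0" using z(1) by (simp add: frame_coords_def Let_def vector_3)
    moreover from this have "R * (v \<bullet> x) = 0" using z(2) by (simp add: frame_coords_def Let_def vector_3)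
    ultimately have o: "c \<bullet> x = 0" "u \<bullet> x = 0" "v \<bullet> x = 0"
      using z(3) assms(7) by (auto simp: frame_coords_def Let_def vector_3)
    have ne: "u \<noteq> 0" "v \<noteq> 0" using assms by auto
    have self: "y \<bullet> z = 0 \<Longrightarrow> y \<noteq> 0 \<Longrightarrow> y \<noteq> z" for y z :: "real ^ 3" by auto
    have "pairwise orthogonal {x, c, u, v}"
      using o assms(4-6) by (auto simp: pairwise_def orthogonal_def inner_commute)
    moreover have "0 \<notin> {x, c, u, v}" using \<open>x \<noteq> 0\<close> assms(1) ne by auto
    ultimately have "independent {x, c, u, v}" by (rule pairwise_orthogonal_independent)
    then have "card {x, c, u, v} \<le> DIM(real ^ 3)" using independent_bound by blast
    moreover have "card {x, c, u, v} = 4"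
      using self[of c x] self[of u x] self[of v x] self[of c u] self[of c v] self[of u v] o assms ne by auto
    ultimately show False by simp
  qed
  then show ?thesis using linear_injective_0[OF linear_frame_coords] by blast
qed

text \<open>The shift by \<open>n\<close> is a change of variable carried out on the coefficients,
  so that each unit interval of circle parameters is reduced to \<open>[0, 1)\<close>.\<close>

lemma quad_frame_coords:
  assumes e: "e = c + (R * (2 / (1 + (t + n)\<^sup>2) - 1)) *\<^sub>R u + (2 * R * ((t + n) / (1 + (t + n)\<^sup>2))) *\<^sub>R v"
  shows "quad t (frame_coords c u v R n x) = (1 + (t + n)\<^sup>2) * proj e x"
proof -
  define w where "w = t + n"
  have pos: "1 + w\<^sup>2 \<noteq> 0" using zero_le_power2[of w] by linarith
  have "(1 + w\<^sup>2) * proj e x = (1 + w\<^sup>2) * (c \<bullet> x) + ((1 + w\<^sup>2) * (2 / (1 + w\<^sup>2)) - (1 + w\<^sup>2)) * R * (u \<bullet> x)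
      + 2 * R * ((1 + w\<^sup>2) * (w / (1 + w\<^sup>2))) * (v \<bullet> x)"
    unfolding e proj_def w_def[symmetric] by (simp add: inner_add_right inner_commute algebra_simps)
  also have "\<dots> = (1 + w\<^sup>2) * (c \<bullet> x) + (1 - w\<^sup>2) * R * (u \<bullet> x) + 2 * R * w * (v \<bullet> x)"
  proof -
    have cancel: "p * (y / p) = y" if "p \<noteq> 0" for p y :: real using that by simp
    show ?thesis unfolding cancel[OF pos] by simp
  qed
  also have "\<dots> = quad t (frame_coords c u v R n x)"
    by (simp add: w_def quad_def frame_coords_def Let_def vector_3 power2_eq_square algebra_simps)
  finally show ?thesis by (simp add: w_def)
qed

lemma circle_exceptional_set:
  fixes V K :: "(real ^ 3) set"
  assumes V: "affine V" "aff_dim V = 2" "0 \<notin> V"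
    and K: "analytic_set K" "\<not> hnull s K" and t0: "0 < t0" "t0 < s" and s: "s \<le> 1"
    and w: "(1 + t0 / s) / 2 < w"
  shows "hnull w {e \<in> sphere 0 1 \<inter> V. hausdorff_dim (proj e ` K) < ereal t0}"
proof -
  obtain c u v where fr: "c \<noteq> 0" "norm u = 1" "norm v = 1" "u \<bullet> v = 0" "c \<bullet> u = 0" "c \<bullet> v = 0"
    and repr: "\<And>e. e \<in> V \<Longrightarrow> \<exists>\<alpha> \<beta>. e = c + \<alpha> *\<^sub>R u + \<beta> *\<^sub>R v"
    using plane_orthonormal_frame[OF V] by metis
  have "0 < (1 + t0 / s) / 2" using t0 by (simp add: add_pos_pos)
  then have w0: "0 < w" using w by (rule less_trans)
  have nrm: "(norm (c + \<alpha> *\<^sub>R u + \<beta> *\<^sub>R v))\<^sup>2 = (norm c)\<^sup>2 + \<alpha>\<^sup>2 + \<beta>\<^sup>2" for \<alpha> \<beta>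
    using fr inner_commute[of u c] inner_commute[of v c] inner_commute[of v u]
    unfolding power2_norm_eq_inner by (simp add: inner_add_left inner_add_right norm_eq_1 power2_eq_square)
  show ?thesis
  proof (cases "(norm c)\<^sup>2 < 1")
    case False
    \<comment> \<open>Here the plane misses the sphere or touches it at \<open>c\<close>, and a
      single point is null for positive exponents.\<close>
    have "{e \<in> sphere 0 1 \<inter> V. hausdorff_dim (proj e ` K) < ereal t0} \<subseteq> {c}"
    proof
      fix e assume "e \<in> {e \<in> sphere 0 1 \<inter> V. hausdorff_dim (proj e ` K) < ereal t0}"
      then have "e \<in> V" "norm e = 1" by auto
      then obtain \<alpha> \<beta> where e: "norm e = 1" "e = c + \<alpha> *\<^sub>R u + \<beta> *\<^sub>R v" using repr by blast
      then have "(norm c)\<^sup>2 + \<alpha>\<^sup>2 + \<beta>\<^sup>2 = 1" using nrm[of \<alpha> \<beta>] by simp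
      then have "\<alpha>\<^sup>2 = 0" "\<beta>\<^sup>2 = 0" using False zero_le_power2[of \<alpha>] zero_le_power2[of \<beta>] by linarith+
      then show "e \<in> {c}" using e by simp
    qed
    with hnull_singleton[OF w0] show ?thesis by (rule hnull_subset)
  next
    case True
    define R where "R = sqrt (1 - (norm c)\<^sup>2)"
    have R: "0 < R" "R\<^sup>2 = 1 - (norm c)\<^sup>2" using True by (simp_all add: R_def)
    define \<phi> where "\<phi> t = c + (R * (2 / (1 + t\<^sup>2) - 1)) *\<^sub>R u + (2 * R * (t / (1 + t\<^sup>2))) *\<^sub>R v" for t
    define L where "L n = frame_coords c u v R (real_of_int n)" for n
    define Bad where "Bad n = {t. 0 \<le> t \<and> t < 1 \<and> hnull t0 (quad t ` L n ` K)}" for n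
    have lip: "dist (\<phi> (t + a)) (\<phi> (t' + a)) \<le> (4 * R) * dist t t'" for t t' a
    proof -
      define A where "A x = 1 / (1 + x\<^sup>2)" for x :: real
      define B where "B x = x / (1 + x\<^sup>2)" for x :: real
      let ?t = "t + a" and ?t' = "t' + a"
      have \<phi>AB: "\<phi> x = c + (R * (2 * A x - 1)) *\<^sub>R u + (2 * R * B x) *\<^sub>R v" for x
        by (simp add: \<phi>_def A_def B_def)
      have AB: "\<bar>A ?t - A ?t'\<bar> \<le> \<bar>t - t'\<bar>" "\<bar>B ?t - B ?t'\<bar> \<le> \<bar>t - t'\<bar>"
        using rational_circle_lipschitz[of ?t ?t'] by (simp_all add: A_def B_def)
      have "\<phi> ?t - \<phi> ?t' = (2 * R * (A ?t - A ?t')) *\<^sub>R u + (2 * R * (B ?t - B ?t')) *\<^sub>R v"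
        unfolding \<phi>AB by (simp add: algebra_simps)
      then have "norm (\<phi> ?t - \<phi> ?t') \<le> norm ((2 * R * (A ?t - A ?t')) *\<^sub>R u) + norm ((2 * R * (B ?t - B ?t')) *\<^sub>R v)"
        by (simp only: norm_triangle_ineq)
      also have "\<dots> = 2 * R * \<bar>A ?t - A ?t'\<bar> + 2 * R * \<bar>B ?t - B ?t'\<bar>"
        using R fr by (simp add: abs_mult)
      also have "\<dots> \<le> 2 * R * \<bar>t - t'\<bar> + 2 * R * \<bar>t - t'\<bar>"
        using R by (intro add_mono mult_left_mono AB) auto
      finally show ?thesis by (simp add: dist_norm)
    qed
    have bad: "hnull w (Bad n)" for n
    proof -
      have an: "analytic_set (L n ` K)"
        using linear_continuous_on[OF linear_conv_bounded_linear[THEN iffD1, OF linear_frame_coords]] K(1)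
        unfolding L_def by (intro analytic_continuous_image)
      obtain b where b: "0 < b" "\<And>x. b * norm x \<le> norm (L n x)"
        using linear_inj_bounded_below_pos[OF linear_frame_coords inj_frame_coords[OF fr R(1)]] unfolding L_def by metis
      have "\<not> hnull s (L n ` K)"
      proof
        assume "hnull s (L n ` K)"
        then have "hnull s (inv (L n) ` (L n ` K))"
        proof (rule hnull_lipschitz_image[rotated])
          show "0 \<le> s" using t0 by simp
          fix x y assume "x \<in> L n ` K" "y \<in> L n ` K"
          then obtain x' y' where xy: "x = L n x'" "y = L n y'" by blast
          have iv: "inv (L n) (L n z) = z" for z
            unfolding L_def by (rule inv_f_f[OF inj_frame_coords[OF fr R(1)]])
          have "b * norm (x' - y') \<le> norm (L n (x' - y'))" by (rule b)
          also have "L n (x' - y') = x - y" unfolding xy L_def by (rule linear_diff[OF linear_frame_coords])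
          finally show "dist (inv (L n) x) (inv (L n) y) \<le> (1 / b) * dist x y"
            using b(1) by (simp add: xy iv dist_norm field_simps)
        qed
        moreover have "inv (L n) ` (L n ` K) = K"
          unfolding L_def using inj_frame_coords[OF fr R(1)] by (simp add: image_inv_f_f)
        ultimately show False using K(2) by simp
      qed
      then show ?thesis unfolding Bad_def by (rule quad_exceptional_set[OF an _ t0 s w])
    qed
    \<comment> \<open>The singleton is the centre of the stereographic projection, which no
      parameter reaches; countably many unit intervals of parameters give the rest of the
      circle.\<close>
    have "hnull w ({c + (- R) *\<^sub>R u} \<union> (\<Union>n\<in>(UNIV::int set). (\<lambda>t. \<phi> (t + real_of_int n)) ` Bad n))"
      using w0 by (intro hnull_Un hnull_singleton hnull_UN hnull_lipschitz_image[OF _ bad lip]) auto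
    moreover have "{e \<in> sphere 0 1 \<inter> V. hausdorff_dim (proj e ` K) < ereal t0}
       \<subseteq> {c + (- R) *\<^sub>R u} \<union> (\<Union>n\<in>(UNIV::int set). (\<lambda>t. \<phi> (t + real_of_int n)) ` Bad n)"
    proof
      fix e assume "e \<in> {e \<in> sphere 0 1 \<inter> V. hausdorff_dim (proj e ` K) < ereal t0}"
      then have "e \<in> V" "norm e = 1" and dim: "hausdorff_dim (proj e ` K) < ereal t0" by auto
      then obtain \<alpha> \<beta> where e: "norm e = 1" "e = c + \<alpha> *\<^sub>R u + \<beta> *\<^sub>R v" using repr by blast
      have sq: "\<alpha>\<^sup>2 + \<beta>\<^sup>2 = R\<^sup>2" using nrm[of \<alpha> \<beta>] e R by simp
      show "e \<in> {c + (- R) *\<^sub>R u} \<union> (\<Union>n\<in>(UNIV::int set). (\<lambda>t. \<phi> (t + real_of_int n)) ` Bad n)"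
      proof (cases "\<alpha> = - R")
        case True
        then have "\<beta> = 0" using sq by simp
        then show ?thesis using e True by simp
      next
        case False
        define a where "a = \<beta> / (R + \<alpha>)"
        define n where "n = \<lfloor>a\<rfloor>"
        define t where "t = a - real_of_int n"
        have t: "0 \<le> t" "t < 1" unfolding t_def n_def by linarith+
        have ea: "e = \<phi> (t + real_of_int n)"
          using rational_circle_point[OF R(1) sq False] e(2) unfolding \<phi>_def t_def a_def[symmetric] by simp
        have "hnull t0 ((\<lambda>y. (1 + (t + real_of_int n)\<^sup>2) * y) ` (proj e ` K))"
        proof (rule hnull_lipschitz_image[OF _ hnull_of_dim_less[OF dim]])
          show "0 \<le> t0" using t0 by simp
          show "dist ((1 + (t + real_of_int n)\<^sup>2) * x) ((1 + (t + real_of_int n)\<^sup>2) * y) \<le> (1 + (t + real_of_int n)\<^sup>2) * dist x y" for x y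
            by (simp add: dist_real_def abs_mult flip: right_diff_distrib)
        qed
        moreover have "(\<lambda>y. (1 + (t + real_of_int n)\<^sup>2) * y) ` (proj e ` K) = quad t ` L n ` K"
          unfolding L_def image_image using quad_frame_coords[OF ea[unfolded \<phi>_def]] by simp
        ultimately have "t \<in> Bad n" using t by (simp add: Bad_def)
        then show ?thesis using ea by blast
      qed
    qed
    ultimately show ?thesis by (rule hnull_subset)
  qed
qed

theorem mainTheorem3:
  fixes V K :: "(real ^ 3) set"
  assumes "affine V" and "aff_dim V = 2" and "0 \<notin> V"
    and "nondegenerate_circle (V \<inter> sphere 0 1)"
    and "analytic_set K"
  shows "hausdorff_ae 1 (sphere 0 1 \<inter> V)
           (\<lambda>e. hausdorff_dim (proj e ` K) = min (hausdorff_dim K) 1)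
    \<and> (\<forall>t::real. 0 < hausdorff_dim K \<and> hausdorff_dim K \<le> 1 \<and> 0 \<le> t \<and> ereal t < hausdorff_dim K \<longrightarrow>
          (\<exists>E \<subseteq> sphere 0 1 \<inter> V.
             hausdorff_dim E \<le> (hausdorff_dim K + ereal t) / (2 * hausdorff_dim K) \<and>
             (hausdorff_dim K + ereal t) / (2 * hausdorff_dim K) < 1 \<and>
             (\<forall>e \<in> (sphere 0 1 \<inter> V) - E. ereal t \<le> hausdorff_dim (proj e ` K))))"
proof (intro conjI allI impI)
  let ?C = "sphere 0 1 \<inter> V"
  have not_null: "\<not> hnull s K" if "ereal s < hausdorff_dim K" "0 \<le> s" for s
    using hausdorff_dim_le[of s K] that by auto
  show "hausdorff_ae 1 ?C (\<lambda>e. hausdorff_dim (proj e ` K) = min (hausdorff_dim K) 1)"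
    unfolding hausdorff_ae_def
  proof (rule hnull_subset)
    \<comment> \<open>Rational thresholds reduce the failure of equality to countably many null
      sets. Each leaves room for an \<open>s\<close> with \<open>q < s\<close>, and then
      \<open>(1 + q / s) / 2 < 1\<close>, so exponent 1 is admissible.\<close>
    let ?T = "{q \<in> \<rat>. 0 < q \<and> ereal q < min (hausdorff_dim K) 1}"
    show "{e \<in> ?C. hausdorff_dim (proj e ` K) \<noteq> min (hausdorff_dim K) 1}
       \<subseteq> (\<Union>q\<in>?T. {e \<in> ?C. hausdorff_dim (proj e ` K) < ereal q})"
    proof
      fix e assume e: "e \<in> {e \<in> ?C. hausdorff_dim (proj e ` K) \<noteq> min (hausdorff_dim K) 1}"
      then have "hausdorff_dim (proj e ` K) < min (hausdorff_dim K) 1"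
        using hausdorff_dim_proj_le[of e K] by (auto simp: order_less_le)
      then obtain r1 where r1: "hausdorff_dim (proj e ` K) < ereal r1" "ereal r1 < min (hausdorff_dim K) 1"
        using ereal_dense2 by blast
      then obtain r2 where r2: "ereal r1 < ereal r2" "ereal r2 < min (hausdorff_dim K) 1"
        using ereal_dense2 by blast
      then obtain q where q: "q \<in> \<rat>" "r1 < q" "q < r2" using Rats_dense_in_real[of r1 r2] by auto
      have "hausdorff_dim (proj e ` K) < ereal q" using r1(1) q(2) by (meson ereal_less_eq(3) less_imp_le less_le_trans)
      moreover have "ereal q < min (hausdorff_dim K) 1" using r2(2) q(3) by (meson ereal_less(2) less_ereal.simps(1) less_trans)
      moreover have "0 < q"
        using calculation(1) hausdorff_dim_nonneg[of "proj e ` K"] by (metis ereal_less(2) le_less_trans)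
      ultimately show "e \<in> (\<Union>q\<in>?T. {e \<in> ?C. hausdorff_dim (proj e ` K) < ereal q})" using e q by blast
    qed
    show "hnull 1 (\<Union>q\<in>?T. {e \<in> ?C. hausdorff_dim (proj e ` K) < ereal q})"
    proof (rule hnull_UN)
      show "countable ?T" by (rule countable_subset[OF _ countable_rat]) auto
      fix q assume q: "q \<in> ?T"
      then obtain s where s: "ereal q < ereal s" "ereal s < min (hausdorff_dim K) 1" using ereal_dense2 by blast
      have s1: "s \<le> 1" using s(2) by (simp add: one_ereal_def)
      have sK: "ereal s < hausdorff_dim K" using s(2) by simp
      have qs: "0 < q" "q < s" using q s(1) by auto
      have "(1 + q / s) / 2 < 1" using qs by simp
      then show "hnull 1 {e \<in> ?C. hausdorff_dim (proj e ` K) < ereal q}"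
        using circle_exceptional_set[OF assms(1-3,5) not_null[OF sK] qs s1] qs by simp
    qed
  qed
next
  fix t :: real
  let ?C = "sphere 0 1 \<inter> V"
  assume H: "0 < hausdorff_dim K \<and> hausdorff_dim K \<le> 1 \<and> 0 \<le> t \<and> ereal t < hausdorff_dim K"
  then obtain d where d: "hausdorff_dim K = ereal d" by (cases "hausdorff_dim K") auto
  then have dt: "0 < d" "d \<le> 1" "0 \<le> t" "t < d" using H by (auto simp: one_ereal_def)
  define E where "E = {e \<in> ?C. hausdorff_dim (proj e ` K) < ereal t}"
  have not_null: "\<not> hnull s K" if "s < d" "0 \<le> s" for s
    using hausdorff_dim_le[of s K] that d by auto
  have "hnull w E" if w: "(d + t) / (2 * d) < w" for w
  proof (cases "t = 0")
    case True
    then have "E = {}" using hausdorff_dim_nonneg by (auto simp: E_def not_less zero_ereal_def[symmetric])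
    then show ?thesis by (simp add: hnull_empty)
  next
    case False
    then have t0: "0 < t" using dt by simp
    have w': "d + t < w * (2 * d)" using w dt by (simp add: divide_less_eq)
    have w2: "0 < 2 * w - 1"
    proof -
      have "0 < d * (2 * w - 1)" using w' t0 by (simp add: algebra_simps)
      then show ?thesis using dt(1) by (simp add: zero_less_mult_iff)
    qed
    \<comment> \<open>\<open>K\<close> may be null at its own dimension \<open>d\<close>, so some
      \<open>s < d\<close> has to be used. The condition \<open>(1 + t / s) / 2 < w\<close> reads
      \<open>t / (2 * w - 1) < s\<close>, and \<open>(d + t) / (2 * d) < w\<close> is what leaves
      room for such an \<open>s\<close>.\<close>
    have "t / (2 * w - 1) < d" using w' w2 by (simp add: divide_less_eq algebra_simps)
    then have "max t (t / (2 * w - 1)) < d" using dt by simp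
    then obtain s where s: "max t (t / (2 * w - 1)) < s" "s < d" using dense by blast
    have ts: "t < s" and "t / (2 * w - 1) < s" using s by auto
    then have "t < s * (2 * w - 1)" using w2 by (simp add: divide_less_eq)
    then have "t / s < 2 * w - 1" using ts t0 by (simp add: divide_less_eq mult.commute)
    then have "(1 + t / s) / 2 < w" by simp
    then show ?thesis
      using circle_exceptional_set[OF assms(1-3,5) not_null[of s] t0 ts] s ts t0 dt unfolding E_def by simp
  qed
  then have "hausdorff_dim E \<le> ereal ((d + t) / (2 * d))"
    using dt by (intro hausdorff_dim_le_if_null_above) auto
  moreover have eq: "(hausdorff_dim K + ereal t) / (2 * hausdorff_dim K) = ereal ((d + t) / (2 * d))"
    using dt by (simp add: d)
  moreover have "(d + t) / (2 * d) < 1" using dt by simp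
  ultimately show "\<exists>E \<subseteq> ?C.
             hausdorff_dim E \<le> (hausdorff_dim K + ereal t) / (2 * hausdorff_dim K) \<and>
             (hausdorff_dim K + ereal t) / (2 * hausdorff_dim K) < 1 \<and>
             (\<forall>e \<in> ?C - E. ereal t \<le> hausdorff_dim (proj e ` K))"
    by (intro exI[of _ E]) (auto simp: E_def one_ereal_def not_less)
qed

end
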